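(* Let $f$ be an arithmetic function satisfying $f(n)\ll n^{\alpha}$ for some $\alpha\in[0,1)$, let $\varepsilon>0$, and let $d\ge 1$ be an integer with $d\ll x^{\frac{3-3\alpha}{14}-\varepsilon}$. Then, as $x\to\infty$, \[ S_{f,2}^{(d)}(x)=\frac{C_1(f)}{\zeta(2)}\,\frac{x}{d^2}\log\!\left(\frac{x}{d^2}\right)+C_f\,\frac{x}{d^2}+O\!\left(x^{\frac{4+3\alpha}{7}+\varepsilon}\right), \] where \[ C_f=\sum_{k=1}^{\infty}\frac{\mu(k)}{k^2}\bigl(C_2(f)-2C_1(f)\log k\bigr). \]
   Context: For a positive integer $n$ and integer $d\ge1$, $\tau_2^{(d)}(n)$ denotes the number of ordered pairs $(n_1,n_2)$ of positive integers with $n_1n_2=n$ and $\gcd(n_1,n_2)=d$. For real $x\ge1$, \[ S_{f,2}^{(d)}(x)=\sum_{n\le x}\tau_2^{(d)}(n)\,f\!\left(\left\lfloor \tfrac{x}{n}\right\rfloor\right). \] The constants are \[ C_1(f)=\sum_{k\ge1}\frac{f(k)}{k(k+1)},\qquad C_3(f)=\sum_{k\ge1}f(k)\left(\frac{\log k}{k}-\frac{\log(k+1)}{k+1}\right),\qquad C_2(f)=(2\gamma-1)C_1(f)-C_3(f), \] where $\gamma$ is Euler's constant, $\mu$ is the Möbius function and $\zeta$ is the Riemann zeta function. *)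

theory Defs
  imports
    "HOL-Analysis.Analysis"
    "HOL-Library.Landau_Symbols"
    "HOL-Computational_Algebra.Computational_Algebra"
begin

definition tau2 :: "nat \<Rightarrow> nat \<Rightarrow> nat" where
  "tau2 d n = card {(a, b). 0 < a \<and> 0 < b \<and> a * b = n \<and> gcd a b = d}"

definition S2 :: "(nat \<Rightarrow> complex) \<Rightarrow> nat \<Rightarrow> real \<Rightarrow> complex" where
  "S2 f d x = (\<Sum>n | 1 \<le> n \<and> real n \<le> x. of_nat (tau2 d n) * f (nat \<lfloor>x / real n\<rfloor>))"

definition moebius_mu :: "nat \<Rightarrow> int" where
  "moebius_mu n = (if squarefree n then (-1) ^ card (prime_factors n) else 0)"

text \<open>The Riemann zeta function, in its half-plane of absolute convergence \<open>Re s > 1\<close> only.\<close>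

definition zeta :: "complex \<Rightarrow> complex" where
  "zeta s = (\<Sum>\<^sub>\<infinity>n\<in>{1..}. 1 / of_nat n powr s)"

text \<open>
  The operator \<open>infsum\<close> stands for unconditional (here: absolute) convergence. The series below
  do converge absolutely as soon as \<open>f n = O(n powr \<alpha>)\<close> with \<open>\<alpha> < 1\<close>.
\<close>

definition C1 :: "(nat \<Rightarrow> complex) \<Rightarrow> complex" where
  "C1 f = (\<Sum>\<^sub>\<infinity>k\<in>{1..}. f k / of_nat (k * (k + 1)))"

definition C3 :: "(nat \<Rightarrow> complex) \<Rightarrow> complex" where
  "C3 f = (\<Sum>\<^sub>\<infinity>k\<in>{1..}. f k * of_real (ln (real k) / real k - ln (real (k + 1)) / real (k + 1)))"

definition C2 :: "(nat \<Rightarrow> complex) \<Rightarrow> complex" where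
  "C2 f = (2 * euler_mascheroni - 1) * C1 f - C3 f"

definition Cf :: "(nat \<Rightarrow> complex) \<Rightarrow> complex" where
  "Cf f = (\<Sum>\<^sub>\<infinity>k\<in>{1..}. of_int (moebius_mu k) / of_nat (k ^ 2) *
             (C2 f - 2 * C1 f * of_real (ln (real k))))"

end

theory Submission
  imports Defs
begin

text \<open>
  Writing \<open>y = x / d\<^sup>2\<close>, the sum runs over the coprime pairs \<open>(a, b)\<close> with \<open>a * b \<le> y\<close>, and Moebius
  inversion reduces it to the sums \<open>T z\<close> of \<open>f \<lfloor>z / (a * b)\<rfloor>\<close> over all pairs with \<open>a * b \<le> z\<close>, where
  \<open>z = y / e\<^sup>2\<close>. Grouping by the value \<open>k\<close> of the floor turns \<open>T z\<close> into a main term plus an error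
  governed by the sum of \<open>\<bar>\<Delta> (z / k)\<bar>\<close> over \<open>k \<le> z\<close> to the power \<open>3/7\<close>, with \<open>\<Delta>\<close> the error term of the
  Dirichlet divisor problem; larger \<open>k\<close> are estimated trivially.

  No pointwise bound for \<open>\<Delta>\<close> is needed. Since the summatory function of the divisor function is
  monotone, \<open>\<Delta> (z / k)\<close> is controlled by the mean of \<open>\<Delta>\<close> over short intervals around \<open>z / k\<close>, which are
  disjoint for different \<open>k\<close>, so the mean square bound of order \<open>N\<close> to the power \<open>3/2 + \<epsilon>\<close> for
  the sum of \<open>\<Delta> n\<close> squared over \<open>n \<le> N\<close> suffices.

  By the hyperbola method, \<open>\<Delta> n\<close> is essentially a sum over \<open>a \<le> \<surd>n\<close> of sawtooth functions of \<open>n mod a\<close>.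
  The product of the sawtooths of \<open>a\<close> and \<open>b\<close> has period \<open>a * b\<close> and mean of size at most
  \<open>(gcd a b)\<^sup>2 / (a * b)\<close>. Averaging repeatedly over windows of length \<open>T\<close> slightly larger than \<open>a * b\<close>
  shrinks the deviation from the mean by a factor \<open>a * b / T\<close> each time; so, without any Fourier
  analysis, only the means contribute.
\<close>

section \<open>Correlations of sawtooth functions\<close>

text \<open>All exponents come from two balances. For k near K the points z / k are about z / K^2
  apart. Windows of length h turn the mean square into (z / K)^(3/2) / h, while the main term varies
  by about h over a window, which costs K h^2 in all. Equality gives h = z^(1/2) K^(-5/6), and up to
  constants such windows stay disjoint as long as K \<le> z^(3/7). Cauchy-Schwarz then gives z^(1/2)
  K^(1/6) per block. With the factor K^\<alpha> from f this meets the trivial bound z K^(\<alpha> -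
  1) for the remaining k at that same K, whatever \<alpha> is. Two obstacles shape the mean square
  estimate. The number of sawtooths depends on n, so a bound for a fixed set of moduli has to be
  made uniform in the length of the sum. And the cut-off n \<le> N is sharp, whereas repeated
  averaging produces a smooth one; positivity of the square allows the exchange. Centring at (a - 1)
  / 2 instead of a / 2 makes the mean of \<open>saw a\<close> over the residues mod a exactly 0. The
  argument is an integer because the averages reach to the left of 0.\<close>

definition saw :: "nat \<Rightarrow> int \<Rightarrow> real" where
  "saw a n = (real_of_int (n mod int a) - (real a - 1) / 2) / real a"

lemma abs_saw_le:
  assumes "a > 0"
  shows "\<bar>saw a n\<bar> \<le> 1 / 2"
proof -
  have "0 \<le> n mod int a" "n mod int a \<le> int a - 1"
    using assms pos_mod_bound[of "int a" n] by auto
  hence "0 \<le> real_of_int (n mod int a)" "real_of_int (n mod int a) \<le> real a - 1"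
    by linarith+
  hence "\<bar>real_of_int (n mod int a) - (real a - 1) / 2\<bar> \<le> (real a) / 2"
    by (auto simp: abs_le_iff field_simps)
  thus ?thesis using assms by (simp add: saw_def abs_divide divide_simps)
qed

lemma saw_add_multiple: "saw a (n + int a * k) = saw a n"
  by (simp add: saw_def)

lemma sum_residues:
  fixes c q :: int
  assumes "m > 0" "coprime c (int m)"
  shows "(\<Sum>j<m. real_of_int ((q + c * int j) mod int m)) = real m * (real m - 1) / 2"
proof -
  let ?F = "\<lambda>j. nat ((q + c * int j) mod int m)"
  have inj: "inj_on ?F {..<m}"
  proof (rule inj_onI)
    fix i j assume ij: "i \<in> {..<m}" "j \<in> {..<m}" "?F i = ?F j"
    have "(q + c * int i) mod int m = (q + c * int j) mod int m"
      using ij(3) assms(1) by (metis eq_nat_nat_iff of_nat_0_less_iff pos_mod_sign)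
    hence "int m dvd (q + c * int i) - (q + c * int j)" by (simp add: mod_eq_dvd_iff)
    hence "int m dvd c * (int i - int j)" by (simp add: algebra_simps)
    hence "int m dvd int i - int j"
      using assms(2) by (metis coprime_commute coprime_dvd_mult_right_iff)
    hence "int i mod int m = int j mod int m" by (simp add: mod_eq_dvd_iff)
    thus "i = j" using ij by simp
  qed
  have sub: "?F ` {..<m} \<subseteq> {..<m}"
    using assms(1) by (auto simp: nat_less_iff)
  have "?F ` {..<m} = {..<m}"
    using inj sub by (simp add: endo_inj_surj)
  hence bij: "bij_betw ?F {..<m} {..<m}" using inj by (simp add: bij_betw_def)
  have "(\<Sum>j<m. real_of_int ((q + c * int j) mod int m)) = (\<Sum>j<m. real (?F j))"
    using assms(1) by (intro sum.cong) auto
  also have "\<dots> = (\<Sum>r<m. real r)" by (rule sum.reindex_bij_betw[OF bij])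
  also have "\<dots> = real m * (real m - 1) / 2"
    by (induction m) (simp_all add: field_simps)
  finally show ?thesis .
qed

text \<open>Discrete form of the multiplication formula for the first Bernoulli function. Modulo g m
  the points are the residues congruent to u mod g, each hit once because multiplication by c
  permutes the residues mod m. The centring in \<open>saw\<close> makes the constants cancel without
  remainder.\<close>

lemma sum_saw_progression:
  assumes "g > 0" "m > 0" "coprime c m"
  shows "(\<Sum>j<m. saw (g * m) (u + int (g * c) * int j)) = saw g u"
proof -
  have *: "(u + int (g * c) * int j) mod int (g * m)
        = u mod int g + int g * ((u div int g + int c * int j) mod int m)" for j
  proof -
    have "(u + int (g * c) * int j) = u + (int c * int j) * int g" by simp
    hence "(u + int (g * c) * int j) div int g = u div int g + int c * int j"
      "(u + int (g * c) * int j) mod int g = u mod int g"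
      using assms(1) by (simp_all only: div_mult_self1 mod_mult_self1)
    moreover have "(u + int (g * c) * int j) mod (int g * int m)
       = int g * ((u + int (g * c) * int j) div int g mod int m) + (u + int (g * c) * int j) mod int g"
      by (rule zmod_zmult2_eq) simp
    ultimately show ?thesis by simp
  qed
  have co: "coprime (int c) (int m)" using assms(3) by simp
  have "(\<Sum>j<m. saw (g * m) (u + int (g * c) * int j)) =
    (\<Sum>j<m. (real_of_int (u mod int g) - (real (g * m) - 1) / 2) / real (g * m)
        + real_of_int ((u div int g + int c * int j) mod int m) / real m)"
    unfolding saw_def * using assms by (intro sum.cong refl) (simp add: field_simps)
  also have "\<dots> = real m * ((real_of_int (u mod int g) - (real (g * m) - 1) / 2) / real (g * m))
      + (real m * (real m - 1) / 2) / real m"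
    unfolding sum.distrib sum_divide_distrib[symmetric] sum_residues[OF assms(2) co] by simp
  also have "\<dots> = saw g u"
    using assms by (simp add: saw_def field_simps)
  finally show ?thesis .
qed

lemma sum_window_shift:
  fixes h :: "int \<Rightarrow> real"
  assumes "\<And>n. h (n + int L) = h n"
  shows "(\<Sum>s<L. h (n + int s)) = (\<Sum>s<L. h (int s))"
proof -
  have step: "(\<Sum>s<L. h (n + 1 + int s)) = (\<Sum>s<L. h (n + int s))" for n
  proof -
    have "h n + (\<Sum>s<L. h (n + 1 + int s)) = (\<Sum>s<Suc L. h (n + int s))"
      by (subst sum.lessThan_Suc_shift) (simp add: algebra_simps)
    also have "\<dots> = (\<Sum>s<L. h (n + int s)) + h n" using assms by simp
    finally show ?thesis by simp
  qed
  show ?thesis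
  proof (induction n rule: int_induct[where k = 0])
    case base thus ?case by simp
  next
    case (step1 i) thus ?case using step[of i] by simp
  next
    case (step2 i) thus ?case using step[of "i - 1"] by simp
  qed
qed

lemma sum_blocks:
  fixes h :: "nat \<Rightarrow> real"
  shows "(\<Sum>s<a * b. h s) = (\<Sum>j<a. \<Sum>u<b. h (j * b + u))"
proof -
  have "(\<Sum>s<a * b. h s) = (\<Sum>j<a. sum h {j * b..<j * b + b})"
    by (rule sum.nat_group[symmetric])
  also have "\<dots> = (\<Sum>j<a. \<Sum>u<b. h (j * b + u))"
  proof (rule sum.cong[OF refl])
    fix j
    have "sum h {0 + j * b..<b + j * b} = (\<Sum>u = 0..<b. h (u + j * b))"
      by (rule sum.shift_bounds_nat_ivl)
    thus "sum h {j * b..<j * b + b} = (\<Sum>u<b. h (j * b + u))"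
      by (simp add: add.commute lessThan_atLeast0)
  qed
  finally show ?thesis .
qed

text \<open>With s = j b + u, \<open>saw b\<close> sees only u, and summing \<open>saw a\<close>
  over j covers the residues mod a congruent to u mod g, each g times, which collapses to g times
  \<open>saw g\<close>. What remains is cut into blocks of length g, and \<open>saw b\<close>
  collapses to \<open>saw g\<close> in the same way. Only the gcd is left of the two moduli.\<close>

lemma sum_saw_product:
  fixes a b :: nat
  assumes "a > 0" "b > 0"
  shows "(\<Sum>s<a * b. saw a (n + int s) * saw b (n + int s))
           = real (gcd a b) * (\<Sum>v<gcd a b. (saw (gcd a b) (n + int v))\<^sup>2)"
proof -
  define g where "g = gcd a b"
  obtain a' b' where ab: "a = g * a'" "b = g * b'" "coprime a' b'"
    using assms gcd_coprime_exists[of a b] unfolding g_def by (metis gcd_eq_0_iff mult.commute not_gr0)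
  have pos: "g > 0" "a' > 0" "b' > 0" using assms ab by auto
  have full: "(\<Sum>j<a. saw a (u + int b * int j)) = real g * saw g u" for u
  proof -
    have "(\<Sum>j<a. saw a (u + int b * int j)) = (\<Sum>i<g. \<Sum>j<a'. saw a (u + int b * int (i * a' + j)))"
      unfolding ab(1) by (rule sum_blocks)
    also have "\<dots> = (\<Sum>i<g. \<Sum>j<a'. saw (g * a') (u + int (g * b') * int j))"
    proof (intro sum.cong refl)
      fix i j
      \<comment> \<open>Since b a' = a b', the next block shifts the argument by a multiple of a, so
        all g blocks have the same sum.\<close>
      have "u + int b * int (i * a' + j) = (u + int (g * b') * int j) + int a * (int b' * int i)"
        by (simp add: ab algebra_simps)
      thus "saw a (u + int b * int (i * a' + j)) = saw (g * a') (u + int (g * b') * int j)"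
        by (simp only: saw_add_multiple) (simp add: ab)
    qed
    also have "\<dots> = real g * saw g u"
      using sum_saw_progression[of g a' b' u] pos ab(3) by (simp add: coprime_commute)
    finally show ?thesis .
  qed
  have part: "(\<Sum>i<b'. saw b (u + int g * int i)) = saw g u" for u
    using sum_saw_progression[of g b' 1 u] pos ab by simp
  have "(\<Sum>s<a * b. saw a (n + int s) * saw b (n + int s))
      = (\<Sum>j<a. \<Sum>u<b. saw a (n + int u + int b * int j) * saw b (n + int u))"
    unfolding sum_blocks
  proof (intro sum.cong refl)
    fix j u
    have "n + int (j * b + u) = n + int u + int b * int j" by (simp add: algebra_simps)
    thus "saw a (n + int (j * b + u)) * saw b (n + int (j * b + u)) =
       saw a (n + int u + int b * int j) * saw b (n + int u)"
      by (simp only: saw_add_multiple)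
  qed
  also have "\<dots> = (\<Sum>u<b. (\<Sum>j<a. saw a (n + int u + int b * int j)) * saw b (n + int u))"
    by (subst sum.swap) (simp add: sum_distrib_right)
  also have "\<dots> = real g * (\<Sum>u<b' * g. saw g (n + int u) * saw b (n + int u))"
    unfolding full by (simp add: sum_distrib_left mult_ac ab(2))
  also have "(\<Sum>u<b' * g. saw g (n + int u) * saw b (n + int u))
     = (\<Sum>i<b'. \<Sum>v<g. saw g (n + int v) * saw b (n + int v + int g * int i))"
    unfolding sum_blocks
  proof (intro sum.cong refl)
    fix i v
    have "n + int (i * g + v) = n + int v + int g * int i" by (simp add: algebra_simps)
    thus "saw g (n + int (i * g + v)) * saw b (n + int (i * g + v)) =
       saw g (n + int v) * saw b (n + int v + int g * int i)"
      by (simp only: saw_add_multiple)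
  qed
  also have "\<dots> = (\<Sum>v<g. saw g (n + int v) * (\<Sum>i<b'. saw b (n + int v + int g * int i)))"
    by (subst sum.swap) (simp add: sum_distrib_left)
  also have "\<dots> = (\<Sum>v<g. (saw g (n + int v))\<^sup>2)"
    unfolding part by (simp add: power2_eq_square)
  finally show ?thesis unfolding g_def .
qed

section \<open>Repeated averaging of periodic functions with mean zero\<close>

text \<open>For L > 0 this packs two properties into one: comparing adjacent windows gives the
  period L, and the mean over a period is 0. In this form it passes through every average with the
  same L.\<close>

definition zero_windows :: "nat \<Rightarrow> (int \<Rightarrow> real) \<Rightarrow> bool" where
  "zero_windows L h \<longleftrightarrow> (\<forall>n. (\<Sum>s<L. h (n + int s)) = 0)"

definition avg :: "nat \<Rightarrow> (int \<Rightarrow> real) \<Rightarrow> int \<Rightarrow> real" where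
  "avg T h n = (\<Sum>s<T. h (n + int s)) / real T"

text \<open>Complete windows of length L vanish and can be stripped off, so fewer than L terms
  remain, however large T is.\<close>

lemma zero_windows_sum_bound:
  assumes "zero_windows L h" "L > 0" "\<And>n. \<bar>h n\<bar> \<le> B"
  shows "\<bar>\<Sum>s<T. h (n + int s)\<bar> \<le> real L * B"
proof (induction T arbitrary: n rule: less_induct)
  case (less T)
  have B: "B \<ge> 0" using assms(3)[of 0] by linarith
  show ?case
  proof (cases "T < L")
    case True
    have "\<bar>\<Sum>s<T. h (n + int s)\<bar> \<le> (\<Sum>s<T. \<bar>h (n + int s)\<bar>)" by (rule sum_abs)
    also have "\<dots> \<le> real (card {..<T}) * B" using assms(3) by (intro sum_bounded_above)
    also have "\<dots> \<le> real L * B" using True B by (intro mult_right_mono) auto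
    finally show ?thesis .
  next
    case False
    have "(\<Sum>s<T. h (n + int s)) = (\<Sum>s<L. h (n + int s)) + (\<Sum>s<T - L. h (n + int L + int s))"
    proof -
      have "(\<Sum>s<L + (T - L). h (n + int s))
          = (\<Sum>s<L. h (n + int s)) + (\<Sum>s<T - L. h (n + int (L + s)))"
      proof -
        have un: "{..<L + (T - L)} = {..<L} \<union> {L..<L + (T - L)}" by auto
        have "(\<Sum>s<L + (T - L). h (n + int s))
          = (\<Sum>s<L. h (n + int s)) + (\<Sum>s\<in>{L..<L + (T - L)}. h (n + int s))"
          by (subst un, rule sum.union_disjoint) auto
        also have "(\<Sum>s\<in>{L..<L + (T - L)}. h (n + int s)) = (\<Sum>s<T - L. h (n + int (L + s)))"
          using sum.shift_bounds_nat_ivl[of "\<lambda>s. h (n + int s)" 0 L "T - L"]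
          by (simp add: add.commute lessThan_atLeast0)
        finally show ?thesis .
      qed
      thus ?thesis using False by (simp add: algebra_simps)
    qed
    also have "(\<Sum>s<L. h (n + int s)) = 0" using assms(1) by (simp add: zero_windows_def)
    finally show ?thesis using less.IH[of "T - L" "n + int L"] False assms(2) by simp
  qed
qed

lemma zero_windows_avg:
  assumes "zero_windows L h"
  shows "zero_windows L (avg T h)"
  unfolding zero_windows_def
proof
  fix n
  have "(\<Sum>u<L. avg T h (n + int u)) = (\<Sum>s<T. \<Sum>u<L. h ((n + int s) + int u)) / real T"
    unfolding avg_def by (subst sum.swap) (simp add: sum_divide_distrib algebra_simps)
  also have "\<dots> = 0" using assms by (simp add: zero_windows_def)
  finally show "(\<Sum>u<L. avg T h (n + int u)) = 0" .
qed

lemma abs_avg_le: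
  assumes "\<And>n. \<bar>h n\<bar> \<le> B"
  shows "\<bar>avg T h n\<bar> \<le> B"
proof (cases "T = 0")
  case True thus ?thesis using assms[of 0] by (simp add: avg_def)
next
  case False
  have "\<bar>\<Sum>s<T. h (n + int s)\<bar> \<le> (\<Sum>s<T. \<bar>h (n + int s)\<bar>)" by (rule sum_abs)
  also have "\<dots> \<le> real (card {..<T}) * B" using assms by (intro sum_bounded_above)
  finally show ?thesis using False by (simp add: avg_def abs_divide divide_simps mult.commute)
qed

text \<open>An average divides a sum of at most L times the sup norm by T, and the result again has
  zero windows of the same length L. So the gain L / T can be collected m times, which takes the
  place of the decay of Fourier coefficients.\<close>

lemma abs_iterated_avg_le:
  assumes "zero_windows L h" "L > 0" "T > 0" "\<And>n. \<bar>h n\<bar> \<le> B"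
  shows "\<bar>(avg T ^^ m) h n\<bar> \<le> (real L / real T) ^ m * B"
proof -
  have "zero_windows L ((avg T ^^ m) h) \<and> (\<forall>n. \<bar>(avg T ^^ m) h n\<bar> \<le> (real L / real T) ^ m * B)"
  proof (induction m)
    case 0 thus ?case using assms by simp
  next
    case (Suc m)
    have "\<bar>\<Sum>s<T. (avg T ^^ m) h (n + int s)\<bar> \<le> real L * ((real L / real T) ^ m * B)" for n
      using Suc assms(2) by (intro zero_windows_sum_bound) auto
    hence "\<bar>avg T ((avg T ^^ m) h) n\<bar> \<le> (real L / real T) ^ Suc m * B" for n
      using assms(3) unfolding avg_def[of T "(avg T ^^ m) h"]
      by (simp add: abs_divide divide_simps mult_ac)
    thus ?case using Suc zero_windows_avg by simp
  qed
  thus ?thesis by simp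
qed

lemma avg_sum: "avg T (\<lambda>n. \<Sum>i\<in>I. h i n) = (\<lambda>n. \<Sum>i\<in>I. avg T (h i) n)"
  unfolding avg_def by (auto simp: fun_eq_iff sum_divide_distrib[symmetric] intro: sum.swap)

lemma iterated_avg_sum: "(avg T ^^ m) (\<lambda>n. \<Sum>i\<in>I. h i n) = (\<lambda>n. \<Sum>i\<in>I. (avg T ^^ m) (h i) n)"
proof (induction m)
  case 0
  show ?case by (simp only: funpow_0)
next
  case (Suc m)
  have "(avg T ^^ Suc m) (\<lambda>n. \<Sum>i\<in>I. h i n) = avg T ((avg T ^^ m) (\<lambda>n. \<Sum>i\<in>I. h i n))"
    by (simp only: funpow.simps comp_apply)
  also have "\<dots> = avg T (\<lambda>n. \<Sum>i\<in>I. (avg T ^^ m) (h i) n)"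
    by (rule arg_cong[OF Suc.IH])
  also have "\<dots> = (\<lambda>n. \<Sum>i\<in>I. avg T ((avg T ^^ m) (h i)) n)"
    by (rule avg_sum)
  finally show ?case by (simp only: funpow.simps comp_apply)
qed

lemma avg_add_const:
  assumes "T > 0"
  shows "avg T (\<lambda>n. h n + c) = (\<lambda>n. avg T h n + c)"
  using assms by (simp add: avg_def fun_eq_iff sum.distrib add_divide_distrib)

lemma iterated_avg_add_const:
  assumes "T > 0"
  shows "(avg T ^^ m) (\<lambda>n. h n + c) = (\<lambda>n. (avg T ^^ m) h n + c)"
proof (induction m)
  case (Suc m)
  show ?case by (simp only: funpow.simps comp_apply Suc.IH) (rule avg_add_const[OF assms])
qed simp

text \<open>\<open>avg T\<close> looks forward, so the m-fold average at t - m T is a weighted mean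
  of values of h between t - m T and t.\<close>

lemma iterated_avg_ge:
  assumes "T > 0" "\<And>n. t - int (m * T) \<le> n \<Longrightarrow> n \<le> t \<Longrightarrow> c \<le> h n"
  shows "c \<le> (avg T ^^ m) h (t - int (m * T))"
  using assms(2)
proof (induction m arbitrary: h)
  case 0 thus ?case by simp
next
  case (Suc m)
  have "c \<le> avg T h n" if n: "t - int (Suc m * T) \<le> n" "n \<le> t - int T" for n
  proof -
    have "real (card {..<T}) * c \<le> (\<Sum>s<T. h (n + int s))"
      using n by (intro sum_bounded_below Suc.prems) auto
    thus ?thesis using assms(1) by (simp add: avg_def divide_simps mult.commute)
  qed
  \<comment> \<open>The bound for \<open>avg T h\<close> holds only up to t - T, whereas the
    induction hypothesis asks for an interval ending at t; hence the translation by T.\<close>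
  hence "c \<le> avg T h (n - int T)" if "t - int (m * T) \<le> n" "n \<le> t" for n
    using that by simp
  hence "c \<le> (avg T ^^ m) (\<lambda>n. avg T h (n - int T)) (t - int (m * T))"
    by (intro Suc.IH) auto
  also have "(avg T ^^ m) (\<lambda>n. avg T h (n - int T)) = (\<lambda>n. (avg T ^^ m) (avg T h) (n - int T))"
  proof -
    have "(avg T ^^ m) (\<lambda>n. k (n - c)) = (\<lambda>n. (avg T ^^ m) k (n - c))" for k :: "int \<Rightarrow> real" and c
      by (induction m) (simp_all add: avg_def fun_eq_iff algebra_simps)
    thus ?thesis .
  qed
  finally show ?case
    by (simp only: funpow_Suc_right comp_def) (simp add: algebra_simps)
qed

text \<open>A window of length (m + 1) T starting anywhere between - m T and 0 contains all n < N,
  as N \<le> T. Since h is nonnegative, its sum dominates the sharp one, and so does a mean of such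
  sums. The sharp cut-off becomes a smooth weight of total mass (m + 1) T.\<close>

lemma sum_le_iterated_avg:
  fixes h :: "int \<Rightarrow> real"
  assumes "T > 0" "N \<le> T" "\<And>n. h n \<ge> 0"
  shows "(\<Sum>n<N. h (int n))
    \<le> real ((m + 1) * T) * (avg T ^^ m) (avg ((m + 1) * T) h) (- int (m * T))"
proof -
  let ?U = "(m + 1) * T"
  have U: "?U > 0" using assms(1) by simp
  have "(\<Sum>n<N. h (int n)) / real ?U \<le> (avg T ^^ m) (avg ?U h) (0 - int (m * T))"
  proof (rule iterated_avg_ge[OF assms(1)])
    fix n :: int assume n: "0 - int (m * T) \<le> n" "n \<le> 0"
    have inj: "inj_on (\<lambda>j. nat (int j - n)) {..<N}" using n by (auto simp: inj_on_def)
    have "(\<Sum>j<N. h (int j)) = (\<Sum>s\<in>(\<lambda>j. nat (int j - n)) ` {..<N}. h (n + int s))"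
      using n by (subst sum.reindex[OF inj]) (auto intro!: sum.cong)
    also have "\<dots> \<le> (\<Sum>s<?U. h (n + int s))"
    proof (rule sum_mono2)
      show "(\<lambda>j. nat (int j - n)) ` {..<N} \<subseteq> {..<?U}"
      proof
        fix s assume "s \<in> (\<lambda>j. nat (int j - n)) ` {..<N}"
        then obtain j where "j < N" "s = nat (int j - n)" by auto
        hence "int s < int T + int (m * T)" using n assms(2) by linarith
        hence "s < T + m * T" by (metis of_nat_add of_nat_less_iff)
        thus "s \<in> {..<?U}" by simp
      qed
    qed (use assms in auto)
    finally show "(\<Sum>n<N. h (int n)) / real ?U \<le> avg ?U h n"
      unfolding avg_def by (rule divide_right_mono) simp
  qed
  thus ?thesis using U by (simp only: pos_divide_le_eq of_nat_0_less_iff) (simp add: mult_ac)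
qed

text \<open>Expanding the square leaves a function of period a b for each pair of moduli. Its mean
  survives the averages and yields the gcd term by \<open>sum_saw_product\<close>; the centred rest
  has zero windows of length a b, so m averages over T leave at most (a b / T)^m of it.\<close>

lemma mean_square_saw_sum:
  assumes I: "finite I" "\<And>a. a \<in> I \<Longrightarrow> a > 0" and T: "T > 0" "N \<le> T"
  shows "(\<Sum>n<N. (\<Sum>a\<in>I. saw a (int n))\<^sup>2)
    \<le> real ((m + 1) * T) * (\<Sum>a\<in>I. \<Sum>b\<in>I. (real (gcd a b))\<^sup>2 / (real a * real b) + (real a * real b / real T) ^ m)"
proof -
  define H where "H = (\<lambda>(a, b) n. saw a n * saw b n)"
  define \<mu> where "\<mu> = (\<lambda>(a, b). (\<Sum>s<a * b. saw a (int s) * saw b (int s)) / (real a * real b))"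
  let ?U = "(m + 1) * T" and ?t = "- int (m * T)"
  have U: "?U > 0" using T by simp
  have sq: "(\<Sum>a\<in>I. saw a n)\<^sup>2 = (\<Sum>p\<in>I \<times> I. H p n)" for n
    by (simp add: power2_eq_square sum_product sum.cartesian_product H_def case_prod_unfold)
  have each: "(avg T ^^ m) (avg ?U (H (a, b))) ?t
     \<le> (real (gcd a b))\<^sup>2 / (real a * real b) + (real a * real b / real T) ^ m"
    if ab: "a \<in> I" "b \<in> I" for a b
  proof -
    have pos: "a > 0" "b > 0" using I ab by auto
    have prod: "\<bar>saw a n * saw b n\<bar> \<le> 1 / 4" for n
      using mult_mono[OF abs_saw_le[OF pos(1)] abs_saw_le[OF pos(2)]] by (simp add: abs_mult)
    define g where "g = gcd a b"
    have g: "g > 0" using pos by (simp add: g_def)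
    have mu_eq: "\<mu> (a, b) = real g * (\<Sum>v<g. (saw g (int v))\<^sup>2) / (real a * real b)"
      using sum_saw_product[OF pos, of 0] by (simp add: \<mu>_def g_def)
    have "(saw g v)\<^sup>2 \<le> 1 / 4" for v
      using abs_saw_le[OF g] power_mono[of "\<bar>saw g v\<bar>" "1 / 2" 2] by (simp add: power2_eq_square)
    hence "(\<Sum>v<g. (saw g (int v))\<^sup>2) \<le> real (card {..<g}) * (1 / 4)"
      by (intro sum_bounded_above) auto
    hence "real g * (\<Sum>v<g. (saw g (int v))\<^sup>2) \<le> real g * (real g * (1 / 4))"
      by (intro mult_left_mono) auto
    hence "\<mu> (a, b) \<le> real g * (real g * (1 / 4)) / (real a * real b)"
      unfolding mu_eq using pos by (intro divide_right_mono) auto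
    hence mu_le: "\<mu> (a, b) \<le> (real g)\<^sup>2 / (real a * real b) / 4"
      by (simp add: power2_eq_square)
    have mu_ge: "\<mu> (a, b) \<ge> 0" unfolding mu_eq by (intro divide_nonneg_nonneg mult_nonneg_nonneg sum_nonneg) auto
    have g2: "(real g)\<^sup>2 \<le> real a * real b"
    proof -
      have "g \<le> a" "g \<le> b" using pos by (auto simp: g_def)
      thus ?thesis by (simp add: power2_eq_square mult_mono)
    qed
    hence "(real g)\<^sup>2 / (real a * real b) \<le> 1" using pos by simp
    hence "(real g)\<^sup>2 / (real a * real b) / 4 \<le> 1 / 4" by (rule divide_right_mono) simp
    hence mu_le1: "\<mu> (a, b) \<le> 1 / 4" using mu_le by (rule order.trans[rotated])
    \<comment> \<open>The product with its mean removed. The product is at most 1/4 in absolute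
      value and the mean lies between 0 and 1/4, so 1 is a generous bound.\<close>
    define h where "h = (\<lambda>n. H (a, b) n + (- \<mu> (a, b)))"
    have hb: "\<bar>h n\<bar> \<le> 1" for n
      using abs_le_D1[OF prod[of n]] abs_le_D2[OF prod[of n]] mu_ge mu_le1
      by (simp add: h_def H_def abs_le_iff)
    have "zero_windows (a * b) h"
      unfolding zero_windows_def
    proof
      fix n
      have "(\<Sum>s<a * b. saw a (n + int s) * saw b (n + int s))
          = (\<Sum>s<a * b. saw a (int s) * saw b (int s))"
      proof (rule sum_window_shift[of "\<lambda>n. saw a n * saw b n"])
        fix n
        have "saw a (n + int (a * b)) = saw a (n + int a * int b)" "saw b (n + int (a * b)) = saw b (n + int b * int a)"
          by (simp_all add: mult.commute)
        thus "saw a (n + int (a * b)) * saw b (n + int (a * b)) = saw a n * saw b n"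
          by (simp only: saw_add_multiple)
      qed
      thus "(\<Sum>s<a * b. h (n + int s)) = 0"
        using pos by (simp add: h_def H_def \<mu>_def sum_subtractf)
    qed
    hence "zero_windows (a * b) (avg ?U h)" by (rule zero_windows_avg)
    hence "\<bar>(avg T ^^ m) (avg ?U h) ?t\<bar> \<le> (real (a * b) / real T) ^ m * 1"
      using pos T abs_avg_le[of h 1, OF hb] by (intro abs_iterated_avg_le) auto
    moreover have "(avg T ^^ m) (avg ?U h) ?t = (avg T ^^ m) (avg ?U (H (a, b))) ?t - \<mu> (a, b)"
      unfolding h_def avg_add_const[OF U] iterated_avg_add_const[OF T(1)] by simp
    ultimately have "(avg T ^^ m) (avg ?U (H (a, b))) ?t \<le> (real a * real b / real T) ^ m + \<mu> (a, b)"
      by (simp add: abs_le_iff)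
    also have "\<dots> \<le> (real a * real b / real T) ^ m + (real g)\<^sup>2 / (real a * real b)"
    proof -
      have quarter: "x / 4 \<le> x" if "x \<ge> 0" for x :: real using that by simp
      have "(real g)\<^sup>2 / (real a * real b) / 4 \<le> (real g)\<^sup>2 / (real a * real b)"
        by (rule quarter) simp
      thus ?thesis using mu_le by (intro add_left_mono) (rule order.trans)
    qed
    finally show ?thesis unfolding g_def by (simp add: add.commute)
  qed
  have "(\<Sum>n<N. (\<Sum>a\<in>I. saw a (int n))\<^sup>2)
     \<le> real ?U * (avg T ^^ m) (avg ?U (\<lambda>n. (\<Sum>a\<in>I. saw a n)\<^sup>2)) ?t"
    by (rule sum_le_iterated_avg[OF T]) simp
  also have "(avg T ^^ m) (avg ?U (\<lambda>n. (\<Sum>a\<in>I. saw a n)\<^sup>2)) ?t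
     = (\<Sum>p\<in>I \<times> I. (avg T ^^ m) (avg ?U (H p)) ?t)"
    unfolding sq avg_sum iterated_avg_sum by (rule refl)
  also have "\<dots> = (\<Sum>a\<in>I. \<Sum>b\<in>I. (avg T ^^ m) (avg ?U (H (a, b))) ?t)"
    by (simp add: sum.cartesian_product case_prod_unfold)
  also have "real ?U * \<dots> \<le> real ?U * (\<Sum>a\<in>I. \<Sum>b\<in>I. (real (gcd a b))\<^sup>2 / (real a * real b) + (real a * real b / real T) ^ m)"
    using each by (intro mult_left_mono sum_mono) auto
  finally show ?thesis .
qed

text \<open>The device of Rademacher and Menshov: a prefix sum is a sum of at most one block per dyadic
  level, so its square is bounded, uniformly in its length, by the squares of all dyadic blocks.\<close>

fun dyadic_squares :: "(nat \<Rightarrow> real) \<Rightarrow> nat \<Rightarrow> nat \<Rightarrow> real" where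
  "dyadic_squares s 0 A = (s A)\<^sup>2"
| "dyadic_squares s (Suc k) A = (\<Sum>a\<in>{A..<A + 2 ^ Suc k}. s a)\<^sup>2
     + dyadic_squares s k A + dyadic_squares s k (A + 2 ^ k)"

lemma dyadic_squares_nonneg: "dyadic_squares s k A \<ge> 0"
  by (induction k arbitrary: A) auto

lemma block_le_dyadic_squares: "(\<Sum>a\<in>{A..<A + 2 ^ k}. s a)\<^sup>2 \<le> dyadic_squares s k A"
proof (cases k)
  case (Suc j)
  thus ?thesis using dyadic_squares_nonneg[of s j A] dyadic_squares_nonneg[of s j "A + 2 ^ j"]
    by simp
qed simp

lemma prefix_square_le_dyadic_squares:
  assumes "B \<le> 2 ^ k"
  shows "(\<Sum>a\<in>{A..<A + B}. s a)\<^sup>2 \<le> real (k + 1) * dyadic_squares s k A"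
  using assms
proof (induction k arbitrary: A B)
  case 0
  hence "B = 0 \<or> B = 1" by auto
  thus ?case by auto
next
  case (Suc k)
  let ?D = "dyadic_squares s k A" and ?E = "dyadic_squares s k (A + 2 ^ k)"
  have nn: "?D \<ge> 0" "?E \<ge> 0" by (rule dyadic_squares_nonneg)+
  have le: "real (k + 2) * (?D + ?E) \<le> real (Suc k + 1) * dyadic_squares s (Suc k) A"
    using nn by (intro mult_mono) auto
  show ?case
  proof (cases "B \<le> 2 ^ k")
    case True
    have "(\<Sum>a\<in>{A..<A + B}. s a)\<^sup>2 \<le> real (k + 1) * ?D" by (rule Suc.IH[OF True])
    also have "\<dots> \<le> real (k + 2) * (?D + ?E)" using nn by (intro mult_mono) auto
    finally show ?thesis using le by linarith
  next
    case False
    define x where "x = (\<Sum>a\<in>{A..<A + 2 ^ k}. s a)"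
    define y where "y = (\<Sum>a\<in>{A + 2 ^ k..<(A + 2 ^ k) + (B - 2 ^ k)}. s a)"
    have split: "(\<Sum>a\<in>{A..<A + B}. s a) = x + y"
    proof -
      have un: "{A..<A + B} = {A..<A + 2 ^ k} \<union> {A + 2 ^ k..<(A + 2 ^ k) + (B - 2 ^ k)}"
        using False by auto
      show ?thesis unfolding x_def y_def by (subst un, rule sum.union_disjoint) auto
    qed
    have x: "x\<^sup>2 \<le> ?D" unfolding x_def by (rule block_le_dyadic_squares)
    have "B - 2 ^ k \<le> 2 ^ k" using Suc.prems by simp
    hence y: "y\<^sup>2 \<le> real (k + 1) * ?E" unfolding y_def by (rule Suc.IH)
    \<comment> \<open>Weight for splitting the mixed term. The left half is a complete block with
      constant 1, the right half carries k + 1; with weight k + 1 the constant grows only by 1, to k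
      + 2.\<close>
    define r where "r = real (k + 1)"
    have r: "r > 0" by (simp add: r_def)
    have "2 * x * y \<le> r * x\<^sup>2 + y\<^sup>2 / r"
    proof -
      have "0 \<le> (r * x - y)\<^sup>2 / r" using r by simp
      also have "\<dots> = r * x\<^sup>2 - 2 * x * y + y\<^sup>2 / r"
        using r by (simp add: power2_eq_square field_simps)
      finally show ?thesis by simp
    qed
    hence "(x + y)\<^sup>2 \<le> (r * x\<^sup>2 + x\<^sup>2) + (y\<^sup>2 + y\<^sup>2 / r)"
      by (simp add: power2_sum)
    also have "\<dots> = (r + 1) * (x\<^sup>2 + y\<^sup>2 / r)"
      using r by (simp add: field_simps)
    also have "\<dots> \<le> (r + 1) * (?D + ?E)"
      using x y r by (intro mult_left_mono add_mono) (auto simp: r_def divide_simps mult_ac)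
    also have "r + 1 = real (k + 2)" by (simp add: r_def)
    finally show ?thesis using le unfolding split by linarith
  qed
qed

text \<open>The blocks I of one dyadic level are disjoint, so with q nonnegative the sums of q over
  the sets I \<times> I add up to at most the sum over the whole square. Hence each of the k + 1
  levels costs no more than the undivided interval.\<close>

lemma sum_dyadic_squares_le:
  fixes s :: "'a \<Rightarrow> nat \<Rightarrow> real"
  assumes q: "\<And>a b. q a b \<ge> 0" and V: "V \<ge> 0"
    and block: "\<And>I. finite I \<Longrightarrow> I \<subseteq> {A0..} \<Longrightarrow> (\<Sum>n\<in>X. (\<Sum>a\<in>I. s n a)\<^sup>2) \<le> V * (\<Sum>a\<in>I. \<Sum>b\<in>I. q a b)"
    and "A \<ge> A0"
  shows "(\<Sum>n\<in>X. dyadic_squares (s n) k A)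
    \<le> real (k + 1) * (V * (\<Sum>a\<in>{A..<A + 2 ^ k}. \<Sum>b\<in>{A..<A + 2 ^ k}. q a b))"
  using assms(4)
proof (induction k arbitrary: A)
  case 0
  thus ?case using block[of "{A}"] by simp
next
  case (Suc k)
  let ?I = "{A..<A + 2 ^ Suc k}" and ?J = "{A..<A + 2 ^ k}" and ?K = "{A + 2 ^ k..<A + 2 ^ k + 2 ^ k}"
  let ?Q = "\<lambda>I. \<Sum>a\<in>I. \<Sum>b\<in>I. q a b"
  have "(\<Sum>n\<in>X. dyadic_squares (s n) (Suc k) A) = (\<Sum>n\<in>X. (\<Sum>a\<in>?I. s n a)\<^sup>2)
     + (\<Sum>n\<in>X. dyadic_squares (s n) k A) + (\<Sum>n\<in>X. dyadic_squares (s n) k (A + 2 ^ k))"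
    by (simp add: sum.distrib)
  also have "\<dots> \<le> V * ?Q ?I + real (k + 1) * (V * ?Q ?J) + real (k + 1) * (V * ?Q ?K)"
    using Suc.prems by (intro add_mono block Suc.IH) auto
  also have "\<dots> = V * ?Q ?I + real (k + 1) * (V * (?Q ?J + ?Q ?K))"
    by (simp add: algebra_simps)
  also have "\<dots> \<le> V * ?Q ?I + real (k + 1) * (V * ?Q ?I)"
  proof -
    have "?Q ?J + ?Q ?K \<le> ?Q ?I"
    proof -
      have un: "?I = ?J \<union> ?K" by auto
      have "?Q ?I = (\<Sum>a\<in>?J. \<Sum>b\<in>?I. q a b) + (\<Sum>a\<in>?K. \<Sum>b\<in>?I. q a b)"
        by (subst un, rule sum.union_disjoint) auto
      moreover have "?Q ?J \<le> (\<Sum>a\<in>?J. \<Sum>b\<in>?I. q a b)"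
        using q by (intro sum_mono sum_mono2) auto
      moreover have "?Q ?K \<le> (\<Sum>a\<in>?K. \<Sum>b\<in>?I. q a b)"
        using q by (intro sum_mono sum_mono2) auto
      ultimately show ?thesis by linarith
    qed
    thus ?thesis
      using V by (intro add_left_mono mult_left_mono) auto
  qed
  finally have "(\<Sum>n\<in>X. dyadic_squares (s n) (Suc k) A) \<le> V * ?Q ?I + real (k + 1) * (V * ?Q ?I)" .
  thus ?case by (simp add: algebra_simps)
qed

text \<open>The gcd is one common divisor among others. Allowing every common divisor g decouples a
  from b: for fixed g the double sum is the square of a sum over multiples of g, which is at most a
  harmonic number.\<close>

lemma sum_gcd_square_le:
  "(\<Sum>a\<in>{1..A}. \<Sum>b\<in>{1..A}. (real (gcd a b))\<^sup>2 / (real a * real b)) \<le> real A * (harm A)\<^sup>2"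
proof -
  define w where "w = (\<lambda>g a. if g dvd a then real g / real a else 0)"
  have wle: "(\<Sum>a\<in>{1..A}. w g a) \<le> harm A" if g: "g \<in> {1..A}" for g
  proof -
    have "(\<Sum>a\<in>{1..A}. w g a) = (\<Sum>a\<in>{a \<in> {1..A}. g dvd a}. real g / real a)"
      unfolding w_def by (rule sum.inter_filter[symmetric]) simp
    also have "\<dots> \<le> (\<Sum>c\<in>{1..A}. 1 / real c)"
    proof (rule sum_le_included[where i = "\<lambda>c. g * c"])
      show "\<forall>y\<in>{a \<in> {1..A}. g dvd a}. \<exists>x\<in>{1..A}. g * x = y \<and> real g / real y \<le> 1 / real x"
      proof
        fix y assume y: "y \<in> {a \<in> {1..A}. g dvd a}"
        then obtain c where c: "y = g * c" by auto
        hence "c \<ge> 1" "c \<le> y" using y g by (auto simp: Suc_le_eq)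
        hence "c \<in> {1..A}" using y by simp
        thus "\<exists>x\<in>{1..A}. g * x = y \<and> real g / real y \<le> 1 / real x"
          using c g by (intro bexI[of _ c]) auto
      qed
    qed auto
    also have "\<dots> = harm A" by (simp add: harm_def inverse_eq_divide)
    finally show ?thesis .
  qed
  have w0: "w g a \<ge> 0" for g a by (simp add: w_def)
  have "(\<Sum>a\<in>{1..A}. \<Sum>b\<in>{1..A}. (real (gcd a b))\<^sup>2 / (real a * real b))
     \<le> (\<Sum>a\<in>{1..A}. \<Sum>b\<in>{1..A}. \<Sum>g\<in>{1..A}. w g a * w g b)"
  proof (intro sum_mono)
    fix a b assume ab: "a \<in> {1..A}" "b \<in> {1..A}"
    have "gcd a b \<in> {1..A}" using ab by (auto simp: Suc_le_eq intro: order.trans[OF gcd_le1_nat])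
    hence "w (gcd a b) a * w (gcd a b) b \<le> (\<Sum>g\<in>{1..A}. w g a * w g b)"
      using w0 by (intro member_le_sum) auto
    thus "(real (gcd a b))\<^sup>2 / (real a * real b) \<le> (\<Sum>g\<in>{1..A}. w g a * w g b)"
      by (simp add: w_def power2_eq_square)
  qed
  also have "\<dots> = (\<Sum>g\<in>{1..A}. (\<Sum>a\<in>{1..A}. w g a)\<^sup>2)"
  proof -
    have "(\<Sum>a\<in>{1..A}. \<Sum>b\<in>{1..A}. \<Sum>g\<in>{1..A}. w g a * w g b)
       = (\<Sum>a\<in>{1..A}. \<Sum>g\<in>{1..A}. \<Sum>b\<in>{1..A}. w g a * w g b)"
      by (rule sum.cong[OF refl], rule sum.swap)
    also have "\<dots> = (\<Sum>g\<in>{1..A}. \<Sum>a\<in>{1..A}. \<Sum>b\<in>{1..A}. w g a * w g b)" by (rule sum.swap)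
    finally show ?thesis by (simp add: power2_eq_square sum_product)
  qed
  also have "\<dots> \<le> real (card {1..A}) * (harm A)\<^sup>2"
    using wle w0 by (intro sum_bounded_above power_mono sum_nonneg) auto
  finally show ?thesis by simp
qed

text \<open>For each n the prefix is bounded by dyadic squares that do not involve R n, so R may
  vary with n in any way below 2^k. One factor k + 1 counts the blocks in a prefix, the other the
  dyadic levels.\<close>

lemma mean_square_saw_variable_sum:
  assumes T: "T > 0" "N \<le> T" and R: "\<And>n. n < N \<Longrightarrow> R n \<le> 2 ^ k"
  shows "(\<Sum>n<N. (\<Sum>a\<in>{1..R n}. saw a (int n))\<^sup>2)
    \<le> (real (k + 1))\<^sup>2 * (real ((m + 1) * T) *
        (2 ^ k * (harm (2 ^ k))\<^sup>2 + (2 ^ k)\<^sup>2 * ((2 ^ k)\<^sup>2 / real T) ^ m))"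
proof -
  define q where "q = (\<lambda>a b. (real (gcd a b))\<^sup>2 / (real a * real b) + (real a * real b / real T) ^ m)"
  let ?s = "\<lambda>n a. saw a (int n)" and ?A = "{1..<1 + (2::nat) ^ k}"
  have eq: "?A = {1..2 ^ k}" by auto
  have "(\<Sum>n<N. (\<Sum>a\<in>{1..R n}. saw a (int n))\<^sup>2)
      \<le> (\<Sum>n<N. real (k + 1) * dyadic_squares (?s n) k 1)"
  proof (rule sum_mono)
    fix n assume "n \<in> {..<N}"
    hence "R n \<le> 2 ^ k" using R by simp
    moreover have "{1..R n} = {1..<1 + R n}" by auto
    ultimately show "(\<Sum>a\<in>{1..R n}. saw a (int n))\<^sup>2 \<le> real (k + 1) * dyadic_squares (?s n) k 1"
      using prefix_square_le_dyadic_squares[of "R n" k "?s n" 1] by simp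
  qed
  also have "\<dots> = real (k + 1) * (\<Sum>n<N. dyadic_squares (?s n) k 1)"
    by (simp add: sum_distrib_left)
  also have "\<dots> \<le> real (k + 1) * (real (k + 1) * (real ((m + 1) * T) * (\<Sum>a\<in>?A. \<Sum>b\<in>?A. q a b)))"
  proof (intro mult_left_mono sum_dyadic_squares_le)
    fix I :: "nat set" assume "finite I" "I \<subseteq> {1..}"
    thus "(\<Sum>n<N. (\<Sum>a\<in>I. saw a (int n))\<^sup>2) \<le> real ((m + 1) * T) * (\<Sum>a\<in>I. \<Sum>b\<in>I. q a b)"
      unfolding q_def by (intro mean_square_saw_sum T) (auto simp: Suc_le_eq)
  qed (auto simp: q_def)
  also have "(\<Sum>a\<in>?A. \<Sum>b\<in>?A. q a b)
      \<le> 2 ^ k * (harm (2 ^ k))\<^sup>2 + (2 ^ k)\<^sup>2 * ((2 ^ k)\<^sup>2 / real T) ^ m"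
  proof -
    have "(\<Sum>a\<in>{1..2 ^ k}. \<Sum>b\<in>{1..(2::nat) ^ k}. (real a * real b / real T) ^ m)
        \<le> (\<Sum>a\<in>{1..(2::nat) ^ k}. \<Sum>b\<in>{1..(2::nat) ^ k}. ((2 ^ k)\<^sup>2 / real T) ^ m)"
    proof (intro sum_mono power_mono divide_right_mono)
      fix a b :: nat assume "a \<in> {1..2 ^ k}" "b \<in> {1..2 ^ k}"
      hence "real a \<le> real (2 ^ k)" "real b \<le> real (2 ^ k)"
        by (simp_all only: of_nat_le_iff atLeastAtMost_iff)
      thus "real a * real b \<le> (2 ^ k)\<^sup>2" unfolding power2_eq_square by (intro mult_mono) auto
    qed auto
    also have "\<dots> = (2 ^ k)\<^sup>2 * ((2 ^ k)\<^sup>2 / real T) ^ m" by (simp add: power2_eq_square)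
    finally show ?thesis
      using sum_gcd_square_le[of "2 ^ k"] unfolding eq q_def by (simp add: sum.distrib)
  qed
  finally show ?thesis by (simp add: power2_eq_square mult.assoc mult_left_mono)
qed

section \<open>The error term of the divisor problem\<close>

lemma log_power_le_powr:
  assumes "\<delta> > 0" "c \<ge> 0"
  shows "\<exists>C>0. \<forall>x\<ge>1::real. (c + ln x) ^ p \<le> C * x powr \<delta>"
proof -
  \<comment> \<open>Dividing by p + 1 rather than p lets p = 0 pass through the same
    argument.\<close>
  define \<eta> where "\<eta> = \<delta> / real (p + 1)"
  have eta: "\<eta> > 0" "real p * \<eta> \<le> \<delta>" using assms by (simp_all add: \<eta>_def field_simps)
  have "(c + ln x) ^ p \<le> (c + 1 / \<eta>) ^ p * x powr \<delta>" if x: "x \<ge> 1" for x :: real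
  proof -
    have "ln x \<le> x powr \<eta> / \<eta>" using x eta by (intro ln_powr_bound)
    moreover have "c * 1 \<le> c * x powr \<eta>" using x eta assms by (intro mult_left_mono ge_one_powr_ge_zero) auto
    ultimately have "c + ln x \<le> (c + 1 / \<eta>) * x powr \<eta>" by (simp add: algebra_simps)
    hence "(c + ln x) ^ p \<le> ((c + 1 / \<eta>) * x powr \<eta>) ^ p" using x assms by (intro power_mono) auto
    also have "\<dots> = (c + 1 / \<eta>) ^ p * x powr (real p * \<eta>)"
      using x by (simp add: power_mult_distrib powr_power mult.commute)
    also have "\<dots> \<le> (c + 1 / \<eta>) ^ p * x powr \<delta>"
      using x eta assms by (intro mult_left_mono powr_mono) auto
    finally show ?thesis .
  qed
  moreover have "(c + 1 / \<eta>) ^ p > 0" using assms eta by (intro zero_less_power add_nonneg_pos) auto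
  ultimately show ?thesis by blast
qed

lemma harm_le_ln:
  assumes "n > 0"
  shows "harm n \<le> 1 + ln (real n)"
  using euler_mascheroni_sequence_decreasing[of 1 n] assms by (simp add: harm_expand)

section \<open>Lattice points under the hyperbola and sawtooth sums\<close>

definition hpairs :: "real \<Rightarrow> (nat \<times> nat) set" where
  "hpairs t = {(a, b). 0 < a \<and> 0 < b \<and> real (a * b) \<le> t}"

definition divsum :: "real \<Rightarrow> real" where
  "divsum t = real (card (hpairs t))"

definition divisor_main :: "real \<Rightarrow> real" where
  "divisor_main t = t * ln t + (2 * euler_mascheroni - 1) * t"

definition divisor_error :: "real \<Rightarrow> real" where
  "divisor_error t = divsum t - divisor_main t"

lemma hpairs_floor: "hpairs t = hpairs (real (nat \<lfloor>t\<rfloor>))"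
proof -
  have "real n \<le> t \<longleftrightarrow> real n \<le> real (nat \<lfloor>t\<rfloor>)" if "n > 0" for n
  proof -
    have "real n \<le> t \<longleftrightarrow> int n \<le> \<lfloor>t\<rfloor>" by (simp add: le_floor_iff)
    also have "\<dots> \<longleftrightarrow> n \<le> nat \<lfloor>t\<rfloor>" using that by linarith
    finally show ?thesis by simp
  qed
  thus ?thesis by (auto simp: hpairs_def simp del: of_nat_mult)
qed

lemma hpairs_subset: "hpairs t \<subseteq> {1..nat \<lfloor>t\<rfloor>} \<times> {1..nat \<lfloor>t\<rfloor>}"
proof
  fix p assume "p \<in> hpairs t"
  then obtain a b where p: "p = (a, b)" "a > 0" "b > 0" "real (a * b) \<le> t"
    by (auto simp: hpairs_def)
  have "a * b \<le> nat \<lfloor>t\<rfloor>" using p(4) by (rule le_nat_floor)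
  moreover have "a \<le> a * b" "b \<le> a * b" using p by auto
  ultimately have "a \<le> nat \<lfloor>t\<rfloor>" "b \<le> nat \<lfloor>t\<rfloor>" by (simp_all only: order.trans)
  thus "p \<in> {1..nat \<lfloor>t\<rfloor>} \<times> {1..nat \<lfloor>t\<rfloor>}" using p by auto
qed

lemma finite_hpairs [simp]: "finite (hpairs t)"
  by (rule finite_subset[OF hpairs_subset]) auto

lemma hpairs_mono: "s \<le> t \<Longrightarrow> hpairs s \<subseteq> hpairs t"
  by (auto simp: hpairs_def)

lemma divsum_mono: "s \<le> t \<Longrightarrow> divsum s \<le> divsum t"
  unfolding divsum_def by (intro of_nat_mono card_mono hpairs_mono) auto

lemma hyperbola_method:
  assumes "R\<^sup>2 \<le> n" "n < (R + 1)\<^sup>2"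
  shows "divsum (real n) = 2 * (\<Sum>a\<in>{1..R}. real (n div a)) - (real R)\<^sup>2"
proof -
  define P where "P = (SIGMA a:{1..R}. {1..n div a})"
  have mem: "(a, b) \<in> hpairs (real n) \<longleftrightarrow> a > 0 \<and> b > 0 \<and> a * b \<le> n" for a b
    by (simp add: hpairs_def flip: of_nat_mult)
  have P: "(a, b) \<in> P \<longleftrightarrow> a > 0 \<and> b > 0 \<and> a * b \<le> n \<and> a \<le> R" for a b
    by (auto simp: P_def less_eq_div_iff_mult_less_eq Suc_le_eq mult.commute)
  have un: "hpairs (real n) = P \<union> prod.swap ` P"
  proof (intro set_eqI iffI)
    fix p assume "p \<in> hpairs (real n)"
    then obtain a b where p: "p = (a, b)" "a > 0" "b > 0" "a * b \<le> n"
      using mem by (cases p) auto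
    have "a \<le> R \<or> b \<le> R"
    proof (rule ccontr)
      assume "\<not> (a \<le> R \<or> b \<le> R)"
      hence "(R + 1) * (R + 1) \<le> a * b" by (intro mult_mono) auto
      thus False using p assms by (simp add: power2_eq_square)
    qed
    moreover have "(a, b) = prod.swap (b, a)" by simp
    moreover have "(a, b) \<in> P \<or> (b, a) \<in> P"
      using p P[of a b] P[of b a] \<open>a \<le> R \<or> b \<le> R\<close> by (auto simp: mult.commute)
    ultimately show "p \<in> P \<union> prod.swap ` P" using p(1) by blast
  next
    fix p assume "p \<in> P \<union> prod.swap ` P"
    thus "p \<in> hpairs (real n)"
      by (cases p) (auto simp: mem P mult.commute)
  qed
  have int: "P \<inter> prod.swap ` P = {1..R} \<times> {1..R}"
  proof (intro set_eqI iffI)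
    fix p assume "p \<in> {1..R} \<times> {1..R}"
    then obtain a b where p: "p = (a, b)" "a > 0" "b > 0" "a \<le> R" "b \<le> R" by auto
    have "a * b \<le> R * R" using p by (intro mult_mono) auto
    hence "a * b \<le> n" using assms by (simp add: power2_eq_square)
    hence "(a, b) \<in> P" "(b, a) \<in> P" using p by (auto simp: P mult.commute)
    moreover have "(a, b) = prod.swap (b, a)" by simp
    ultimately show "p \<in> P \<inter> prod.swap ` P" using p(1) by blast
  qed (auto simp: P image_iff)
  have fin: "finite P" by (simp add: P_def)
  have cP: "real (card P) = (\<Sum>a\<in>{1..R}. real (n div a))" by (simp add: P_def)
  have "card (prod.swap ` P) = card P" by (rule card_image) (auto simp: inj_on_def)
  moreover have "card P + card (prod.swap ` P) = card (hpairs (real n)) + card ({1..R} \<times> {1..R})"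
    using card_Un_Int[OF fin, of "prod.swap ` P"] fin by (simp add: un int)
  ultimately have "2 * real (card P) = divsum (real n) + (real R)\<^sup>2"
    unfolding divsum_def by (simp add: power2_eq_square flip: of_nat_mult of_nat_add)
  thus ?thesis using cP by simp
qed

text \<open>The term 1 / (2 a) is the price of centring at (a - 1) / 2. Summed over a it gives half
  a harmonic number, hence only a logarithm.\<close>

lemma real_div_eq_saw:
  assumes "a > 0"
  shows "real (n div a) = real n / real a - saw a (int n) - 1 / 2 + 1 / (2 * real a)"
proof -
  have "real_of_int (int n mod int a) = real (n mod a)" by (simp flip: zmod_int)
  moreover have "real n = real a * real (n div a) + real (n mod a)"
    by (metis mult_div_mod_eq of_nat_add of_nat_mult)
  ultimately show ?thesis using assms by (simp add: saw_def field_simps)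
qed

text \<open>Apart from the sawtooths all is elementary. With Q = R + 1 the harmonic number that
  multiplies x is known up to 1 / (2 R Q), and Q^2 exceeds x by at most 2 Q, so everything stays
  bounded except one bare harmonic number, the source of the logarithm.\<close>

lemma divisor_error_saw:
  assumes "n > 0" and R: "R\<^sup>2 \<le> n" "n < (R + 1)\<^sup>2"
  shows "\<bar>divisor_error (real n) + 2 * (\<Sum>a\<in>{1..R}. saw a (int n))\<bar> \<le> 9 + ln (real n)"
proof -
  define S where "S = (\<Sum>a\<in>{1..R}. saw a (int n))"
  define x where "x = real n"
  define Q where "Q = real R + 1"
  define h where "h = (harm R :: real)"
  have R0: "R > 0" using assms by (cases R) auto
  hence Rge: "real R \<ge> 1" by simp
  have x: "x \<ge> 1" "(real R)\<^sup>2 \<le> x" "x < Q\<^sup>2"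
  proof -
    show "x \<ge> 1" using assms by (simp add: x_def)
    show "(real R)\<^sup>2 \<le> x" using R(1) unfolding x_def by (metis of_nat_le_iff of_nat_power)
    have "real n < real ((R + 1)\<^sup>2)" using R(2) by (simp only: of_nat_less_iff)
    thus "x < Q\<^sup>2" by (simp add: x_def Q_def add.commute)
  qed
  have Q: "Q \<ge> 2" using Rge by (simp add: Q_def)
  have "(\<Sum>a\<in>{1..R}. real (n div a)) = (\<Sum>a\<in>{1..R}. x * (1 / real a) - saw a (int n) - 1 / 2 + (1 / 2) * (1 / real a))"
    by (intro sum.cong refl) (simp add: real_div_eq_saw x_def)
  also have "\<dots> = x * h - S - real R / 2 + h / 2"
    unfolding sum.distrib sum_subtractf sum_distrib_left[symmetric]
    by (simp add: h_def harm_def S_def inverse_eq_divide)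
  finally have D: "divsum x = 2 * x * h - 2 * S - real R + h - (real R)\<^sup>2"
    using hyperbola_method[OF R] by (simp add: x_def)
  \<comment> \<open>Defect in the two-sided bound for Euler's constant. It is at most 1 / (2 R Q)
    while x < Q^2, so 2 x e is at most Q / R \<le> 2.\<close>
  define e where "e = euler_mascheroni + ln Q - 1 / (2 * Q) - h"
  have "euler_mascheroni \<in> {h - ln Q + inverse (2 * Q)..h - ln Q + inverse (2 * real R)}"
    using euler_mascheroni_bounds[of R] R0 by (simp add: h_def Q_def add.commute)
  hence e: "e \<ge> 0" "e \<le> 1 / (2 * real R) - 1 / (2 * Q)"
    by (simp_all add: e_def inverse_eq_divide)
  have "1 / (2 * real R) - 1 / (2 * Q) = 1 / (2 * real R * Q)"
    using Rge by (simp add: Q_def field_simps)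
  hence "2 * x * e \<le> 2 * Q\<^sup>2 * (1 / (2 * real R * Q))"
    using e x by (intro mult_mono) auto
  also have "\<dots> = Q / real R" using Q by (simp add: power2_eq_square)
  also have "\<dots> \<le> 2" using Rge by (simp add: Q_def divide_le_eq)
  finally have xe: "0 \<le> 2 * x * e" "2 * x * e \<le> 2" using e x by auto
  have xQ: "0 \<le> Q - x / Q" "Q - x / Q \<le> 2"
  proof -
    have "Q - x / Q = (Q\<^sup>2 - x) / Q" using Q by (simp add: field_simps power2_eq_square)
    moreover have "Q\<^sup>2 - x \<le> 2 * Q" using x Q by (simp add: Q_def power2_eq_square algebra_simps)
    ultimately show "0 \<le> Q - x / Q" "Q - x / Q \<le> 2" using x Q by (auto simp: divide_le_eq)
  qed
  \<comment> \<open>A quantity that vanishes to second order at x = Q^2: the inequality ln t \<le> t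
    - 1, for t = Q^2 / x and for t = x / Q^2, traps it between - (Q - x / Q)^2 and 0.\<close>
  define E where "E = x * ln (Q\<^sup>2 / x) + x - Q\<^sup>2"
  have E: "E \<le> 0" "E \<ge> -4"
  proof -
    have v: "Q\<^sup>2 / x > 0" using x Q by (intro divide_pos_pos) auto
    have "x * ln (Q\<^sup>2 / x) \<le> x * (Q\<^sup>2 / x - 1)"
      using x v by (intro mult_left_mono ln_le_minus_one) auto
    thus "E \<le> 0" using x by (simp add: E_def algebra_simps)
    have "ln (x / Q\<^sup>2) \<le> x / Q\<^sup>2 - 1" using x Q by (intro ln_le_minus_one divide_pos_pos) auto
    hence "ln (Q\<^sup>2 / x) \<ge> 1 - x / Q\<^sup>2" using x Q by (simp add: ln_div)
    hence "x * ln (Q\<^sup>2 / x) \<ge> x * (1 - x / Q\<^sup>2)" using x by (intro mult_left_mono) auto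
    moreover have "x * (1 - x / Q\<^sup>2) + x - Q\<^sup>2 = - ((Q - x / Q)\<^sup>2)"
      using Q by (simp add: power2_eq_square field_simps)
    moreover have "(Q - x / Q)\<^sup>2 \<le> 2\<^sup>2" using xQ by (intro power_mono) auto
    ultimately show "E \<ge> -4" by (simp add: E_def)
  qed
  have lnQ: "x * ln (Q\<^sup>2 / x) = 2 * x * ln Q - x * ln x"
    using x Q by (simp add: ln_div ln_realpow algebra_simps)
  have h: "h \<ge> 0" "h \<le> 1 + ln x"
  proof -
    show "h \<ge> 0" by (simp add: h_def harm_nonneg)
    have "real R \<le> (real R)\<^sup>2" using Rge by (simp add: power2_eq_square)
    hence "real R \<le> x" using x(2) by linarith
    hence "ln (real R) \<le> ln x" using Rge by (subst ln_le_cancel_iff) auto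
    thus "h \<le> 1 + ln x" using harm_le_ln[OF R0] by (simp add: h_def)
  qed
  have hx: "2 * x * h = 2 * x * euler_mascheroni + 2 * x * ln Q - x / Q - 2 * x * e"
    using Q by (simp add: e_def field_simps)
  have "divisor_error x + 2 * S = E + (Q - x / Q) - 2 * x * e + h"
    unfolding divisor_error_def divisor_main_def D hx E_def lnQ
    by (simp add: Q_def power2_eq_square algebra_simps)
  \<comment> \<open>The four pieces are at most 4, 2, 2 and 1 + ln x in absolute value.\<close>
  hence "\<bar>divisor_error x + 2 * S\<bar> \<le> 9 + ln x" using E xQ xe h by linarith
  thus ?thesis unfolding x_def S_def .
qed

section \<open>Mean square of the divisor error\<close>

lemma mean_square_divisor_error:
  assumes "\<delta> > 0"
  shows "\<exists>C>0. \<forall>N\<ge>1. (\<Sum>n\<in>{1..N}. (divisor_error (real n))\<^sup>2) \<le> C * real N powr (3 / 2 + \<delta>)"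
proof -
  define \<eta> where "\<eta> = \<delta> / 2"
  have eta: "\<eta> > 0" using assms by (simp add: \<eta>_def)
  \<comment> \<open>Each average will gain x^(- \<eta>), so m of them gain at least a factor x,
    which makes up for the number of pairs of moduli, at most 4 x.\<close>
  define m where "m = nat \<lceil>1 / \<eta>\<rceil>"
  have "1 / \<eta> \<le> real m" unfolding m_def by (rule real_nat_ceiling_ge)
  hence m: "\<eta> * real m \<ge> 1" using eta by (simp add: field_simps)
  \<comment> \<open>Four logarithms: two from the dyadic decomposition, two from the squared
    harmonic number in the gcd sum.\<close>
  obtain C0 where C0: "C0 > 0" "\<And>x::real. x \<ge> 1 \<Longrightarrow> (9 + ln x) ^ 4 \<le> C0 * x powr \<eta>"
    using log_power_le_powr[OF eta, of 9 4] by auto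
  define C where "C = 240 * real (m + 1) * C0 + 2 * C0"
  have "(\<Sum>n\<in>{1..N}. (divisor_error (real n))\<^sup>2) \<le> C * real N powr (3 / 2 + \<delta>)" if N: "N \<ge> 1" for N
  proof -
    define x where "x = real N"
    define L where "L = 9 + ln x"
    have x: "x \<ge> 1" using N by (simp add: x_def)
    hence L: "L \<ge> 9" by (simp add: L_def)
    define k where "k = nat \<lceil>log 2 (sqrt x)\<rceil>"
    have lg: "log 2 (sqrt x) \<ge> 0" using x by (simp add: zero_le_log_cancel_iff)
    have k: "log 2 (sqrt x) \<le> real k" "real k \<le> log 2 (sqrt x) + 1"
      using lg unfolding k_def by linarith+
    have k1: "sqrt x \<le> 2 ^ k"
    proof -
      have "sqrt x = 2 powr (log 2 (sqrt x))" using x by simp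
      also have "\<dots> \<le> 2 powr real k" using k by (intro powr_mono) auto
      finally show ?thesis by (simp add: powr_realpow)
    qed
    have k2: "2 ^ k \<le> 2 * sqrt x"
    proof -
      have "2 ^ k = 2 powr real k" by (simp add: powr_realpow)
      also have "\<dots> \<le> 2 powr (log 2 (sqrt x) + 1)" using k by (intro powr_mono) auto
      also have "\<dots> = 2 * sqrt x" using x by (simp add: powr_add)
      finally show ?thesis .
    qed
    have k4: "(2 ^ k)\<^sup>2 \<le> 4 * x"
    proof -
      have "(2 ^ k)\<^sup>2 \<le> (2 * sqrt x)\<^sup>2" using k2 by (intro power_mono) auto
      thus ?thesis using x by (simp add: power_mult_distrib)
    qed
    have kL: "real (k + 1) \<le> L"
    proof -
      have "log 2 (sqrt x) = ln x / (2 * ln 2)" using x by (simp add: log_def ln_sqrt)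
      also have "\<dots> \<le> ln x / 1" using x ln2_ge_two_thirds by (intro divide_left_mono) auto
      finally show ?thesis using k by (simp add: L_def)
    qed
    have hL: "harm (2 ^ k) \<le> L"
    proof -
      have "harm (2 ^ k) \<le> 1 + ln (real (2 ^ k))" by (rule harm_le_ln) simp
      also have "ln (real (2 ^ k)) \<le> ln (2 * sqrt x)" using k2 by (subst ln_le_cancel_iff) (use x in auto)
      also have "\<dots> = ln 2 + ln x / 2" using x by (simp add: ln_mult ln_sqrt)
      also have "\<dots> \<le> 1 + ln x" using ln_2_less_1 ln_ge_zero[OF x] by linarith
      finally show ?thesis by (simp add: L_def)
    qed
    \<comment> \<open>Products of two moduli are at most (2^k)^2 \<le> 4 x; T exceeds this by the
      factor x^\<eta> that every average is to gain.\<close>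
    define T where "T = nat \<lceil>4 * x powr (1 + \<eta>)\<rceil>"
    have xp: "x powr (1 + \<eta>) \<ge> x"
      using x eta powr_mono[of 1 "1 + \<eta>" x] by simp
    have T1: "real T \<ge> 4 * x powr (1 + \<eta>)" unfolding T_def by linarith
    have T2: "real T \<le> 5 * x powr (1 + \<eta>)"
      using xp x unfolding T_def by linarith
    have TN: "N + 1 \<le> T"
    proof -
      have "real (N + 1) \<le> real T" using T1 xp x by (simp add: x_def)
      thus ?thesis by (simp only: of_nat_le_iff)
    qed
    define R where "R = (\<lambda>n. nat \<lfloor>sqrt (real n)\<rfloor>)"
    have R1: "(R n)\<^sup>2 \<le> n" "n < (R n + 1)\<^sup>2" for n
    proof -
      have "real (R n) \<le> sqrt (real n)" by (simp add: R_def)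
      hence "(real (R n))\<^sup>2 \<le> (sqrt (real n))\<^sup>2" by (intro power_mono) auto
      hence "real ((R n)\<^sup>2) \<le> real n" by simp
      thus "(R n)\<^sup>2 \<le> n" by (simp only: of_nat_le_iff)
      have "sqrt (real n) < real (R n) + 1" unfolding R_def by linarith
      hence "(sqrt (real n))\<^sup>2 < (real (R n) + 1)\<^sup>2" by (intro power_strict_mono) auto
      hence "real n < real ((R n + 1)\<^sup>2)" by (simp add: add.commute)
      thus "n < (R n + 1)\<^sup>2" by (simp only: of_nat_less_iff)
    qed
    have R2: "R n \<le> 2 ^ k" if "n < N + 1" for n
    proof -
      have "real (R n) \<le> sqrt (real n)" by (simp add: R_def)
      also have "\<dots> \<le> sqrt x" using that by (simp add: x_def)
      also have "\<dots> \<le> real (2 ^ k)" using k1 by simp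
      finally show ?thesis by (simp only: of_nat_le_iff)
    qed
    define S where "S = (\<lambda>n. \<Sum>a\<in>{1..R n}. saw a (int n))"
    have "(\<Sum>n<N + 1. (S n)\<^sup>2) \<le> (real (k + 1))\<^sup>2 * (real ((m + 1) * T) *
        (2 ^ k * (harm (2 ^ k))\<^sup>2 + (2 ^ k)\<^sup>2 * ((2 ^ k)\<^sup>2 / real T) ^ m))"
      unfolding S_def using TN R2 by (intro mean_square_saw_variable_sum) auto
    also have "\<dots> \<le> L\<^sup>2 * ((real (m + 1) * (5 * x powr (1 + \<eta>))) * (6 * sqrt x * L\<^sup>2))"
    proof -
      have "((2 ^ k)\<^sup>2 / real T) ^ m \<le> (x powr (- \<eta>)) ^ m"
      proof (intro power_mono)
        have "(2 ^ k)\<^sup>2 / real T \<le> (4 * x) / (4 * x powr (1 + \<eta>))"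
          using k4 T1 x by (intro frac_le) auto
        also have "\<dots> = x powr (- \<eta>)" using x by (simp add: powr_add powr_minus field_simps)
        finally show "(2 ^ k)\<^sup>2 / real T \<le> x powr (- \<eta>)" .
      qed auto
      also have "\<dots> = x powr (- (\<eta> * real m))" using x by (simp add: powr_power mult.commute)
      also have "\<dots> \<le> x powr (-1)" using x m by (intro powr_mono) auto
      finally have "((2 ^ k)\<^sup>2 / real T) ^ m \<le> x powr (-1)" .
      hence "(2 ^ k)\<^sup>2 * ((2 ^ k)\<^sup>2 / real T) ^ m \<le> (4 * x) * x powr (-1)"
        using k4 x by (intro mult_mono) auto
      also have "\<dots> = 4" using x by (simp add: powr_minus)
      also have "\<dots> \<le> 4 * (sqrt x * L\<^sup>2)"
      proof -
        have "1 * 1 \<le> sqrt x * L\<^sup>2" using x L by (intro mult_mono one_le_power) auto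
        thus ?thesis by simp
      qed
      finally have "(2 ^ k)\<^sup>2 * ((2 ^ k)\<^sup>2 / real T) ^ m \<le> 4 * (sqrt x * L\<^sup>2)" .
      moreover have "2 ^ k * (harm (2 ^ k))\<^sup>2 \<le> (2 * sqrt x) * L\<^sup>2"
        using k2 hL x by (intro mult_mono power_mono) (auto simp: harm_nonneg)
      ultimately have A: "2 ^ k * (harm (2 ^ k))\<^sup>2 + (2 ^ k)\<^sup>2 * ((2 ^ k)\<^sup>2 / real T) ^ m \<le> 6 * sqrt x * L\<^sup>2"
        by (simp add: algebra_simps)
      have B: "real ((m + 1) * T) \<le> real (m + 1) * (5 * x powr (1 + \<eta>))"
        using T2 unfolding of_nat_mult by (intro mult_left_mono) auto
      have "(real (k + 1))\<^sup>2 \<le> L\<^sup>2" using kL by (intro power_mono) auto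
      moreover have "real ((m + 1) * T) * (2 ^ k * (harm (2 ^ k))\<^sup>2 + (2 ^ k)\<^sup>2 * ((2 ^ k)\<^sup>2 / real T) ^ m)
          \<le> (real (m + 1) * (5 * x powr (1 + \<eta>))) * (6 * sqrt x * L\<^sup>2)"
        using A B x by (intro mult_mono) (auto intro!: add_nonneg_nonneg mult_nonneg_nonneg)
      ultimately show ?thesis
        by (rule mult_mono[OF _ _ zero_le_power2]) (auto intro!: add_nonneg_nonneg mult_nonneg_nonneg)
    qed
    also have "\<dots> = 30 * real (m + 1) * L ^ 4 * (x powr (1 + \<eta>) * x powr (1 / 2))"
      by (simp add: powr_half_sqrt x_def power2_eq_square power4_eq_xxxx)
    also have "\<dots> \<le> 30 * real (m + 1) * (C0 * x powr \<eta>) * (x powr (1 + \<eta>) * x powr (1 / 2))"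
      using C0(2)[OF x] unfolding L_def by (intro mult_mono mult_right_mono mult_left_mono) (use C0 in auto)
    also have "\<dots> = 30 * real (m + 1) * C0 * (x powr \<eta> * (x powr (1 + \<eta>) * x powr (1 / 2)))"
      by simp
    also have "x powr \<eta> * (x powr (1 + \<eta>) * x powr (1 / 2)) = x powr (3 / 2 + \<delta>)"
      by (simp add: \<eta>_def add.commute flip: powr_add)
    finally have SS: "(\<Sum>n<N + 1. (S n)\<^sup>2) \<le> 30 * real (m + 1) * C0 * x powr (3 / 2 + \<delta>)" .
    have "(\<Sum>n\<in>{1..N}. (divisor_error (real n))\<^sup>2) \<le> (\<Sum>n\<in>{1..N}. 8 * (S n)\<^sup>2 + 2 * L\<^sup>2)"
    proof (rule sum_mono)
      fix n assume n: "n \<in> {1..N}"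
      have "\<bar>divisor_error (real n) + 2 * S n\<bar> \<le> 9 + ln (real n)"
        unfolding S_def using n by (intro divisor_error_saw R1) auto
      also have "\<dots> \<le> L" using n by (simp add: L_def x_def)
      finally have "(divisor_error (real n) + 2 * S n)\<^sup>2 \<le> L\<^sup>2" using L abs_le_square_iff[of "divisor_error (real n) + 2 * S n" L] by simp
      moreover have "(u::real)\<^sup>2 \<le> 2 * (u + 2 * v)\<^sup>2 + 8 * v\<^sup>2" for u v
        using zero_le_power2[of "u + 4 * v"] by (simp add: power2_eq_square algebra_simps)
      ultimately show "(divisor_error (real n))\<^sup>2 \<le> 8 * (S n)\<^sup>2 + 2 * L\<^sup>2"
        by (smt (verit))
    qed
    also have "\<dots> = 8 * (\<Sum>n\<in>{1..N}. (S n)\<^sup>2) + 2 * (x * L\<^sup>2)"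
      by (simp add: sum.distrib sum_distrib_left x_def)
    also have "(\<Sum>n\<in>{1..N}. (S n)\<^sup>2) \<le> (\<Sum>n<N + 1. (S n)\<^sup>2)"
      by (intro sum_mono2) auto
    also have "x * L\<^sup>2 \<le> C0 * x powr (3 / 2 + \<delta>)"
    proof -
      have "L\<^sup>2 \<le> L ^ 4" using L by (intro power_increasing) auto
      also have "\<dots> \<le> C0 * x powr \<eta>" using C0(2)[OF x] by (simp add: L_def)
      finally have "x * L\<^sup>2 \<le> x powr 1 * (C0 * x powr \<eta>)" using x by simp
      also have "\<dots> = C0 * x powr (1 + \<eta>)" by (simp only: powr_add mult_ac)
      also have "\<dots> \<le> C0 * x powr (3 / 2 + \<delta>)"
        using C0 x eta by (intro mult_left_mono powr_mono) (auto simp: \<eta>_def)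
      finally show ?thesis .
    qed
    finally show ?thesis using SS by (simp add: C_def x_def algebra_simps)
  qed
  moreover have "C > 0" using C0 by (auto simp: C_def intro!: add_nonneg_pos mult_nonneg_nonneg)
  ultimately show ?thesis by blast
qed

section \<open>From the mean square to the errors at z / k\<close>

lemma divisor_main_mono:
  assumes "1 \<le> s" "s \<le> t"
  shows "divisor_main s \<le> divisor_main t"
    and "divisor_main t \<le> divisor_main s + (t - s) * (ln t + 2)"
proof -
  have *: "0 \<le> divisor_main t - divisor_main s \<and> divisor_main t - divisor_main s \<le> (t - s) * (ln t + 2)"
  proof (cases "s = t")
    case False
    have der: "DERIV divisor_main u :> ln u + 2 * euler_mascheroni" if "s \<le> u" "u \<le> t" for u
    proof -
      have "u > 0" using that assms by simp
      thus ?thesis unfolding divisor_main_def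
        by (auto intro!: derivative_eq_intros)
    qed
    obtain u where u: "s < u" "u < t" "divisor_main t - divisor_main s = (t - s) * (ln u + 2 * euler_mascheroni)"
      using MVT2[of s t divisor_main "\<lambda>u. ln u + 2 * euler_mascheroni"] der False assms by auto
    have "0 \<le> ln u" "ln u \<le> ln t" using u assms by auto
    hence "0 \<le> ln u + 2 * euler_mascheroni" "ln u + 2 * euler_mascheroni \<le> ln t + 2"
      using euler_mascheroni_pos euler_mascheroni_less_13_over_22 by linarith+
    thus ?thesis unfolding u(3) using u assms by (auto intro!: mult_left_mono)
  qed simp
  show "divisor_main s \<le> divisor_main t"
    "divisor_main t \<le> divisor_main s + (t - s) * (ln t + 2)" using * by auto
qed

text \<open>The bound comes from the monotonicity of \<open>divsum\<close>; it trades a value at a single point for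
  an average over a short interval.\<close>

lemma divisor_error_square_le_neighbours:
  assumes "t \<ge> 1" "j < \<eta>" "real \<eta> \<le> t - 1" "0 < \<eta>" "t + real \<eta> \<le> u"
  shows "(divisor_error t)\<^sup>2 \<le> 2 * (divisor_error (real (nat \<lfloor>t\<rfloor> + j)))\<^sup>2
     + 2 * (divisor_error (real (nat \<lfloor>t\<rfloor> - j)))\<^sup>2 + 2 * (real \<eta> * (ln u + 2))\<^sup>2"
proof -
  define n where "n = nat \<lfloor>t\<rfloor>"
  have n: "real n \<le> t" "t < real n + 1" using assms unfolding n_def by linarith+
  have L: "ln u \<ge> 0" using assms by simp
  have D: "divsum t = divsum (real n)" unfolding divsum_def n_def by (subst hpairs_floor) simp
  have jn: "real j + 1 \<le> real \<eta>" using assms by linarith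
  have up: "divisor_error t \<le> divisor_error (real (n + j)) + real \<eta> * (ln u + 2)"
  proof -
    have "divsum t \<le> divsum (real (n + j))" unfolding D by (intro divsum_mono) simp
    moreover have "divisor_main (real (n + j)) \<le> divisor_main t + real \<eta> * (ln u + 2)"
    proof (cases "real (n + j) \<le> t")
      case True
      have "real (n + j) \<ge> 1" using n assms by simp
      moreover have "0 \<le> real \<eta> * (ln u + 2)" using L by simp
      ultimately show ?thesis using divisor_main_mono(1)[OF _ True] by linarith
    next
      case False
      have "divisor_main (real (n + j)) \<le> divisor_main t + (real (n + j) - t) * (ln (real (n + j)) + 2)"
        using False assms by (intro divisor_main_mono) auto
      also have "(real (n + j) - t) * (ln (real (n + j)) + 2) \<le> real \<eta> * (ln u + 2)"
      proof (intro mult_mono)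
        have "real (n + j) \<le> u" using n jn assms by simp
        thus "ln (real (n + j)) + 2 \<le> ln u + 2" using False assms by (simp add: ln_le_cancel_iff)
        show "0 \<le> ln (real (n + j)) + 2" using False assms by (intro add_nonneg_nonneg ln_ge_zero) auto
      qed (use n jn in auto)
      finally show ?thesis by simp
    qed
    ultimately show ?thesis unfolding divisor_error_def by linarith
  qed
  have jle: "real (n - j) = real n - real j" using n jn assms by (simp add: of_nat_diff)
  have lo: "divisor_error t \<ge> divisor_error (real (n - j)) - real \<eta> * (ln u + 2)"
  proof -
    have "divsum (real (n - j)) \<le> divsum t" unfolding D by (intro divsum_mono) simp
    moreover have "divisor_main t \<le> divisor_main (real (n - j)) + real \<eta> * (ln u + 2)"
    proof -
      have "divisor_main t \<le> divisor_main (real (n - j)) + (t - real (n - j)) * (ln t + 2)"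
        using n jn assms jle by (intro divisor_main_mono) auto
      also have "(t - real (n - j)) * (ln t + 2) \<le> real \<eta> * (ln u + 2)"
      proof (intro mult_mono)
        show "ln t + 2 \<le> ln u + 2" using assms by simp
        show "0 \<le> ln t + 2" using assms by (intro add_nonneg_nonneg ln_ge_zero) auto
      qed (use n jn jle in auto)
      finally show ?thesis by simp
    qed
    ultimately show ?thesis unfolding divisor_error_def by linarith
  qed
  define e where "e = real \<eta> * (ln u + 2)"
  have e: "e \<ge> 0" using L by (simp add: e_def)
  have sq: "w\<^sup>2 \<le> 2 * v\<^sup>2 + 2 * e\<^sup>2" if "\<bar>w\<bar> \<le> \<bar>v\<bar> + e" for v w :: real
  proof -
    have "w\<^sup>2 \<le> (\<bar>v\<bar> + e)\<^sup>2" using that e abs_le_square_iff[of w "\<bar>v\<bar> + e"] by simp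
    also have "\<dots> \<le> 2 * v\<^sup>2 + 2 * e\<^sup>2"
      using zero_le_power2[of "\<bar>v\<bar> - e"] by (simp add: power2_eq_square algebra_simps)
    finally show ?thesis .
  qed
  have "(divisor_error t)\<^sup>2 \<le> 2 * (divisor_error (real (n + j)))\<^sup>2 + 2 * (divisor_error (real (n - j)))\<^sup>2 + 2 * e\<^sup>2"
  \<comment> \<open>To the right of t a positive error stays large, and to the left a negative one,
    because \<open>divsum\<close> is monotone and the main term moves slowly. As the sign is
    unknown, both neighbours enter the bound.\<close>
  proof (cases "divisor_error t \<ge> 0")
    case True
    have "(divisor_error t)\<^sup>2 \<le> 2 * (divisor_error (real (n + j)))\<^sup>2 + 2 * e\<^sup>2"
      using True up by (intro sq) (simp add: e_def)
    thus ?thesis using zero_le_power2[of "divisor_error (real (n - j))"] by linarith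
  next
    case False
    have "(divisor_error t)\<^sup>2 \<le> 2 * (divisor_error (real (n - j)))\<^sup>2 + 2 * e\<^sup>2"
      using False lo by (intro sq) (simp add: e_def)
    thus ?thesis using zero_le_power2[of "divisor_error (real (n + j))"] by linarith
  qed
  thus ?thesis by (simp add: n_def e_def)
qed

lemma sum_disjoint_windows_le:
  fixes F :: "nat \<Rightarrow> real" and p :: "nat \<Rightarrow> nat \<Rightarrow> nat"
  assumes "finite A" "\<And>n. F n \<ge> 0" "\<And>k j. k \<in> A \<Longrightarrow> j < \<eta> \<Longrightarrow> p k j \<in> {1..N}"
    and inj: "inj_on (\<lambda>(k, j). p k j) (A \<times> {..<\<eta>})"
  shows "(\<Sum>k\<in>A. \<Sum>j<\<eta>. F (p k j)) \<le> (\<Sum>n\<in>{1..N}. F n)"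
proof -
  have "(\<Sum>k\<in>A. \<Sum>j<\<eta>. F (p k j)) = (\<Sum>q\<in>A \<times> {..<\<eta>}. F ((\<lambda>(k, j). p k j) q))"
    by (simp add: sum.cartesian_product case_prod_unfold)
  also have "\<dots> = (\<Sum>n\<in>(\<lambda>(k, j). p k j) ` (A \<times> {..<\<eta>}). F n)"
    by (subst sum.reindex[OF inj]) simp
  also have "\<dots> \<le> (\<Sum>n\<in>{1..N}. F n)"
    using assms by (intro sum_mono2) auto
  finally show ?thesis .
qed

lemma divisor_error_block_square:
  assumes "\<delta> > 0"
  shows "\<exists>C>0. \<forall>z::real. \<forall>K::nat. K \<ge> 1 \<longrightarrow> real K \<le> z powr (3 / 7) \<longrightarrow> z powr (1 / 7) \<ge> 16 \<longrightarrow> z \<ge> 1 \<longrightarrow>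
     (\<Sum>k\<in>{K..<2 * K}. (divisor_error (z / real k))\<^sup>2) \<le> C * (z powr (1 + \<delta>) * real K powr (- 2 / 3))"
proof -
  obtain C0 where C0: "C0 > 0" "\<And>N. N \<ge> 1 \<Longrightarrow> (\<Sum>n\<in>{1..N}. (divisor_error (real n))\<^sup>2) \<le> C0 * real N powr (3 / 2 + \<delta>)"
    using mean_square_divisor_error[OF assms] by auto
  obtain C1 where C1: "C1 > 0" "\<And>x::real. x \<ge> 1 \<Longrightarrow> (3 + ln x) ^ 2 \<le> C1 * x powr \<delta>"
    using log_power_le_powr[OF assms, of 3 2] by auto
  define C where "C = 64 * C0 * 2 powr (3 / 2 + \<delta>) + C1"
  have "(\<Sum>k\<in>{K..<2 * K}. (divisor_error (z / real k))\<^sup>2) \<le> C * (z powr (1 + \<delta>) * real K powr (- 2 / 3))"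
    if K: "K \<ge> 1" "real K \<le> z powr (3 / 7)" and z16: "z powr (1 / 7) \<ge> 16" and z: "z \<ge> 1" for z :: real and K :: nat
  proof -
    define \<kappa> where "\<kappa> = real K"
    have kap: "\<kappa> \<ge> 1" "\<kappa> \<le> z powr (3 / 7)" using K by (auto simp: \<kappa>_def)
    define Y where "Y = z / \<kappa>"
    \<comment> \<open>The window length before rounding. It balances Y^(3/2) / h, the mean square
      shared out over the window, against \<kappa> h^2, the variation of the main term; the factor
      1/8 makes the windows fit between neighbouring points z / k.\<close>
    define h where "h = z powr (1 / 2) * \<kappa> powr (- 5 / 6) / 8"
    define \<eta> where "\<eta> = nat \<lfloor>h\<rfloor>"
    \<comment> \<open>The worst case is \<kappa> = z^(3/7), where h = z^(1/7) / 8; hence the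
      threshold 16. With h \<ge> 2, rounding down loses at most half of h.\<close>
    have h2: "h \<ge> 2"
    proof -
      have "z powr (1 / 7) = z powr (1 / 2) * (z powr (3 / 7)) powr (- 5 / 6)"
        by (simp add: powr_powr flip: powr_add)
      also have "\<dots> \<le> z powr (1 / 2) * \<kappa> powr (- 5 / 6)"
        using kap by (intro mult_left_mono powr_mono2') auto
      finally show ?thesis using z16 by (simp add: h_def)
    qed
    \<comment> \<open>This is what limits the range of k: up to constants, h \<le> z / \<kappa>^2
      says \<kappa>^(7/6) \<le> z^(1/2), that is, \<kappa> \<le> z^(3/7).\<close>
    have hY: "8 * h \<le> Y / \<kappa>"
    proof -
      have "\<kappa> powr (7 / 6) \<le> (z powr (3 / 7)) powr (7 / 6)" using kap by (intro powr_mono2) auto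
      also have "\<dots> = z powr (1 / 2)" by (simp add: powr_powr)
      finally have "z powr (1 / 2) * (\<kappa> powr (7 / 6) * \<kappa> powr (- 2)) \<le> z powr (1 / 2) * (z powr (1 / 2) * \<kappa> powr (- 2))"
        by (intro mult_left_mono mult_right_mono) auto
      hence "z powr (1 / 2) * \<kappa> powr (7 / 6 + - 2) \<le> z powr (1 / 2 + 1 / 2) * \<kappa> powr (- 2)"
        by (simp only: powr_add mult.assoc)
      moreover have "\<kappa> powr (- 2) = 1 / \<kappa>\<^sup>2"
        unfolding powr_minus using kap by (simp add: inverse_eq_divide)
      ultimately show ?thesis using z by (simp add: h_def Y_def power2_eq_square)
    qed
    have eta: "\<eta> > 0" "real \<eta> \<le> h" "h / 2 \<le> real \<eta>" using h2 unfolding \<eta>_def by linarith+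
    have YK: "8 * h * \<kappa> \<le> Y" using hY kap by (simp add: field_simps)
    have h8: "8 * h \<le> 8 * h * \<kappa>" using h2 kap by simp
    have Yh: "8 * h \<le> Y" using YK h8 by linarith
    have tk: "Y / 2 \<le> z / real k" "z / real k \<le> Y" if "k \<in> {K..<2 * K}" for k
    proof -
      have k: "\<kappa> \<le> real k" "real k \<le> 2 * \<kappa>" using that by (auto simp: \<kappa>_def)
      have "z / (2 * \<kappa>) \<le> z / real k" using k kap z by (intro divide_left_mono mult_pos_pos) auto
      thus "Y / 2 \<le> z / real k" by (simp add: Y_def)
      show "z / real k \<le> Y" unfolding Y_def using k kap z by (intro divide_left_mono mult_pos_pos) auto
    qed
    have gap: "z / real k - z / real l \<ge> 2 * h" if "k \<in> {K..<2 * K}" "l \<in> {K..<2 * K}" "k < l" for k l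
    proof -
      have k: "\<kappa> \<le> real k" "real k \<le> 2 * \<kappa>" "\<kappa> \<le> real l" "real l \<le> 2 * \<kappa>" "real l - real k \<ge> 1"
        using that by (auto simp: \<kappa>_def)
      have "2 * h \<le> Y / \<kappa> / 4" using hY by simp
      also have "\<dots> = z * 1 / ((2 * \<kappa>) * (2 * \<kappa>))" by (simp add: Y_def)
      also have "\<dots> \<le> z * (real l - real k) / (real k * real l)"
        using k kap z by (intro frac_le mult_mono mult_nonneg_nonneg mult_pos_pos) auto
      also have "\<dots> = z / real k - z / real l" using k kap by (simp add: field_simps)
      finally show ?thesis .
    qed
    define n where "n = (\<lambda>k::nat. nat \<lfloor>z / real k\<rfloor>)"
    have n: "real (n k) \<le> z / real k" "z / real k < real (n k) + 1" if "k \<in> {K..<2 * K}" for k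
      using tk[OF that] Yh h2 unfolding n_def by linarith+
    \<comment> \<open>The points are 2 h apart and \<eta> \<le> h, so after rounding to integers the
      windows to the right of the n k are still disjoint, and likewise those to the left.\<close>
    have gapn: "n l + \<eta> \<le> n k" if "k \<in> {K..<2 * K}" "l \<in> {K..<2 * K}" "k < l" for k l
    proof -
      have "real (n l) + real \<eta> < real (n k) + 1"
        using gap[OF that] n[OF that(1)] n[OF that(2)] eta h2 by linarith
      thus ?thesis by linarith
    qed
    define N where "N = nat \<lfloor>2 * Y\<rfloor>"
    have N: "N \<ge> 1" "real N \<le> 2 * Y" using Yh h2 unfolding N_def by linarith+
    define L where "L = ln (2 * Y) + 2"
    have rng: "n k + j \<in> {1..N}" "n k - j \<in> {1..N}" "j < n k" if "k \<in> {K..<2 * K}" "j < \<eta>" for k j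
    proof -
      have a: "real j + 1 \<le> h" using that eta by linarith
      have "real (n k + j) \<le> 2 * Y" using n[OF that(1)] tk[OF that(1)] a Yh h2 by simp
      hence "n k + j \<le> N" unfolding N_def by (rule le_nat_floor)
      moreover have "real j + 1 \<le> real (n k)" using n[OF that(1)] tk[OF that(1)] a Yh h2 by linarith
      hence "j < n k" by linarith
      ultimately show "n k + j \<in> {1..N}" "n k - j \<in> {1..N}" "j < n k" by auto
    qed
    let ?A = "{K..<2 * K}" and ?F = "\<lambda>m. (divisor_error (real m))\<^sup>2"
    have up: "(\<Sum>k\<in>?A. \<Sum>j<\<eta>. ?F (n k + j)) \<le> (\<Sum>m\<in>{1..N}. ?F m)"
    proof (rule sum_disjoint_windows_le)
      show "inj_on (\<lambda>(k, j). n k + j) (?A \<times> {..<\<eta>})"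
      proof (rule inj_onI, clarify)
        fix k i l j assume *: "k \<in> ?A" "l \<in> ?A" "i < \<eta>" "j < \<eta>" "n k + i = n l + j"
        have "k = l" using gapn[of k l] gapn[of l k] * by (cases k l rule: linorder_cases) auto
        thus "k = l \<and> i = j" using * by simp
      qed
    qed (use rng in auto)
    have lo: "(\<Sum>k\<in>?A. \<Sum>j<\<eta>. ?F (n k - j)) \<le> (\<Sum>m\<in>{1..N}. ?F m)"
    proof (rule sum_disjoint_windows_le)
      show "inj_on (\<lambda>(k, j). n k - j) (?A \<times> {..<\<eta>})"
      proof (rule inj_onI, clarify)
        fix k i l j assume *: "k \<in> ?A" "l \<in> ?A" "i < \<eta>" "j < \<eta>" "n k - i = n l - j"
        have "i < n k" "j < n l" using rng * by auto
        hence e: "n k + j = n l + i" using * by linarith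
        have "k = l" using gapn[of k l] gapn[of l k] * e by (cases k l rule: linorder_cases) auto
        thus "k = l \<and> i = j" using e by simp
      qed
    qed (use rng in auto)
    \<comment> \<open>Averaging over a window: the same square is written once for each of the
      \<eta> offsets j, and each copy is compared with a different pair of neighbours.\<close>
    have "real \<eta> * (\<Sum>k\<in>?A. (divisor_error (z / real k))\<^sup>2) = (\<Sum>k\<in>?A. \<Sum>j<\<eta>. (divisor_error (z / real k))\<^sup>2)"
      by (simp add: sum_distrib_left)
    also have "\<dots> \<le> (\<Sum>k\<in>?A. \<Sum>j<\<eta>. 2 * ?F (n k + j) + 2 * ?F (n k - j) + 2 * (real \<eta> * L)\<^sup>2)"
    proof (intro sum_mono)
      fix k j assume kj: "k \<in> ?A" "j \<in> {..<\<eta>}"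
      show "(divisor_error (z / real k))\<^sup>2 \<le> 2 * ?F (n k + j) + 2 * ?F (n k - j) + 2 * (real \<eta> * L)\<^sup>2"
        unfolding n_def L_def
      proof (intro divisor_error_square_le_neighbours)
        show "1 \<le> z / real k" "real \<eta> \<le> z / real k - 1" "z / real k + real \<eta> \<le> 2 * Y"
          using tk[OF kj(1)] eta Yh h2 by linarith+
      qed (use kj eta in auto)
    qed
    also have "\<dots> = 2 * (\<Sum>k\<in>?A. \<Sum>j<\<eta>. ?F (n k + j)) + 2 * (\<Sum>k\<in>?A. \<Sum>j<\<eta>. ?F (n k - j))
        + \<kappa> * (real \<eta> * (2 * (real \<eta> * L)\<^sup>2))"
      by (simp add: sum.distrib sum_distrib_left \<kappa>_def)
    also have "\<dots> \<le> 4 * (\<Sum>m\<in>{1..N}. ?F m) + \<kappa> * (real \<eta> * (2 * (real \<eta> * L)\<^sup>2))"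
      using up lo by linarith
    also have "(\<Sum>m\<in>{1..N}. ?F m) \<le> C0 * (2 * Y) powr (3 / 2 + \<delta>)"
    proof -
      have "(\<Sum>m\<in>{1..N}. ?F m) \<le> C0 * real N powr (3 / 2 + \<delta>)" by (rule C0(2)[OF N(1)])
      also have "\<dots> \<le> C0 * (2 * Y) powr (3 / 2 + \<delta>)"
        using N C0 assms by (intro mult_left_mono powr_mono2) auto
      finally show ?thesis .
    qed
    finally have main: "real \<eta> * (\<Sum>k\<in>?A. (divisor_error (z / real k))\<^sup>2)
        \<le> 4 * (C0 * (2 * Y) powr (3 / 2 + \<delta>)) + \<kappa> * (real \<eta> * (2 * (real \<eta> * L)\<^sup>2))" by simp
    have "(\<Sum>k\<in>?A. (divisor_error (z / real k))\<^sup>2)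
       \<le> 4 * (C0 * (2 * Y) powr (3 / 2 + \<delta>)) / real \<eta> + 2 * \<kappa> * (real \<eta> * L)\<^sup>2"
      using main eta(1) by (simp add: field_simps)
    also have "\<dots> \<le> 4 * (C0 * (2 * Y) powr (3 / 2 + \<delta>)) / (h / 2) + 2 * \<kappa> * (h * L)\<^sup>2"
    proof (intro add_mono mult_left_mono power_mono mult_right_mono divide_left_mono)
      show "0 \<le> L" using Yh h2 by (simp add: L_def)
    qed (use eta h2 kap C0 L_def Yh in \<open>auto simp: L_def\<close>)
    also have "\<dots> = 64 * C0 * ((2 * Y) powr (3 / 2 + \<delta>) * (8 * h) powr (-1)) + \<kappa> * (8 * h)\<^sup>2 * L\<^sup>2 / 32"
      using h2 by (simp add: powr_minus field_simps power_mult_distrib)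
    also have "(2 * Y) powr (3 / 2 + \<delta>) * (8 * h) powr (-1) \<le> 2 powr (3 / 2 + \<delta>) * (z powr (1 + \<delta>) * \<kappa> powr (- 2 / 3))"
    proof -
      have 8: "(8 * h) powr (-1) = z powr (- 1 / 2) * \<kappa> powr (5 / 6)"
      proof -
        have "(8 * h) powr (-1) = (z powr (1 / 2)) powr (-1) * (\<kappa> powr (- 5 / 6)) powr (-1)"
          unfolding h_def by (subst powr_mult[symmetric]) auto
        thus ?thesis by (simp only: powr_powr) simp
      qed
      have Ypow: "(2 * Y) powr (3 / 2 + \<delta>) = 2 powr (3 / 2 + \<delta>) * (z powr (3 / 2 + \<delta>) * \<kappa> powr (- (3 / 2 + \<delta>)))"
      proof -
        have "(2 * Y) powr (3 / 2 + \<delta>) = 2 powr (3 / 2 + \<delta>) * (z / \<kappa>) powr (3 / 2 + \<delta>)"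
          unfolding Y_def by (rule powr_mult)
        also have "(z / \<kappa>) powr (3 / 2 + \<delta>) = z powr (3 / 2 + \<delta>) / \<kappa> powr (3 / 2 + \<delta>)"
          by (rule powr_divide)
        finally show ?thesis by (simp only: powr_minus divide_inverse)
      qed
      have "(2 * Y) powr (3 / 2 + \<delta>) * (8 * h) powr (-1)
         = 2 powr (3 / 2 + \<delta>) * ((z powr (3 / 2 + \<delta>) * z powr (- 1 / 2)) * (\<kappa> powr (- (3 / 2 + \<delta>)) * \<kappa> powr (5 / 6)))"
        unfolding 8 Ypow by (simp add: mult_ac)
      also have "z powr (3 / 2 + \<delta>) * z powr (- 1 / 2) = z powr (1 + \<delta>)"
        by (simp add: add.commute flip: powr_add)
      also have "\<kappa> powr (- (3 / 2 + \<delta>)) * \<kappa> powr (5 / 6) \<le> \<kappa> powr (- 2 / 3)"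
        unfolding powr_add[symmetric] using kap assms by (intro powr_mono) auto
      finally show ?thesis by (simp add: mult_left_mono)
    qed
    also have "\<kappa> * (8 * h)\<^sup>2 * L\<^sup>2 / 32 \<le> C1 * (z powr (1 + \<delta>) * \<kappa> powr (- 2 / 3))"
    proof -
      have "(8 * h)\<^sup>2 = (8 * h) powr 2" using h2 by (simp add: powr_numeral)
      also have "\<dots> = z * \<kappa> powr (- 5 / 3)"
        using z kap by (simp add: h_def powr_mult powr_powr)
      finally have "\<kappa> * (8 * h)\<^sup>2 = z * (\<kappa> powr 1 * \<kappa> powr (- 5 / 3))" using kap by simp
      also have "\<kappa> powr 1 * \<kappa> powr (- 5 / 3) = \<kappa> powr (- 2 / 3)" by (subst powr_add[symmetric]) simp
      finally have a: "\<kappa> * (8 * h)\<^sup>2 = z * \<kappa> powr (- 2 / 3)" .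
      have "L \<le> 3 + ln z"
      proof -
        have "z * 1 \<le> z * \<kappa>" using z kap by (intro mult_left_mono) auto
        hence "Y \<le> z" using kap by (simp add: Y_def divide_le_eq)
        hence "ln (2 * Y) \<le> ln (2 * z)"
          using Yh h2 z by (subst ln_le_cancel_iff) auto
        thus ?thesis using z ln_2_less_1 by (simp add: L_def ln_mult)
      qed
      moreover have "L \<ge> 0" using Yh h2 by (simp add: L_def)
      ultimately have "L\<^sup>2 \<le> (3 + ln z)\<^sup>2" by (intro power_mono) auto
      also have "\<dots> \<le> C1 * z powr \<delta>" by (rule C1(2)[OF z])
      finally have "z * \<kappa> powr (- 2 / 3) * L\<^sup>2 \<le> z * \<kappa> powr (- 2 / 3) * (C1 * z powr \<delta>)"
        using z by (intro mult_left_mono) auto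
      also have "\<dots> = C1 * (z powr (1 + \<delta>) * \<kappa> powr (- 2 / 3))"
        using z by (simp add: powr_add)
      finally have "z * \<kappa> powr (- 2 / 3) * L\<^sup>2 \<le> C1 * (z powr (1 + \<delta>) * \<kappa> powr (- 2 / 3))" .
      moreover have "0 \<le> z * \<kappa> powr (- 2 / 3) * L\<^sup>2" using z by simp
      ultimately show ?thesis unfolding a by linarith
    qed
    finally show ?thesis using C0 by (simp add: C_def \<kappa>_def algebra_simps mult_left_mono)
  qed
  moreover have "C > 0" using C0 C1 by (auto simp: C_def intro!: add_pos_pos mult_pos_pos)
  ultimately show ?thesis by blast
qed

text \<open>Cauchy-Schwarz on a dyadic block gives z^(1/2) K^(1/6) up to z^(\<delta> / 2), at most
  z^(4/7) since K \<le> z^(3/7). The number of blocks is logarithmic and takes up the other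
  z^(\<delta> / 2).\<close>

lemma sum_divisor_error:
  assumes "\<delta> > 0"
  shows "\<exists>C>0. \<forall>z::real. \<forall>J::nat. 2 ^ J \<le> z powr (3 / 7) \<longrightarrow> z powr (1 / 7) \<ge> 16 \<longrightarrow> z \<ge> 1 \<longrightarrow>
     (\<Sum>k\<in>{1..2 ^ J}. \<bar>divisor_error (z / real k)\<bar>) \<le> C * z powr (4 / 7 + \<delta>)"
proof -
  obtain C0 where C0: "C0 > 0" "\<And>(z::real) (K::nat). K \<ge> 1 \<Longrightarrow> real K \<le> z powr (3 / 7) \<Longrightarrow> z powr (1 / 7) \<ge> 16 \<Longrightarrow> z \<ge> 1 \<Longrightarrow>
     (\<Sum>k\<in>{K..<2 * K}. (divisor_error (z / real k))\<^sup>2) \<le> C0 * (z powr (1 + \<delta>) * real K powr (- 2 / 3))"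
    using divisor_error_block_square[OF assms] by blast
  obtain C1 where C1: "C1 > 0" "\<And>x::real. x \<ge> 1 \<Longrightarrow> (1 + ln x) ^ 1 \<le> C1 * x powr (\<delta> / 2)"
    using log_power_le_powr[of "\<delta> / 2" 1 1] assms by auto
  define C where "C = C1 * sqrt C0"
  have "(\<Sum>k\<in>{1..2 ^ J}. \<bar>divisor_error (z / real k)\<bar>) \<le> C * z powr (4 / 7 + \<delta>)"
    if J: "2 ^ J \<le> z powr (3 / 7)" and z16: "z powr (1 / 7) \<ge> 16" and z: "z \<ge> 1" for z :: real and J :: nat
  proof -
    let ?g = "\<lambda>k. \<bar>divisor_error (z / real k)\<bar>"
    have block: "(\<Sum>k\<in>{2 ^ j..<2 * 2 ^ j}. ?g k) \<le> sqrt C0 * z powr (4 / 7 + \<delta> / 2)" if "j \<le> J" for j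
    proof -
      define K :: nat where "K = 2 ^ j"
      have "real K = 2 ^ j" by (simp add: K_def)
      also have "\<dots> \<le> 2 ^ J" using that by (intro power_increasing) auto
      also note J
      finally have "real K \<le> z powr (3 / 7)" .
      moreover have "K \<ge> 1" by (simp add: K_def)
      ultimately have K: "K \<ge> 1" "real K \<le> z powr (3 / 7)" by auto
      have "(\<Sum>k\<in>{K..<2 * K}. ?g k)\<^sup>2 \<le> (\<Sum>k\<in>{K..<2 * K}. (?g k)\<^sup>2) * real (card {K..<2 * K})"
        by (rule sum_squared_le_sum_of_squares)
      also have "\<dots> = (\<Sum>k\<in>{K..<2 * K}. (divisor_error (z / real k))\<^sup>2) * real K" by simp
      also have "\<dots> \<le> C0 * (z powr (1 + \<delta>) * real K powr (- 2 / 3)) * real K"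
        by (intro mult_right_mono C0(2) K z16 z) auto
      also have "\<dots> = C0 * (z powr (1 + \<delta>) * (real K powr (- 2 / 3) * real K powr 1))"
        by simp
      also have "real K powr (- 2 / 3) * real K powr 1 = real K powr (1 / 3)"
        by (subst powr_add[symmetric]) simp
      also have "C0 * (z powr (1 + \<delta>) * real K powr (1 / 3)) \<le> C0 * (z powr (1 + \<delta>) * (z powr (3 / 7)) powr (1 / 3))"
        using K C0 by (intro mult_left_mono powr_mono2) auto
      also have "\<dots> = C0 * z powr (8 / 7 + \<delta>)"
        by (simp add: powr_powr add.commute flip: powr_add)
      also have "\<dots> = (sqrt C0 * z powr (4 / 7 + \<delta> / 2))\<^sup>2"
        using C0 z by (simp add: power_mult_distrib powr_power)
      finally show ?thesis unfolding K_def[symmetric]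
        by (rule power2_le_imp_le) (use C0 in auto)
    qed
    have blocks: "(\<Sum>k\<in>{1..<2 ^ i}. ?g k) \<le> real i * (sqrt C0 * z powr (4 / 7 + \<delta> / 2))" if "i \<le> J + 1" for i
      using that
    proof (induction i)
      case (Suc i)
      have "(1::nat) \<le> 2 ^ i" by simp
      hence un: "{1..<2 ^ Suc i} = {1..<2 ^ i} \<union> {2 ^ i..<2 * (2::nat) ^ i}" by auto
      have "(\<Sum>k\<in>{1..<2 ^ Suc i}. ?g k) = (\<Sum>k\<in>{1..<2 ^ i}. ?g k) + (\<Sum>k\<in>{2 ^ i..<2 * 2 ^ i}. ?g k)"
        by (subst un, rule sum.union_disjoint) auto
      also have "\<dots> \<le> real i * (sqrt C0 * z powr (4 / 7 + \<delta> / 2)) + sqrt C0 * z powr (4 / 7 + \<delta> / 2)"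
        using Suc by (intro add_mono block) auto
      finally show ?case by (simp add: algebra_simps)
    qed simp
    have "(\<Sum>k\<in>{1..2 ^ J}. ?g k) \<le> (\<Sum>k\<in>{1..<2 ^ (J + 1)}. ?g k)"
      by (intro sum_mono2) auto
    also have "\<dots> \<le> real (J + 1) * (sqrt C0 * z powr (4 / 7 + \<delta> / 2))" by (rule blocks) simp
    also have "real (J + 1) \<le> C1 * z powr (\<delta> / 2)"
    proof -
      have "real J * ln 2 = ln (2 ^ J)" by (simp add: ln_realpow)
      also have "\<dots> \<le> ln (z powr (3 / 7))" using J z by (subst ln_le_cancel_iff) auto
      also have "\<dots> = 3 / 7 * ln z" using z by (simp add: ln_powr)
      finally have "real J * ln 2 \<le> 3 / 7 * ln z" .
      moreover have "real J * (2 / 3) \<le> real J * ln 2" using ln2_ge_two_thirds by (intro mult_left_mono) auto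
      ultimately have "real J \<le> ln z" using ln_ge_zero[OF z] by linarith
      thus ?thesis using C1(2)[OF z] by simp
    qed
    finally have "(\<Sum>k\<in>{1..2 ^ J}. ?g k) \<le> C1 * z powr (\<delta> / 2) * (sqrt C0 * z powr (4 / 7 + \<delta> / 2))"
      using C0 by (simp add: mult_right_mono)
    also have "\<dots> = C * (z powr (\<delta> / 2) * z powr (4 / 7 + \<delta> / 2))" by (simp add: C_def)
    also have "z powr (\<delta> / 2) * z powr (4 / 7 + \<delta> / 2) = z powr (4 / 7 + \<delta>)"
      by (simp add: add.commute flip: powr_add)
    finally show ?thesis .
  qed
  moreover have "C > 0" using C0 C1 by (simp add: C_def)
  ultimately show ?thesis by blast
qed

section \<open>Tails of series and sums of powers\<close>

text \<open>Comparison with a telescoping sum: the mean value theorem bounds k^(- p) - (k + 1)^(- p)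
  below by p (2 k)^(- p - 1), as k + 1 \<le> 2 k. The doubling is the source of 2^(1 + p).\<close>

lemma sum_powr_tail_le:
  assumes "p > 0" "N \<ge> (1::nat)"
  shows "(\<Sum>k\<in>{N..<M}. real k powr (- 1 - p)) \<le> 2 powr (1 + p) / p * real N powr (- p)"
proof -
  have step: "real k powr (- 1 - p) \<le> 2 powr (1 + p) / p * (real k powr (- p) - real (Suc k) powr (- p))"
    if k: "k \<ge> 1" for k :: nat
  proof -
    have der: "DERIV (\<lambda>u. - (u powr (- p))) u :> p * u powr (- p - 1)" if "real k \<le> u" for u
      using k that by (auto intro!: derivative_eq_intros)
    obtain u where u: "real k < u" "u < real (Suc k)"
      "- (real (Suc k) powr (- p)) - - (real k powr (- p)) = (real (Suc k) - real k) * (p * u powr (- p - 1))"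
      using MVT2[of "real k" "real (Suc k)" "\<lambda>u. - (u powr (- p))" "\<lambda>u. p * u powr (- p - 1)"] der by auto
    have "(2 * real k) powr (- p - 1) \<le> u powr (- p - 1)"
      using u k assms by (intro powr_mono2') auto
    hence "p * (2 powr (- p - 1) * real k powr (- p - 1)) \<le> p * u powr (- p - 1)"
      using assms by (simp add: powr_mult)
    also have "\<dots> = real k powr (- p) - real (Suc k) powr (- p)" using u(3) by simp
    finally have "2 powr (1 + p) / p * (p * (2 powr (- p - 1) * real k powr (- p - 1)))
       \<le> 2 powr (1 + p) / p * (real k powr (- p) - real (Suc k) powr (- p))"
      using assms by (intro mult_left_mono) auto
    also have "2 powr (1 + p) / p * (p * (2 powr (- p - 1) * real k powr (- p - 1)))
       = (2 powr (1 + p) * 2 powr (- p - 1)) * real k powr (- p - 1)" using assms by simp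
    also have "2 powr (1 + p) * 2 powr (- p - 1) = (1::real)" by (subst powr_add[symmetric]) simp
    also have "- p - 1 = - 1 - p" by simp
    finally show ?thesis by simp
  qed
  have "(\<Sum>k\<in>{N..<M}. real k powr (- 1 - p)) \<le> (\<Sum>k\<in>{N..<M}. 2 powr (1 + p) / p * (real k powr (- p) - real (Suc k) powr (- p)))"
    using assms by (intro sum_mono step) auto
  also have "\<dots> = 2 powr (1 + p) / p * (\<Sum>k\<in>{N..<M}. real k powr (- p) - real (Suc k) powr (- p))"
    by (simp add: sum_distrib_left)
  also have "\<dots> \<le> 2 powr (1 + p) / p * real N powr (- p)"
  proof (intro mult_left_mono)
    show "(\<Sum>k\<in>{N..<M}. real k powr (- p) - real (Suc k) powr (- p)) \<le> real N powr (- p)"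
    proof (cases "N \<le> M")
      case True
      have "(\<Sum>k\<in>{N..<M}. real k powr (- p) - real (Suc k) powr (- p))
          = - (\<Sum>k\<in>{N..<M}. real (Suc k) powr (- p) - real k powr (- p))"
        by (simp add: sum_negf[symmetric])
      also have "\<dots> = real N powr (- p) - real M powr (- p)"
        using sum_Suc_diff'[OF True, of "\<lambda>k. real k powr (- p)"] by simp
      finally show ?thesis by simp
    qed simp
  qed (use assms in auto)
  finally show ?thesis .
qed

lemma infsum_powr_tail:
  fixes g :: "nat \<Rightarrow> complex"
  assumes "p > 0" "B \<ge> 0" and g: "\<And>k. k \<ge> 1 \<Longrightarrow> norm (g k) \<le> B * real k powr (- 1 - p)"
  shows "(\<lambda>k. norm (g k)) summable_on {1..}"
    and "N \<ge> 1 \<Longrightarrow> norm (infsum g {1..} - (\<Sum>k\<in>{1..<N}. g k)) \<le> B * (2 powr (1 + p) / p) * real N powr (- p)"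
proof -
  \<comment> \<open>\<open>infsum\<close> is a limit over all finite subsets, so arbitrary finite
    sets beyond N are bounded here, not just intervals. This yields both summability and the tail
    estimate.\<close>
  have fin: "(\<Sum>k\<in>F. norm (g k)) \<le> B * (2 powr (1 + p) / p) * real N powr (- p)"
    if "N \<ge> 1" "finite F" "F \<subseteq> {N..}" for F N
  proof -
    have "F \<subseteq> {N..<Suc (Max F)}"
      using that Max_ge[of F] by (auto simp: less_Suc_eq_le)
    hence "(\<Sum>k\<in>F. norm (g k)) \<le> (\<Sum>k\<in>{N..<Suc (Max F)}. norm (g k))"
      by (intro sum_mono2) auto
    also have "\<dots> \<le> (\<Sum>k\<in>{N..<Suc (Max F)}. B * real k powr (- 1 - p))"
      using that by (intro sum_mono g) auto
    also have "\<dots> = B * (\<Sum>k\<in>{N..<Suc (Max F)}. real k powr (- 1 - p))" by (rule sum_distrib_left[symmetric])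
    also have "\<dots> \<le> B * (2 powr (1 + p) / p * real N powr (- p))"
      using assms that by (intro mult_left_mono sum_powr_tail_le) auto
    finally show ?thesis by (simp add: mult.assoc)
  qed
  have abs: "(\<lambda>k. norm (g k)) summable_on {N..}" if "N \<ge> 1" for N
    by (rule nonneg_bounded_partial_sums_imp_summable_on[where C = "B * (2 powr (1 + p) / p) * real N powr (- p)"])
       (use that fin in \<open>auto simp: eventually_finite_subsets_at_top intro!: exI[of _ "{}"]\<close>)
  show "(\<lambda>k. norm (g k)) summable_on {1..}" using abs[of 1] by simp
  assume N: "N \<ge> 1"
  have summ: "g summable_on {N..}" by (rule abs_summable_summable) (rule abs[OF N])
  have "infsum g ({1..<N} \<union> {N..}) = infsum g {1..<N} + infsum g {N..}"
    by (intro infsum_Un_disjoint summ) auto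
  moreover have "{1..<N} \<union> {N..} = {1..}" using N by auto
  ultimately have "infsum g {1..} - (\<Sum>k\<in>{1..<N}. g k) = infsum g {N..}" by simp
  also have "norm \<dots> \<le> infsum (\<lambda>k. norm (g k)) {N..}" by (rule norm_infsum_bound[OF abs[OF N]])
  also have "\<dots> \<le> B * (2 powr (1 + p) / p) * real N powr (- p)"
    by (rule infsum_le_finite_sums[OF abs[OF N]]) (use fin N in auto)
  finally show "norm (infsum g {1..} - (\<Sum>k\<in>{1..<N}. g k)) \<le> B * (2 powr (1 + p) / p) * real N powr (- p)" .
qed

lemma sum_powr_le:
  assumes "0 \<le> \<alpha>" "\<alpha> < 1"
  shows "(\<Sum>b\<in>{1..n}. real b powr (- \<alpha>)) \<le> real n powr (1 - \<alpha>) / (1 - \<alpha>)"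
proof (induction n)
  case (Suc n)
  have "real (Suc n) powr (- \<alpha>) \<le> (real (Suc n) powr (1 - \<alpha>) - real n powr (1 - \<alpha>)) / (1 - \<alpha>)"
  proof (cases "n = 0")
    case True
    thus ?thesis using assms by (simp add: field_simps)
  next
    case False
    have der: "DERIV (\<lambda>u. u powr (1 - \<alpha>)) u :> (1 - \<alpha>) * u powr (- \<alpha>)" if "real n \<le> u" for u
      using False that by (auto intro!: derivative_eq_intros)
    obtain u where u: "real n < u" "u < real (Suc n)"
      "real (Suc n) powr (1 - \<alpha>) - real n powr (1 - \<alpha>) = (real (Suc n) - real n) * ((1 - \<alpha>) * u powr (- \<alpha>))"
      using MVT2[of "real n" "real (Suc n)" "\<lambda>u. u powr (1 - \<alpha>)" "\<lambda>u. (1 - \<alpha>) * u powr (- \<alpha>)"] der by auto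
    have "real (Suc n) powr (- \<alpha>) \<le> u powr (- \<alpha>)" using u False assms by (intro powr_mono2') auto
    thus ?thesis unfolding u(3) using assms by simp
  qed
  thus ?case using Suc.IH by (simp add: diff_divide_distrib)
qed simp

text \<open>For fixed a the sum over b is at most a constant times t^(1 - \<alpha>) / a, so the
  second variable costs only a logarithm. This serves the trivial estimate of the pairs where the
  floor is large.\<close>

lemma sum_hpairs_powr_le:
  assumes "0 \<le> \<alpha>" "\<alpha> < 1" "t \<ge> 1"
  shows "(\<Sum>(a, b)\<in>hpairs t. real (a * b) powr (- \<alpha>)) \<le> t powr (1 - \<alpha>) / (1 - \<alpha>) * (1 + ln t)"
proof -
  define n where "n = nat \<lfloor>t\<rfloor>"
  have n: "n > 0" "real n \<le> t" using assms unfolding n_def by linarith+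
  have eq: "hpairs t = (SIGMA a:{1..n}. {1..nat \<lfloor>t / real a\<rfloor>})"
  proof (intro set_eqI iffI)
    fix p assume p: "p \<in> hpairs t"
    then obtain a b where ab: "p = (a, b)" "a > 0" "b > 0" "real (a * b) \<le> t" by (auto simp: hpairs_def)
    hence "real b \<le> t / real a" by (simp add: field_simps)
    hence "b \<le> nat \<lfloor>t / real a\<rfloor>" by (rule le_nat_floor)
    thus "p \<in> (SIGMA a:{1..n}. {1..nat \<lfloor>t / real a\<rfloor>})"
      using ab p hpairs_subset[of t] by (auto simp: n_def)
  next
    fix p assume "p \<in> (SIGMA a:{1..n}. {1..nat \<lfloor>t / real a\<rfloor>})"
    then obtain a b where ab: "p = (a, b)" "a \<ge> 1" "b \<ge> 1" "b \<le> nat \<lfloor>t / real a\<rfloor>" by auto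
    have "0 \<le> t / real a" using assms by simp
    hence "real b \<le> t / real a" using ab by linarith
    thus "p \<in> hpairs t" using ab by (simp add: hpairs_def field_simps)
  qed
  have "(\<Sum>(a, b)\<in>hpairs t. real (a * b) powr (- \<alpha>))
     = (\<Sum>a\<in>{1..n}. \<Sum>b\<in>{1..nat \<lfloor>t / real a\<rfloor>}. real (a * b) powr (- \<alpha>))"
    unfolding eq by (subst sum.Sigma) auto
  also have "\<dots> \<le> (\<Sum>a\<in>{1..n}. t powr (1 - \<alpha>) / (1 - \<alpha>) * (1 / real a))"
  proof (rule sum_mono)
    fix a assume a: "a \<in> {1..n}"
    have "(\<Sum>b\<in>{1..nat \<lfloor>t / real a\<rfloor>}. real (a * b) powr (- \<alpha>))
        = real a powr (- \<alpha>) * (\<Sum>b\<in>{1..nat \<lfloor>t / real a\<rfloor>}. real b powr (- \<alpha>))"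
      by (simp add: powr_mult sum_distrib_left)
    also have "\<dots> \<le> real a powr (- \<alpha>) * (real (nat \<lfloor>t / real a\<rfloor>) powr (1 - \<alpha>) / (1 - \<alpha>))"
      using assms by (intro mult_left_mono sum_powr_le) auto
    also have "\<dots> \<le> real a powr (- \<alpha>) * ((t / real a) powr (1 - \<alpha>) / (1 - \<alpha>))"
      using assms by (intro mult_left_mono divide_right_mono powr_mono2) auto
    also have "\<dots> = t powr (1 - \<alpha>) / (1 - \<alpha>) * (real a powr (- \<alpha>) / real a powr (1 - \<alpha>))"
      by (simp add: powr_divide mult_ac)
    also have "real a powr (- \<alpha>) / real a powr (1 - \<alpha>) = 1 / real a"
    proof -
      have "real a powr (- \<alpha>) / real a powr (1 - \<alpha>) = real a powr (- 1)"
        by (subst powr_diff[symmetric]) simp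
      thus ?thesis using a by (simp add: powr_minus_divide)
    qed
    finally show "(\<Sum>b\<in>{1..nat \<lfloor>t / real a\<rfloor>}. real (a * b) powr (- \<alpha>)) \<le> t powr (1 - \<alpha>) / (1 - \<alpha>) * (1 / real a)" .
  qed
  also have "\<dots> = t powr (1 - \<alpha>) / (1 - \<alpha>) * harm n"
    by (simp add: sum_distrib_left harm_def inverse_eq_divide)
  also have "\<dots> \<le> t powr (1 - \<alpha>) / (1 - \<alpha>) * (1 + ln t)"
  proof (intro mult_left_mono)
    have "ln (real n) \<le> ln t" using n by (subst ln_le_cancel_iff) auto
    thus "harm n \<le> 1 + ln t" using harm_le_ln[OF n(1)] by linarith
  qed (use assms in auto)
  finally show ?thesis .
qed

section \<open>The sum over all factorisations\<close>

definition hyperbola_sum :: "(nat \<Rightarrow> complex) \<Rightarrow> real \<Rightarrow> complex" where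
  "hyperbola_sum f z = (\<Sum>(a, b)\<in>hpairs z. f (nat \<lfloor>z / real (a * b)\<rfloor>))"

text \<open>The floor equals k exactly when z / (k + 1) < a b \<le> z / k, so each k contributes a
  difference of two values of \<open>divsum\<close>. The induction peels off one such layer at a
  time; the pairs left over have floor at least N.\<close>

lemma hyperbola_sum_eq_by_floor:
  assumes "z > 0" "N \<ge> 1"
  shows "hyperbola_sum f z = (\<Sum>(a, b)\<in>hpairs (z / real N). f (nat \<lfloor>z / real (a * b)\<rfloor>))
     + (\<Sum>k\<in>{1..<N}. f k * of_real (divsum (z / real k) - divsum (z / real (k + 1))))"
  using assms(2)
proof (induction N rule: dec_induct)
  case base
  thus ?case by (simp add: hyperbola_sum_def)
next
  case (step N)
  let ?g = "\<lambda>(a, b). f (nat \<lfloor>z / real (a * b)\<rfloor>)"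
  let ?P = "hpairs (z / real N)" and ?Q = "hpairs (z / real (Suc N))"
  have sub: "?Q \<subseteq> ?P" using step assms by (intro hpairs_mono divide_left_mono) auto
  have "(\<Sum>p\<in>?P. ?g p) = (\<Sum>p\<in>?Q. ?g p) + (\<Sum>p\<in>?P - ?Q. ?g p)"
    using sum.subset_diff[OF sub, of ?g] by (simp add: add.commute)
  also have "(\<Sum>p\<in>?P - ?Q. ?g p) = (\<Sum>p\<in>?P - ?Q. f N)"
  proof (rule sum.cong[OF refl])
    fix p assume p: "p \<in> ?P - ?Q"
    then obtain a b where ab: "p = (a, b)" "a > 0" "b > 0" "real (a * b) \<le> z / real N"
      "real (a * b) > z / real (Suc N)"
      by (cases p) (auto simp: hpairs_def not_le simp del: of_nat_mult of_nat_Suc)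
    define m where "m = real (a * b)"
    have m: "m > 0" "m \<le> z / real N" "m > z / real (Suc N)" using ab by (simp_all add: m_def)
    have "real N \<le> z / m" "z / m < real N + 1"
      using m step.hyps by (simp_all add: field_simps)
    hence "nat \<lfloor>z / m\<rfloor> = N" by linarith
    thus "?g p = f N" by (simp add: ab(1) m_def)
  qed
  also have "\<dots> = f N * of_real (divsum (z / real N) - divsum (z / real (N + 1)))"
    using sub by (simp add: divsum_def card_Diff_subset of_nat_diff card_mono mult.commute)
  finally have "(\<Sum>p\<in>?P. ?g p) = (\<Sum>p\<in>?Q. ?g p) + f N * of_real (divsum (z / real N) - divsum (z / real (N + 1)))" .
  thus ?case using step by (simp add: add_ac)
qed

lemma abs_ln_quotient_diff_le:
  assumes "k \<ge> (1::nat)"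
  shows "\<bar>ln (real k) / real k - ln (real (k + 1)) / real (k + 1)\<bar> \<le> (1 + ln (real k)) / (real k)\<^sup>2"
proof -
  have k: "real k \<ge> 1" using assms by simp
  define l where "l = ln (1 + 1 / real k)"
  have lk: "ln (real (k + 1)) = ln (real k) + l"
  proof -
    have "real (k + 1) = real k * (1 + 1 / real k)" using k by (simp add: field_simps)
    moreover have "ln (real k * (1 + 1 / real k)) = ln (real k) + ln (1 + 1 / real k)"
      using k by (intro ln_mult_pos add_pos_pos) auto
    ultimately show ?thesis by (simp only: l_def)
  qed
  have l: "0 \<le> l" "l \<le> 1 / real k" unfolding l_def using k by (auto intro: ln_add_one_self_le_self)
  have eq: "ln (real k) / real k - ln (real (k + 1)) / real (k + 1)
      = (ln (real k) / real k - l) / real (k + 1)"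
    unfolding lk using k by (simp add: field_simps)
  have "\<bar>ln (real k) / real k - l\<bar> \<le> ln (real k) / real k + 1 / real k"
  proof -
    have "0 \<le> ln (real k) / real k" using k by (intro divide_nonneg_nonneg) auto
    thus ?thesis using l unfolding abs_le_iff by linarith
  qed
  also have "\<dots> = (1 + ln (real k)) / real k" by (simp add: add_divide_distrib)
  finally have "\<bar>ln (real k) / real k - l\<bar> / real (k + 1) \<le> (1 + ln (real k)) / real k / real k"
    using k by (intro frac_le) auto
  thus ?thesis unfolding eq by (simp add: power2_eq_square)
qed

text \<open>The spare exponent \<delta> absorbs the logarithm in the terms of \<open>C3\<close>, so
  that both tails are bounded by the same power of N.\<close>

lemma C1_C3_tails:
  fixes f :: "nat \<Rightarrow> complex"
  assumes "0 \<le> \<alpha>" "0 < \<delta>" "\<alpha> + \<delta> < 1" "B \<ge> 0"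
    and f: "\<And>k. k \<ge> 1 \<Longrightarrow> norm (f k) \<le> B * real k powr \<alpha>"
  shows "\<exists>C\<ge>0. \<forall>N\<ge>1.
     norm (C1 f - (\<Sum>k\<in>{1..<N}. f k / of_nat (k * (k + 1)))) \<le> C * real N powr (\<alpha> + \<delta> - 1) \<and>
     norm (C3 f - (\<Sum>k\<in>{1..<N}. f k * of_real (ln (real k) / real k - ln (real (k + 1)) / real (k + 1)))) \<le> C * real N powr (\<alpha> + \<delta> - 1)"
proof -
  obtain C0 where C0: "C0 > 0" "\<And>x::real. x \<ge> 1 \<Longrightarrow> (1 + ln x) ^ 1 \<le> C0 * x powr \<delta>"
    using log_power_le_powr[of \<delta> 1 1] assms by auto
  define p where "p = 1 - \<alpha> - \<delta>"
  have p: "p > 0" using assms by (simp add: p_def)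
  define D where "D = 2 powr (1 + p) / p"
  have D: "D \<ge> 0" using p by (simp add: D_def)
  have g1: "norm (f k / of_nat (k * (k + 1))) \<le> B * real k powr (- 1 - p)" if k: "k \<ge> 1" for k
  proof -
    have "norm (f k / of_nat (k * (k + 1))) = norm (f k) / (real k * (real k + 1))"
      by (simp only: norm_divide norm_of_nat) (simp only: of_nat_mult of_nat_add of_nat_1)
    also have "\<dots> \<le> (B * real k powr (\<alpha> + \<delta>)) / (real k * real k)"
    proof (intro frac_le)
      show "norm (f k) \<le> B * real k powr (\<alpha> + \<delta>)"
      proof -
        have "B * real k powr \<alpha> \<le> B * real k powr (\<alpha> + \<delta>)"
          using assms k by (intro mult_left_mono powr_mono) auto
        thus ?thesis using f[OF k] by linarith
      qed
    qed (use k assms in \<open>auto intro!: mult_left_mono\<close>)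
    also have "\<dots> = B * (real k powr (\<alpha> + \<delta>) / real k powr 2)"
      using k by (simp add: powr_numeral power2_eq_square)
    also have "real k powr (\<alpha> + \<delta>) / real k powr 2 = real k powr (- 1 - p)"
      unfolding powr_diff[symmetric] by (simp add: p_def algebra_simps)
    finally show ?thesis .
  qed
  have g3: "norm (f k * of_real (ln (real k) / real k - ln (real (k + 1)) / real (k + 1))) \<le> (B * C0) * real k powr (- 1 - p)"
    if k: "k \<ge> 1" for k
  proof -
    have "norm (f k * of_real (ln (real k) / real k - ln (real (k + 1)) / real (k + 1)))
       = norm (f k) * \<bar>ln (real k) / real k - ln (real (k + 1)) / real (k + 1)\<bar>"
      by (simp only: norm_mult norm_of_real)
    also have "\<dots> \<le> (B * real k powr \<alpha>) * ((1 + ln (real k)) / (real k)\<^sup>2)"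
      using f[OF k] abs_ln_quotient_diff_le[OF k] assms by (intro mult_mono) auto
    also have "\<dots> \<le> (B * real k powr \<alpha>) * ((C0 * real k powr \<delta>) / (real k)\<^sup>2)"
      using C0(2)[of "real k"] k assms by (intro mult_left_mono divide_right_mono) auto
    also have "\<dots> = B * C0 * (real k powr (\<alpha> + \<delta>) / real k powr 2)"
      using k by (simp add: powr_numeral powr_add)
    also have "real k powr (\<alpha> + \<delta>) / real k powr 2 = real k powr (- 1 - p)"
      unfolding powr_diff[symmetric] by (simp add: p_def algebra_simps)
    finally show ?thesis .
  qed
  have "norm (C1 f - (\<Sum>k\<in>{1..<N}. f k / of_nat (k * (k + 1)))) \<le> (B * (1 + C0) * D) * real N powr (\<alpha> + \<delta> - 1) \<and>
     norm (C3 f - (\<Sum>k\<in>{1..<N}. f k * of_real (ln (real k) / real k - ln (real (k + 1)) / real (k + 1)))) \<le> (B * (1 + C0) * D) * real N powr (\<alpha> + \<delta> - 1)"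
    if N: "N \<ge> 1" for N
  proof -
    have ex: "real N powr (\<alpha> + \<delta> - 1) = real N powr (- p)" by (simp add: p_def algebra_simps)
    have "norm (C1 f - (\<Sum>k\<in>{1..<N}. f k / of_nat (k * (k + 1)))) \<le> B * D * real N powr (- p)"
      unfolding C1_def D_def using N by (intro infsum_powr_tail(2) p g1) (use assms in auto)
    also have "\<dots> \<le> (B * (1 + C0) * D) * real N powr (- p)"
      using C0 D assms by (intro mult_right_mono) (auto simp: algebra_simps)
    finally have 1: "norm (C1 f - (\<Sum>k\<in>{1..<N}. f k / of_nat (k * (k + 1)))) \<le> (B * (1 + C0) * D) * real N powr (- p)" .
    have "norm (C3 f - (\<Sum>k\<in>{1..<N}. f k * of_real (ln (real k) / real k - ln (real (k + 1)) / real (k + 1)))) \<le> (B * C0) * D * real N powr (- p)"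
      unfolding C3_def D_def using N by (intro infsum_powr_tail(2) p g3) (use assms C0 in auto)
    also have "\<dots> \<le> (B * (1 + C0) * D) * real N powr (- p)"
      using C0 D assms by (intro mult_right_mono) (auto simp: algebra_simps)
    finally show ?thesis using 1 unfolding ex by blast
  qed
  moreover have "B * (1 + C0) * D \<ge> 0" using assms C0 D by auto
  ultimately show ?thesis by blast
qed

text \<open>The origin of \<open>C1\<close> and \<open>C3\<close>: weighted with f k and summed over
  k, the two terms on the right are partial sums of these series, and the coefficient of z alone
  assembles to \<open>C2\<close>.\<close>

lemma divisor_main_diff:
  assumes "z > 0" "k \<ge> (1::nat)"
  shows "divisor_main (z / real k) - divisor_main (z / real (k + 1))
    = z * (ln z + 2 * euler_mascheroni - 1) * (1 / (real k * real (k + 1)))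
      - z * (ln (real k) / real k - ln (real (k + 1)) / real (k + 1))"
proof -
  define p q where "p = real k" and "q = real (k + 1)"
  have pq: "p > 0" "q > 0" "q = p + 1" using assms by (simp_all add: p_def q_def)
  have inv: "1 / (p * q) = inverse p - inverse q" using pq by (simp add: field_simps)
  have ln: "ln (z / p) = ln z - ln p" "ln (z / q) = ln z - ln q"
    using pq assms by (simp_all add: ln_div)
  show ?thesis
    unfolding divisor_main_def p_def[symmetric] q_def[symmetric] inv ln
    by (simp only: divide_inverse) (simp add: algebra_simps)
qed

text \<open>With N about z^(3/7), three errors have the same size z^((4 + 3 \<alpha>) / 7), up to
  small powers: the pairs with a b \<le> z / N, the completion of the partial sums to
  \<open>C1\<close> and \<open>C3\<close>, and the divisor errors weighted by f k, which is at most
  of order N^\<alpha>.\<close>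

lemma hyperbola_sum_asymptotics:
  fixes f :: "nat \<Rightarrow> complex"
  assumes \<alpha>: "0 \<le> \<alpha>" "\<alpha> < 1" and "0 < \<delta>" and B: "B \<ge> 0"
    and f: "\<And>k. k \<ge> 1 \<Longrightarrow> norm (f k) \<le> B * real k powr \<alpha>"
  shows "\<exists>C>0. \<forall>z\<ge>1. norm (hyperbola_sum f z - (C1 f * of_real (z * ln z) + C2 f * of_real z))
     \<le> C * z powr ((4 + 3 * \<alpha>) / 7 + \<delta>)"
proof -
  \<comment> \<open>The cap keeps \<alpha> + \<eta> below 1, so that the tails of \<open>C1\<close>
    and \<open>C3\<close> are bounded by a negative power of N.\<close>
  define \<eta> where "\<eta> = min \<delta> ((1 - \<alpha>) / 2)"
  have "\<eta> \<le> (1 - \<alpha>) / 2" unfolding \<eta>_def by (rule min.cobounded2)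
  moreover have "\<eta> > 0" "\<eta> \<le> \<delta>" using assms by (auto simp: \<eta>_def)
  moreover have "\<alpha> + (1 - \<alpha>) / 2 < 1" using \<alpha> by (simp add: field_simps)
  ultimately have eta: "\<eta> > 0" "\<eta> \<le> \<delta>" "\<alpha> + \<eta> < 1" by auto
  define \<beta> where "\<beta> = (4 + 3 * \<alpha>) / 7"
  obtain Ct where Ct: "Ct \<ge> 0" "\<And>N. N \<ge> 1 \<Longrightarrow>
     norm (C1 f - (\<Sum>k\<in>{1..<N}. f k / of_nat (k * (k + 1)))) \<le> Ct * real N powr (\<alpha> + \<eta> - 1)"
     "\<And>N. N \<ge> 1 \<Longrightarrow> norm (C3 f - (\<Sum>k\<in>{1..<N}. f k * of_real (ln (real k) / real k - ln (real (k + 1)) / real (k + 1)))) \<le> Ct * real N powr (\<alpha> + \<eta> - 1)"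
    using C1_C3_tails[OF \<alpha>(1) eta(1) eta(3) B f] by blast
  obtain Cd where Cd: "Cd > 0" "\<And>(z::real) (J::nat). 2 ^ J \<le> z powr (3 / 7) \<Longrightarrow> z powr (1 / 7) \<ge> 16 \<Longrightarrow> z \<ge> 1 \<Longrightarrow>
     (\<Sum>k\<in>{1..2 ^ J}. \<bar>divisor_error (z / real k)\<bar>) \<le> Cd * z powr (4 / 7 + \<eta>)"
    using sum_divisor_error[OF eta(1)] by blast
  \<comment> \<open>Only \<eta> / 2 is spent on the logarithm: the tails lose a further 3 \<eta> / 7
    through N^(\<alpha> + \<eta> - 1), and 1/2 + 3/7 < 1.\<close>
  obtain Cl where Cl: "Cl > 0" "\<And>x::real. x \<ge> 1 \<Longrightarrow> (4 + ln x) ^ 1 \<le> Cl * x powr (\<eta> / 2)"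
    using log_power_le_powr[of "\<eta> / 2" 4 1] eta by auto
  define g where "g = (euler_mascheroni :: real)"
  have g: "0 < g" "g < 1" using euler_mascheroni_pos euler_mascheroni_less_13_over_22 by (auto simp: g_def)
  have large: "norm (hyperbola_sum f z - (C1 f * of_real (z * ln z) + C2 f * of_real z))
       \<le> (B * (2 / (1 - \<alpha>)) * Cl + 4 * Ct * Cl + 2 * B * Cd) * z powr (\<beta> + \<delta>)"
    if z: "z \<ge> 1" and z16: "z powr (1 / 7) \<ge> 16" for z :: real
  proof -
    \<comment> \<open>This makes N the largest power of 2 not above z^(3/7): a power of 2 to suit
      the dyadic blocks, and at least z^(3/7) / 2, as the tail estimates require.\<close>
    define J where "J = nat \<lfloor>log 2 (z powr (3 / 7))\<rfloor>"
    define N :: nat where "N = 2 ^ J"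
    have lg: "log 2 (z powr (3 / 7)) \<ge> 0" using z by (simp add: zero_le_log_cancel_iff ge_one_powr_ge_zero)
    have J: "real J \<le> log 2 (z powr (3 / 7))" "log 2 (z powr (3 / 7)) \<le> real J + 1"
      using lg unfolding J_def by linarith+
    have N1: "real N \<le> z powr (3 / 7)"
    proof -
      have "real N = 2 powr real J" by (simp add: N_def powr_realpow)
      also have "\<dots> \<le> 2 powr (log 2 (z powr (3 / 7)))" using J by (intro powr_mono) auto
      finally show ?thesis using z by simp
    qed
    have N2: "z powr (3 / 7) / 2 \<le> real N"
    proof -
      have "z powr (3 / 7) = 2 powr (log 2 (z powr (3 / 7)))" using z by simp
      also have "\<dots> \<le> 2 powr (real J + 1)" using J by (intro powr_mono) auto
      also have "\<dots> = 2 * real N" by (simp add: N_def powr_add powr_realpow)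
      finally show ?thesis by simp
    qed
    have N0: "N \<ge> 1" by (simp add: N_def)
    have z0: "z > 0" using z by simp
    define l where "l = 4 + ln z"
    have l: "l \<ge> 4" "l \<le> Cl * z powr (\<eta> / 2)" using z Cl(2)[OF z] by (auto simp: l_def)

    define Tl where "Tl = (\<Sum>(a, b)\<in>hpairs (z / real N). f (nat \<lfloor>z / real (a * b)\<rfloor>))"
    define t where "t = z / real N"
    have t: "t \<ge> 1" "t \<le> 2 * z powr (4 / 7)"
    proof -
      have "z powr (3 / 7) \<le> z powr 1" using z by (intro powr_mono) auto
      thus "t \<ge> 1" using N1 N0 z by (simp add: t_def le_divide_eq)
      have "t \<le> z powr 1 / (z powr (3 / 7) / 2)" unfolding t_def using N2 N0 z by (intro frac_le) auto
      also have "\<dots> = 2 * (z powr 1 / z powr (3 / 7))" by simp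
      also have "z powr 1 / z powr (3 / 7) = z powr (4 / 7)" unfolding powr_diff[symmetric] by simp
      finally show "t \<le> 2 * z powr (4 / 7)" .
    qed
    have tail: "norm Tl \<le> B * (2 / (1 - \<alpha>)) * Cl * z powr (\<beta> + \<eta>)"
    proof -
      have "norm Tl \<le> (\<Sum>(a, b)\<in>hpairs t. B * z powr \<alpha> * real (a * b) powr (- \<alpha>))"
        unfolding Tl_def t_def[symmetric]
      proof (rule sum_norm_le, clarify)
        fix a b assume ab: "(a, b) \<in> hpairs t"
        define m where "m = real (a * b)"
        have "a * b \<ge> 1" using ab by (auto simp: hpairs_def Suc_le_eq)
        hence m: "m \<ge> 1" by (simp add: m_def del: of_nat_mult)
        have "m \<le> t" using ab by (simp add: hpairs_def m_def)
        also have "t \<le> z" using N0 z by (simp add: t_def divide_le_eq)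
        finally have "z / m \<ge> 1" using m by (simp add: le_divide_eq)
        hence k: "nat \<lfloor>z / m\<rfloor> \<ge> 1" "real (nat \<lfloor>z / m\<rfloor>) \<le> z / m" by linarith+
        have "norm (f (nat \<lfloor>z / m\<rfloor>)) \<le> B * real (nat \<lfloor>z / m\<rfloor>) powr \<alpha>" by (rule f[OF k(1)])
        also have "\<dots> \<le> B * (z / m) powr \<alpha>" using k B \<alpha> by (intro mult_left_mono powr_mono2) auto
        also have "\<dots> = B * z powr \<alpha> * m powr (- \<alpha>)" by (simp add: powr_divide powr_minus_divide)
        finally show "norm (f (nat \<lfloor>z / real (a * b)\<rfloor>)) \<le> B * z powr \<alpha> * real (a * b) powr (- \<alpha>)"
          by (simp only: m_def)
      qed
      also have "\<dots> = B * z powr \<alpha> * (\<Sum>(a, b)\<in>hpairs t. real (a * b) powr (- \<alpha>))"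
        by (simp add: sum_distrib_left case_prod_unfold)
      also have "\<dots> \<le> B * z powr \<alpha> * (t powr (1 - \<alpha>) / (1 - \<alpha>) * (1 + ln t))"
        using B by (intro mult_left_mono sum_hpairs_powr_le \<alpha> t) auto
      also have "\<dots> \<le> B * z powr \<alpha> * (2 * z powr (4 / 7 * (1 - \<alpha>)) / (1 - \<alpha>) * l)"
      proof (intro mult_left_mono mult_mono divide_right_mono)
        have "t powr (1 - \<alpha>) \<le> (2 * z powr (4 / 7)) powr (1 - \<alpha>)" using t \<alpha> by (intro powr_mono2) auto
        also have "\<dots> = 2 powr (1 - \<alpha>) * z powr (4 / 7 * (1 - \<alpha>))" by (simp add: powr_mult powr_powr)
        also have "\<dots> \<le> 2 powr 1 * z powr (4 / 7 * (1 - \<alpha>))" using \<alpha> by (intro mult_right_mono powr_mono) auto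
        finally show "t powr (1 - \<alpha>) \<le> 2 * z powr (4 / 7 * (1 - \<alpha>))" by simp
        have "t \<le> z" using N0 z by (simp add: t_def divide_le_eq)
        hence "ln t \<le> ln z" using t by (subst ln_le_cancel_iff) auto
        thus "1 + ln t \<le> l" by (simp add: l_def)
      qed (use B \<alpha> t in auto)
      also have "\<dots> = B * (2 / (1 - \<alpha>)) * (z powr \<alpha> * z powr (4 / 7 * (1 - \<alpha>))) * l"
        by simp
      also have "z powr \<alpha> * z powr (4 / 7 * (1 - \<alpha>)) = z powr \<beta>"
        unfolding powr_add[symmetric] by (simp add: \<beta>_def field_simps)
      also have "B * (2 / (1 - \<alpha>)) * z powr \<beta> * l \<le> B * (2 / (1 - \<alpha>)) * z powr \<beta> * (Cl * z powr (\<eta> / 2))"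
        using l B \<alpha> by (intro mult_left_mono) auto
      also have "\<dots> = B * (2 / (1 - \<alpha>)) * Cl * z powr (\<beta> + \<eta> / 2)" by (simp add: powr_add)
      also have "\<dots> \<le> B * (2 / (1 - \<alpha>)) * Cl * z powr (\<beta> + \<eta>)"
        using B \<alpha> Cl eta z by (intro mult_left_mono powr_mono) auto
      finally show ?thesis .
    qed

    define \<Sigma>1 where "\<Sigma>1 = (\<Sum>k\<in>{1..<N}. f k / of_nat (k * (k + 1)))"
    define \<Sigma>3 where "\<Sigma>3 = (\<Sum>k\<in>{1..<N}. f k * of_real (ln (real k) / real k - ln (real (k + 1)) / real (k + 1)))"
    define E where "E = (\<Sum>k\<in>{1..<N}. f k * of_real (divisor_error (z / real k) - divisor_error (z / real (k + 1))))"
    have split: "hyperbola_sum f z = Tl + (of_real (z * (ln z + 2 * g - 1)) * \<Sigma>1 - of_real z * \<Sigma>3) + E"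
    proof -
      have "(\<Sum>k\<in>{1..<N}. f k * of_real (divsum (z / real k) - divsum (z / real (k + 1))))
        = (\<Sum>k\<in>{1..<N}. (of_real (z * (ln z + 2 * g - 1)) * (f k / of_nat (k * (k + 1)))
             - of_real z * (f k * of_real (ln (real k) / real k - ln (real (k + 1)) / real (k + 1))))
             + f k * of_real (divisor_error (z / real k) - divisor_error (z / real (k + 1))))"
      proof (intro sum.cong refl)
        fix k assume k: "k \<in> {1..<N}"
        define q where "q = ln (real k) / real k - ln (real (k + 1)) / real (k + 1)"
        define e where "e = divisor_error (z / real k) - divisor_error (z / real (k + 1))"
        have D: "divsum (z / real k) - divsum (z / real (k + 1))
            = z * (ln z + 2 * g - 1) * (1 / (real k * real (k + 1))) - z * q + e"
          using divisor_main_diff[OF z0, of k] k unfolding e_def divisor_error_def q_def g_def by simp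
        have "(of_real (1 / (real k * real (k + 1))) :: complex) = 1 / of_nat (k * (k + 1))" by (simp add: algebra_simps)
        thus "f k * of_real (divsum (z / real k) - divsum (z / real (k + 1)))
          = (of_real (z * (ln z + 2 * g - 1)) * (f k / of_nat (k * (k + 1))) - of_real z * (f k * of_real q)) + f k * of_real e"
          unfolding D of_real_add of_real_diff of_real_mult[of "z * (ln z + 2 * g - 1)"] of_real_mult[of z q]
          by (simp add: algebra_simps)
      qed
      thus ?thesis
        unfolding hyperbola_sum_eq_by_floor[OF z0 N0] Tl_def \<Sigma>1_def \<Sigma>3_def E_def
        by (simp only: sum.distrib sum_subtractf sum_distrib_left add.assoc)
    qed
    have C2: "C2 f = of_real (2 * g - 1) * C1 f - C3 f" by (simp add: C2_def g_def)
    have "hyperbola_sum f z - (C1 f * of_real (z * ln z) + C2 f * of_real z)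
       = Tl - of_real (z * (ln z + 2 * g - 1)) * (C1 f - \<Sigma>1) + of_real z * (C3 f - \<Sigma>3) + E"
      unfolding split C2 by (simp add: algebra_simps)
    also have "norm \<dots> \<le> norm Tl + norm (of_real (z * (ln z + 2 * g - 1)) * (C1 f - \<Sigma>1)) + norm (of_real z * (C3 f - \<Sigma>3)) + norm E"
      by (intro order.trans[OF norm_triangle_ineq] add_mono order.trans[OF norm_triangle_ineq4] order_refl)
    finally have bound: "norm (hyperbola_sum f z - (C1 f * of_real (z * ln z) + C2 f * of_real z))
       \<le> norm Tl + norm (of_real (z * (ln z + 2 * g - 1)) * (C1 f - \<Sigma>1)) + norm (of_real z * (C3 f - \<Sigma>3)) + norm E" .

    have Np: "real N powr (\<alpha> + \<eta> - 1) \<le> 2 * z powr (3 / 7 * (\<alpha> + \<eta> - 1))"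
    proof -
      have "real N powr (\<alpha> + \<eta> - 1) \<le> (z powr (3 / 7) / 2) powr (\<alpha> + \<eta> - 1)"
        using N2 z eta by (intro powr_mono2') auto
      also have "\<dots> = z powr (3 / 7 * (\<alpha> + \<eta> - 1)) * 2 powr (1 - \<alpha> - \<eta>)"
      proof -
        have "(2::real) powr (\<alpha> + \<eta> - 1) = 1 / 2 powr (1 - \<alpha> - \<eta>)"
          by (subst powr_minus_divide[symmetric]) (simp add: algebra_simps)
        thus ?thesis by (simp add: powr_divide powr_powr)
      qed
      also have "\<dots> \<le> z powr (3 / 7 * (\<alpha> + \<eta> - 1)) * 2 powr 1"
        using eta \<alpha> by (intro mult_left_mono powr_mono) auto
      finally show ?thesis by simp
    qed
    have zN: "z * l * (Ct * real N powr (\<alpha> + \<eta> - 1)) \<le> 2 * Ct * Cl * z powr (\<beta> + \<eta>)"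
    proof -
      have "z * l * (Ct * real N powr (\<alpha> + \<eta> - 1))
          \<le> z * (Cl * z powr (\<eta> / 2)) * (Ct * (2 * z powr (3 / 7 * (\<alpha> + \<eta> - 1))))"
        using l Np z Ct(1) Cl(1) by (intro mult_mono mult_left_mono) auto
      also have "\<dots> = 2 * Ct * Cl * (z powr 1 * (z powr (\<eta> / 2) * z powr (3 / 7 * (\<alpha> + \<eta> - 1))))"
        using z by simp
      also have "z powr 1 * (z powr (\<eta> / 2) * z powr (3 / 7 * (\<alpha> + \<eta> - 1))) = z powr (1 + (\<eta> / 2 + 3 / 7 * (\<alpha> + \<eta> - 1)))"
        by (simp only: powr_add)
      also have "2 * Ct * Cl * \<dots> \<le> 2 * Ct * Cl * z powr (\<beta> + \<eta>)"
        using Ct(1) Cl(1) z eta by (intro mult_left_mono powr_mono) (auto simp: \<beta>_def field_simps)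
      finally show ?thesis .
    qed
    have b1: "norm (of_real (z * (ln z + 2 * g - 1)) * (C1 f - \<Sigma>1)) \<le> 2 * Ct * Cl * z powr (\<beta> + \<eta>)"
    proof -
      have "\<bar>ln z + 2 * g - 1\<bar> \<le> l" using g z ln_ge_zero[OF z] unfolding l_def abs_le_iff by linarith
      hence "norm (of_real (z * (ln z + 2 * g - 1)) * (C1 f - \<Sigma>1)) \<le> z * l * (Ct * real N powr (\<alpha> + \<eta> - 1))"
        unfolding norm_mult norm_of_real abs_mult using Ct(2)[OF N0] z l \<Sigma>1_def
        by (intro mult_mono) auto
      thus ?thesis using zN by linarith
    qed
    have b3: "norm (of_real z * (C3 f - \<Sigma>3)) \<le> 2 * Ct * Cl * z powr (\<beta> + \<eta>)"
    proof -
      have "norm (of_real z * (C3 f - \<Sigma>3)) \<le> z * l * (Ct * real N powr (\<alpha> + \<eta> - 1))"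
        unfolding norm_mult norm_of_real using Ct(3)[OF N0] z l \<Sigma>3_def
        by (intro mult_mono) auto
      thus ?thesis using zN by linarith
    qed
    have bE: "norm E \<le> 2 * B * Cd * z powr (\<beta> + \<eta>)"
    proof -
      let ?d = "\<lambda>k. \<bar>divisor_error (z / real k)\<bar>"
      have "norm E \<le> (\<Sum>k\<in>{1..<N}. B * z powr (3 / 7 * \<alpha>) * (?d k + ?d (k + 1)))"
        unfolding E_def
      proof (rule sum_norm_le)
        fix k assume k: "k \<in> {1..<N}"
        have "norm (f k) \<le> B * real k powr \<alpha>" using k by (intro f) auto
        also have "\<dots> \<le> B * (z powr (3 / 7)) powr \<alpha>"
          using k N1 B \<alpha> by (intro mult_left_mono powr_mono2) auto
        finally have "norm (f k) \<le> B * z powr (3 / 7 * \<alpha>)" by (simp add: powr_powr)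
        thus "norm (f k * of_real (divisor_error (z / real k) - divisor_error (z / real (k + 1))))
            \<le> B * z powr (3 / 7 * \<alpha>) * (?d k + ?d (k + 1))"
          unfolding norm_mult norm_of_real using B by (intro mult_mono abs_triangle_ineq4) auto
      qed
      also have "\<dots> = B * z powr (3 / 7 * \<alpha>) * ((\<Sum>k\<in>{1..<N}. ?d k) + (\<Sum>k\<in>{1..<N}. ?d (k + 1)))"
        by (simp only: sum.distrib sum_distrib_left[symmetric])
      also have "\<dots> \<le> B * z powr (3 / 7 * \<alpha>) * ((\<Sum>k\<in>{1..N}. ?d k) + (\<Sum>k\<in>{1..N}. ?d k))"
      proof (intro mult_left_mono add_mono)
        show "(\<Sum>k\<in>{1..<N}. ?d k) \<le> (\<Sum>k\<in>{1..N}. ?d k)" by (intro sum_mono2) auto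
        have "(\<Sum>k\<in>{1..<N}. ?d (k + 1)) = (\<Sum>k\<in>{1 + 1..<N + 1}. ?d k)"
          by (rule sum.shift_bounds_nat_ivl[symmetric])
        also have "\<dots> \<le> (\<Sum>k\<in>{1..N}. ?d k)" by (intro sum_mono2) auto
        finally show "(\<Sum>k\<in>{1..<N}. ?d (k + 1)) \<le> (\<Sum>k\<in>{1..N}. ?d k)" .
      qed (use B in auto)
      also have "\<dots> \<le> B * z powr (3 / 7 * \<alpha>) * (Cd * z powr (4 / 7 + \<eta>) + Cd * z powr (4 / 7 + \<eta>))"
      proof -
        have "(\<Sum>k\<in>{1..N}. ?d k) \<le> Cd * z powr (4 / 7 + \<eta>)"
          unfolding N_def using N1 z z16 by (intro Cd(2)) (auto simp: N_def)
        thus ?thesis using B by (intro mult_left_mono add_mono) auto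
      qed
      also have "\<dots> = 2 * B * Cd * (z powr (3 / 7 * \<alpha>) * z powr (4 / 7 + \<eta>))" by (simp add: algebra_simps)
      also have "z powr (3 / 7 * \<alpha>) * z powr (4 / 7 + \<eta>) = z powr (\<beta> + \<eta>)"
        unfolding powr_add[symmetric] by (simp add: \<beta>_def field_simps)
      finally show ?thesis .
    qed
    have "norm (hyperbola_sum f z - (C1 f * of_real (z * ln z) + C2 f * of_real z))
       \<le> (B * (2 / (1 - \<alpha>)) * Cl + 4 * Ct * Cl + 2 * B * Cd) * z powr (\<beta> + \<eta>)"
      using bound tail b1 b3 bE by (simp add: algebra_simps)
    also have "\<dots> \<le> (B * (2 / (1 - \<alpha>)) * Cl + 4 * Ct * Cl + 2 * B * Cd) * z powr (\<beta> + \<delta>)"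
      using B \<alpha> Cl Ct(1) Cd(1) eta z by (intro mult_left_mono powr_mono) auto
    finally show ?thesis .
  qed
  \<comment> \<open>All z with z^(1/7) < 16 lie below Z. There every quantity is bounded and the
    power of z is at least 1, so a constant is enough.\<close>
  define Z where "Z = (16::real) ^ 7"
  define S where "S = B * Z powr \<alpha> * divsum Z + (norm (C1 f) * (Z * ln Z) + norm (C2 f) * Z)"
  have small: "norm (hyperbola_sum f z - (C1 f * of_real (z * ln z) + C2 f * of_real z))
       \<le> S * z powr (\<beta> + \<delta>)"
    if z: "z \<ge> 1" and z16: "z powr (1 / 7) < 16" for z :: real
  proof -
    have zZ: "z \<le> Z"
    proof -
      have "z = (z powr (1 / 7)) ^ 7" using z by (simp add: powr_power)
      also have "\<dots> \<le> 16 ^ 7" using z16 by (intro power_mono) auto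
      finally show ?thesis by (simp only: Z_def)
    qed
    have "norm (hyperbola_sum f z) \<le> real (card (hpairs z)) * (B * Z powr \<alpha>)"
      unfolding hyperbola_sum_def
    proof (rule sum_norm_bound, clarify)
      fix a b assume ab: "(a, b) \<in> hpairs z"
      define m where "m = real (a * b)"
      have "a * b \<ge> 1" using ab by (auto simp: hpairs_def Suc_le_eq)
      hence m: "m \<ge> 1" by (simp add: m_def del: of_nat_mult)
      have mz: "m \<le> z" using ab by (simp add: hpairs_def m_def)
      have "z / m \<ge> 1" using m mz by (simp add: le_divide_eq)
      hence k: "nat \<lfloor>z / m\<rfloor> \<ge> 1" "real (nat \<lfloor>z / m\<rfloor>) \<le> z / m" by linarith+
      have "z / m \<le> z / 1" using m z by (intro divide_left_mono) auto
      hence kZ: "real (nat \<lfloor>z / m\<rfloor>) \<le> Z" using k zZ by linarith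
      have "norm (f (nat \<lfloor>z / m\<rfloor>)) \<le> B * real (nat \<lfloor>z / m\<rfloor>) powr \<alpha>" by (rule f[OF k(1)])
      also have "\<dots> \<le> B * Z powr \<alpha>" using kZ B \<alpha> by (intro mult_left_mono powr_mono2) auto
      finally show "norm (f (nat \<lfloor>z / real (a * b)\<rfloor>)) \<le> B * Z powr \<alpha>" by (simp only: m_def)
    qed
    also have "\<dots> \<le> divsum Z * (B * Z powr \<alpha>)"
      using divsum_mono[OF zZ] B by (intro mult_right_mono) (auto simp: divsum_def)
    finally have 1: "norm (hyperbola_sum f z) \<le> B * Z powr \<alpha> * divsum Z" by (simp only: mult_ac)
    have "norm (C1 f * of_real (z * ln z) + C2 f * of_real z) \<le> norm (C1 f * of_real (z * ln z)) + norm (C2 f * of_real z)"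
      by (rule norm_triangle_ineq)
    also have "\<dots> = norm (C1 f) * (z * ln z) + norm (C2 f) * z"
      unfolding norm_mult norm_of_real using z by simp
    also have "\<dots> \<le> norm (C1 f) * (Z * ln Z) + norm (C2 f) * Z"
      using z zZ by (intro add_mono mult_left_mono mult_mono) auto
    finally have 2: "norm (C1 f * of_real (z * ln z) + C2 f * of_real z) \<le> norm (C1 f) * (Z * ln Z) + norm (C2 f) * Z" .
    have "norm (hyperbola_sum f z - (C1 f * of_real (z * ln z) + C2 f * of_real z)) \<le> S"
      unfolding S_def by (intro order.trans[OF norm_triangle_ineq4] add_mono[OF 1 2])
    also have "S = S * 1" by simp
    also have "\<dots> \<le> S * z powr (\<beta> + \<delta>)"
    proof (intro mult_left_mono)
      show "1 \<le> z powr (\<beta> + \<delta>)" using z \<alpha> assms by (intro ge_one_powr_ge_zero) (auto simp: \<beta>_def)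
      show "0 \<le> S" unfolding S_def using B
        by (intro add_nonneg_nonneg mult_nonneg_nonneg) (auto simp: Z_def divsum_def)
    qed
    finally show ?thesis .
  qed
  define C where "C = max S (B * (2 / (1 - \<alpha>)) * Cl + 4 * Ct * Cl + 2 * B * Cd) + 1"
  have "norm (hyperbola_sum f z - (C1 f * of_real (z * ln z) + C2 f * of_real z)) \<le> C * z powr (\<beta> + \<delta>)"
    if z: "z \<ge> 1" for z
  proof (cases "z powr (1 / 7) < 16")
    case True
    show ?thesis by (rule order.trans[OF small[OF z True]]) (auto simp: C_def intro!: mult_right_mono)
  next
    case False
    hence F: "z powr (1 / 7) \<ge> 16" by simp
    show ?thesis by (rule order.trans[OF large[OF z F]]) (auto simp: C_def intro!: mult_right_mono)
  qed
  moreover have "C > 0"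
  proof -
    have "0 \<le> B * (2 / (1 - \<alpha>)) * Cl + 4 * Ct * Cl + 2 * B * Cd"
      using B \<alpha> Cl Ct(1) Cd(1) by auto
    thus ?thesis unfolding C_def by linarith
  qed
  ultimately show ?thesis unfolding \<beta>_def by blast
qed

section \<open>Coprime factorisations\<close>

text \<open>Fix a prime p dividing n. Multiplication by p matches the squarefree divisors prime to p
  with those divisible by p and reverses the sign of \<open>moebius_mu\<close>.\<close>

lemma sum_moebius_mu_divisors:
  assumes "n > 0"
  shows "(\<Sum>d | d dvd n. moebius_mu d) = (if n = 1 then 1 else 0)"
proof (cases "n = 1")
  case True
  thus ?thesis by (simp add: moebius_mu_def)
next
  case False
  then obtain p where p: "prime p" "p dvd n" using prime_factor_nat by blast
  have fin: "finite {d. d dvd n}" using assms by simp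
  define A where "A = {d. d dvd n \<and> squarefree d \<and> \<not> p dvd d}"
  define B where "B = {d. d dvd n \<and> squarefree d \<and> p dvd d}"
  have cop: "coprime p d" if "\<not> p dvd d" for d
    using p(1) that by (simp add: prime_imp_coprime)
  have B: "B = (*) p ` A"
  proof (intro set_eqI iffI)
    fix d assume "d \<in> B"
    then obtain e where e: "d = p * e" "p * e dvd n" "squarefree (p * e)" by (auto simp: B_def)
    have "\<not> p dvd e"
    proof
      assume "p dvd e"
      hence "p\<^sup>2 dvd p * e" by (simp add: power2_eq_square)
      hence "\<not> squarefree (p * e)" using p by (intro not_squarefreeI[of p]) (auto simp: prime_nat_iff)
      thus False using e by simp
    qed
    moreover have "squarefree e" using e(3) by (rule squarefree_mono[rotated]) simp
    moreover have "e dvd n" using e(2) by (rule dvd_mult_right)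
    ultimately show "d \<in> (*) p ` A" using e by (auto simp: A_def)
  next
    fix d assume "d \<in> (*) p ` A"
    then obtain e where e: "d = p * e" "e dvd n" "squarefree e" "\<not> p dvd e" by (auto simp: A_def)
    have "p * e dvd n" using p(2) e(2) cop[OF e(4)] by (rule divides_mult)
    moreover have "squarefree (p * e)"
      using cop[OF e(4)] squarefree_prime[OF p(1)] e(3) by (rule squarefree_mult_coprime)
    ultimately show "d \<in> B" by (simp add: B_def e(1))
  qed
  have mu: "moebius_mu (p * d) = - moebius_mu d" if "d \<in> A" for d
  proof -
    have d: "squarefree d" "\<not> p dvd d" "d \<noteq> 0" using that assms by (auto simp: A_def)
    have "prime_factors (p * d) = insert p (prime_factors d)"
      using p d by (subst prime_factors_product) (auto simp: prime_factorization_prime)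
    moreover have "p \<notin> prime_factors d" using d by auto
    moreover have "squarefree (p * d)"
      using cop[OF d(2)] squarefree_prime[OF p(1)] d(1) by (rule squarefree_mult_coprime)
    ultimately show ?thesis using d by (simp add: moebius_mu_def)
  qed
  have "(\<Sum>d | d dvd n. moebius_mu d) = (\<Sum>d\<in>A \<union> B. moebius_mu d)"
    by (rule sum.mono_neutral_right[OF fin]) (auto simp: A_def B_def moebius_mu_def)
  also have "\<dots> = (\<Sum>d\<in>A. moebius_mu d) + (\<Sum>d\<in>B. moebius_mu d)"
    by (rule sum.union_disjoint) (use fin in \<open>auto simp: A_def B_def\<close>)
  also have "(\<Sum>d\<in>B. moebius_mu d) = (\<Sum>d\<in>A. moebius_mu (p * d))"
    unfolding B using p by (subst sum.reindex) (auto simp: inj_on_def)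
  also have "\<dots> = - (\<Sum>d\<in>A. moebius_mu d)" using mu by (simp add: sum_negf)
  finally show ?thesis using False by simp
qed

lemma abs_moebius_mu_le: "\<bar>moebius_mu n\<bar> \<le> 1"
  by (simp add: moebius_mu_def power_abs)

lemma norm_moebius_mu_term_le:
  assumes "k \<ge> 1"
  shows "norm (of_int (moebius_mu k) / of_nat (k ^ 2) :: complex) \<le> 1 * real k powr (- 1 - 1)"
proof -
  have "norm (of_int (moebius_mu k) / of_nat (k ^ 2) :: complex) = \<bar>real_of_int (moebius_mu k)\<bar> / (real k)\<^sup>2"
    by (simp add: norm_divide norm_power)
  also have "\<dots> \<le> 1 / (real k)\<^sup>2"
  proof (intro divide_right_mono)
    show "\<bar>real_of_int (moebius_mu k)\<bar> \<le> 1" using abs_moebius_mu_le[of k] by linarith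
  qed simp
  also have "\<dots> = real k powr (- 2)" using assms by (simp add: powr_minus_divide)
  finally show ?thesis by simp
qed

text \<open>The product of the two absolutely convergent series is rearranged according to m = k l;
  by \<open>sum_moebius_mu_divisors\<close> only m = 1 survives.\<close>

lemma sum_moebius_mu_over_squares:
  "(\<Sum>\<^sub>\<infinity>k\<in>{1..}. of_int (moebius_mu k) / of_nat (k ^ 2)) = 1 / zeta 2"
proof -
  define c :: "nat \<Rightarrow> complex" where "c = (\<lambda>k. of_int (moebius_mu k) / of_nat (k ^ 2))"
  define r :: "nat \<Rightarrow> complex" where "r = (\<lambda>k. 1 / of_nat (k ^ 2))"
  have rn: "norm (r k) \<le> 1 * real k powr (- 1 - 1)" if "k \<ge> 1" for k
    using that by (simp add: r_def norm_divide norm_power powr_minus_divide)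
  have cn: "norm (c k) \<le> 1 * real k powr (- 1 - 1)" if "k \<ge> 1" for k
    unfolding c_def by (rule norm_moebius_mu_term_le[OF that])
  have c_abs: "(\<lambda>k. norm (c k)) summable_on {1..}"
    by (rule infsum_powr_tail(1)[of 1 1]) (use cn in auto)
  have r_abs: "(\<lambda>k. norm (r k)) summable_on {1..}"
    by (rule infsum_powr_tail(1)[of 1 1]) (use rn in auto)
  have prod_abs: "(\<lambda>p. norm ((\<lambda>(k, l). c k * r l) p)) summable_on {1..} \<times> {1..}"
    unfolding Infinite_Sum.abs_summable_on_Sigma_iff
  proof (intro conjI ballI)
    fix k show "(\<lambda>l. norm (case (k, l) of (k, l) \<Rightarrow> c k * r l)) summable_on {1..}"
      using r_abs by (simp add: norm_mult summable_on_cmult_right)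
  next
    have "infsum (\<lambda>l. norm (case (k, l) of (k, l) \<Rightarrow> c k * r l)) {1..} = norm (c k) * infsum (\<lambda>l. norm (r l)) {1..}" for k
      by (simp add: norm_mult infsum_cmult_right')
    thus "(\<lambda>k. norm (infsum (\<lambda>l. norm (case (k, l) of (k, l) \<Rightarrow> c k * r l)) {1..})) summable_on {1..}"
      using c_abs by (simp add: abs_mult summable_on_cmult_left)
  qed
  hence prod_summ: "(\<lambda>(k, l). c k * r l) summable_on {1..} \<times> {1..}" by (rule abs_summable_summable)
  \<comment> \<open>The summand in the coordinates m = k l and d = k. It involves l only through m,
    so for fixed m the sum over d is a divisor sum of \<open>moebius_mu\<close>.\<close>
  define h where "h = (\<lambda>(m, d). of_int (moebius_mu d) / of_nat (m ^ 2) :: complex)"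
  define T where "T = (SIGMA m:{1::nat..}. {d. d dvd m})"
  have bij: "(\<lambda>(m, d). (d, m div d)) ((\<lambda>(k, l). (k * l, k)) p) = p" "(\<lambda>(k, l). (k * l, k)) p \<in> T"
    "h ((\<lambda>(k, l). (k * l, k)) p) = (\<lambda>(k, l). c k * r l) p"
    if "p \<in> {1..} \<times> {1..}" for p :: "nat \<times> nat"
    using that by (auto simp: T_def h_def c_def r_def power_mult_distrib Suc_le_eq split: prod.splits)
  have bij': "(\<lambda>(k, l). (k * l, k)) ((\<lambda>(m, d). (d, m div d)) q) = q" "(\<lambda>(m, d). (d, m div d)) q \<in> {1..} \<times> {1..}"
    if "q \<in> T" for q
    using that by (auto simp: T_def Suc_le_eq dvd_div_eq_0_iff intro!: Nat.gr0I)
  have hT: "infsum (\<lambda>(k, l). c k * r l) ({1..} \<times> {1..}) = infsum h T"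
    by (rule infsum_reindex_bij_witness[where j = "\<lambda>(k, l). (k * l, k)" and i = "\<lambda>(m, d). (d, m div d)"])
       (use bij bij' in auto)
  have "h summable_on T \<longleftrightarrow> (\<lambda>(k, l). c k * r l) summable_on {1..} \<times> {1..}"
    by (rule sym, rule summable_on_reindex_bij_witness[where j = "\<lambda>(k, l). (k * l, k)" and i = "\<lambda>(m, d). (d, m div d)"])
       (use bij bij' in auto)
  hence hsumm: "h summable_on T" using prod_summ by simp
  have inner: "infsum (\<lambda>d. h (m, d)) {d. d dvd m} = (if m = 1 then 1 else 0)" if m: "m \<in> {1..}" for m
  proof -
    have "infsum (\<lambda>d. h (m, d)) {d. d dvd m} = (\<Sum>d | d dvd m. of_int (moebius_mu d) / of_nat (m ^ 2))"
      using m by (simp add: h_def)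
    also have "\<dots> = of_int (\<Sum>d | d dvd m. moebius_mu d) / of_nat (m ^ 2)"
      by (simp add: sum_divide_distrib)
    also have "(\<Sum>d | d dvd m. moebius_mu d) = (if m = 1 then 1 else 0)"
      using m by (intro sum_moebius_mu_divisors) auto
    finally show ?thesis by simp
  qed
  have "infsum c {1..} * infsum r {1..} = infsum (\<lambda>k. infsum (\<lambda>l. c k * r l) {1..}) {1..}"
    by (simp add: infsum_cmult_left' infsum_cmult_right')
  also have "\<dots> = infsum (\<lambda>(k, l). c k * r l) ({1..} \<times> {1..})"
    by (rule infsum_Sigma'_banach[OF prod_summ])
  also have "\<dots> = infsum (\<lambda>m. infsum (\<lambda>d. h (m, d)) {d. d dvd m}) {1..}"
    unfolding hT T_def by (rule infsum_Sigma_banach[symmetric]) (use hsumm in \<open>simp add: T_def\<close>)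
  also have "\<dots> = infsum (\<lambda>m. if m = 1 then 1 else 0) {1::nat..}"
    using inner by (intro infsum_cong) auto
  also have "\<dots> = infsum (\<lambda>m. 1) {1::nat}"
    by (rule infsum_cong_neutral) auto
  also have "\<dots> = 1" by simp
  finally have "infsum c {1..} * infsum r {1..} = 1" .
  moreover have "zeta 2 = infsum r {1..}" by (simp add: zeta_def r_def)
  \<comment> \<open>A product equal to 1 also rules out zeta 2 = 0, which the division
    requires.\<close>
  ultimately show ?thesis by (simp add: c_def divide_simps) (auto simp: mult.commute)
qed

definition coprime_sum :: "(nat \<Rightarrow> complex) \<Rightarrow> real \<Rightarrow> complex" where
  "coprime_sum f y = (\<Sum>(a, b) | (a, b) \<in> hpairs y \<and> coprime a b. f (nat \<lfloor>y / real (a * b)\<rfloor>))"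

lemma scale_hpairs:
  assumes "e \<ge> (1::nat)"
  shows "{(a, b). (a, b) \<in> hpairs x \<and> e dvd a \<and> e dvd b} = (\<lambda>(a, b). (e * a, e * b)) ` hpairs (x / (real e)\<^sup>2)"
proof -
  have iff: "(e * a, e * b) \<in> hpairs x \<longleftrightarrow> (a, b) \<in> hpairs (x / (real e)\<^sup>2)" for a b
    using assms by (auto simp: hpairs_def field_simps power2_eq_square)
  show ?thesis
  proof (intro set_eqI iffI)
    fix p assume "p \<in> {(a, b). (a, b) \<in> hpairs x \<and> e dvd a \<and> e dvd b}"
    then obtain a b where "p = (e * a, e * b)" "(e * a, e * b) \<in> hpairs x" by (auto elim!: dvdE)
    thus "p \<in> (\<lambda>(a, b). (e * a, e * b)) ` hpairs (x / (real e)\<^sup>2)" using iff[of a b] by auto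
  qed (use iff in auto)
qed

lemma inj_on_scale: "e \<ge> (1::nat) \<Longrightarrow> inj_on (\<lambda>(a, b). (e * a, e * b)) A"
  by (auto simp: inj_on_def)

lemma scaled_floor:
  "x / real ((e * a) * (e * b)) = x / (real e)\<^sup>2 / real (a * b)"
  by (simp add: power2_eq_square mult_ac)

text \<open>Grouping the pairs by their product n produces the weights \<open>tau2\<close>. Removing
  the factor d from both entries leaves the argument of the floor unchanged, so the identity is
  exact and d survives only in the scaling of x.\<close>

lemma S2_eq_coprime_sum:
  assumes "d \<ge> 1"
  shows "S2 f d x = coprime_sum f (x / (real d)\<^sup>2)"
proof -
  let ?F = "\<lambda>(a, b). f (nat \<lfloor>x / real (a * b)\<rfloor>)"
  define S where "S = {(a, b). (a, b) \<in> hpairs x \<and> gcd a b = d}"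
  define Ns where "Ns = {n. 1 \<le> n \<and> real n \<le> x}"
  have finS: "finite S" by (rule finite_subset[OF _ finite_hpairs[of x]]) (auto simp: S_def)
  have "Ns \<subseteq> {..nat \<lfloor>x\<rfloor>}" by (auto simp: Ns_def intro: le_nat_floor)
  hence finN: "finite Ns" by (rule finite_subset) simp
  have "S2 f d x = (\<Sum>n\<in>Ns. \<Sum>p\<in>{p \<in> S. (\<lambda>(a, b). a * b) p = n}. ?F p)"
    unfolding S2_def Ns_def[symmetric]
  proof (rule sum.cong[OF refl])
    fix n assume n: "n \<in> Ns"
    have eq: "{p \<in> S. (\<lambda>(a, b). a * b) p = n} = {(a, b). 0 < a \<and> 0 < b \<and> a * b = n \<and> gcd a b = d}"
      using n by (auto simp: S_def hpairs_def Ns_def)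
    have "(\<Sum>p\<in>{p \<in> S. (\<lambda>(a, b). a * b) p = n}. ?F p) = (\<Sum>p\<in>{p \<in> S. (\<lambda>(a, b). a * b) p = n}. f (nat \<lfloor>x / real n\<rfloor>))"
      by (intro sum.cong) auto
    also have "\<dots> = of_nat (tau2 d n) * f (nat \<lfloor>x / real n\<rfloor>)" by (simp only: sum_constant eq tau2_def)
    finally show "of_nat (tau2 d n) * f (nat \<lfloor>x / real n\<rfloor>) = (\<Sum>p\<in>{p \<in> S. (\<lambda>(a, b). a * b) p = n}. ?F p)" ..
  qed
  also have "\<dots> = (\<Sum>p\<in>S. ?F p)"
    by (rule sum.group[OF finS finN]) (auto simp: S_def Ns_def hpairs_def Suc_le_eq)
  also have "S = (\<lambda>(a, b). (d * a, d * b)) ` {(a, b). (a, b) \<in> hpairs (x / (real d)\<^sup>2) \<and> coprime a b}"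
  proof -
    have "S = {(a, b). (a, b) \<in> {(a, b). (a, b) \<in> hpairs x \<and> d dvd a \<and> d dvd b} \<and> gcd a b = d}"
      by (auto simp: S_def)
    also have "\<dots> = {(a, b). (a, b) \<in> (\<lambda>(a, b). (d * a, d * b)) ` hpairs (x / (real d)\<^sup>2) \<and> gcd a b = d}"
      by (simp only: scale_hpairs[OF assms])
    also have "\<dots> = (\<lambda>(a, b). (d * a, d * b)) ` {(a, b). (a, b) \<in> hpairs (x / (real d)\<^sup>2) \<and> coprime a b}"
    proof -
      have gcd: "gcd (d * a) (d * b) = d \<longleftrightarrow> coprime a b" for a b
        using assms by (simp add: gcd_mult_distrib_nat[symmetric] coprime_iff_gcd_eq_1)
      show ?thesis
      proof (intro set_eqI iffI)
        fix p assume "p \<in> {(a, b). (a, b) \<in> (\<lambda>(a, b). (d * a, d * b)) ` hpairs (x / (real d)\<^sup>2) \<and> gcd a b = d}"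
        then obtain a b where ab: "p = (d * a, d * b)" "(a, b) \<in> hpairs (x / (real d)\<^sup>2)" "gcd (d * a) (d * b) = d"
          by auto
        have "p = (\<lambda>(a, b). (d * a, d * b)) (a, b)" by (simp add: ab(1))
        moreover have "coprime a b" using ab(3) gcd by blast
        ultimately show "p \<in> (\<lambda>(a, b). (d * a, d * b)) ` {(a, b). (a, b) \<in> hpairs (x / (real d)\<^sup>2) \<and> coprime a b}"
          using ab(2) by blast
      qed (auto simp: gcd)
    qed
    finally show ?thesis .
  qed
  also have "(\<Sum>p\<in>\<dots>. ?F p) = coprime_sum f (x / (real d)\<^sup>2)"
    unfolding coprime_sum_def
    by (subst sum.reindex[OF inj_on_scale[OF assms]]) (simp only: comp_def case_prod_unfold fst_conv snd_conv scaled_floor)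
  finally show ?thesis .
qed

text \<open>A common divisor e of a and b satisfies e^2 \<le> a b \<le> y, so the sum over e stops
  at sqrt y. Up to there y / e^2 is at least 1, where the asymptotics of
  \<open>hyperbola_sum\<close> apply.\<close>

lemma coprime_sum_eq_moebius:
  assumes "y > 0"
  shows "coprime_sum f y = (\<Sum>e\<in>{1..nat \<lfloor>sqrt y\<rfloor>}. of_int (moebius_mu e) * hyperbola_sum f (y / (real e)\<^sup>2))"
proof -
  define E where "E = nat \<lfloor>sqrt y\<rfloor>"
  let ?F = "\<lambda>(a, b). f (nat \<lfloor>y / real (a * b)\<rfloor>)"
  have "coprime_sum f y = (\<Sum>(a, b)\<in>hpairs y. if coprime a b then ?F (a, b) else 0)"
  proof -
    have "{(a, b). (a, b) \<in> hpairs y \<and> coprime a b} = {p \<in> hpairs y. (\<lambda>(a, b). coprime a b) p}" by auto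
    thus ?thesis unfolding coprime_sum_def
      by (simp only:) (subst sum.inter_filter, simp, rule sum.cong, auto)
  qed
  also have "\<dots> = (\<Sum>p\<in>hpairs y. \<Sum>e\<in>{1..E}. if e dvd fst p \<and> e dvd snd p then of_int (moebius_mu e) * ?F p else 0)"
  proof (rule sum.cong[OF refl])
    fix p assume "p \<in> hpairs y"
    then obtain a b where p: "p = (a, b)" and ab: "(a, b) \<in> hpairs y" by (cases p) auto
    hence pos: "a > 0" "b > 0" "real (a * b) \<le> y" by (auto simp: hpairs_def)
    have sub: "{e. e dvd gcd a b} = {e \<in> {1..E}. e dvd a \<and> e dvd b}"
    proof (intro set_eqI iffI)
      fix e assume "e \<in> {e. e dvd gcd a b}"
      hence e: "e dvd a" "e dvd b" by auto
      have "e > 0" "e \<le> a" "e \<le> b" using e pos by (auto intro: dvd_imp_le dvd_pos_nat)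
      hence "e * e \<le> a * b" by (intro mult_mono) auto
      hence "real (e * e) \<le> real (a * b)" by (simp only: of_nat_le_iff)
      hence "(real e)\<^sup>2 \<le> y" using pos by (simp add: power2_eq_square)
      hence "real e \<le> sqrt y" by (rule real_le_rsqrt)
      hence "e \<le> E" unfolding E_def by (rule le_nat_floor)
      thus "e \<in> {e \<in> {1..E}. e dvd a \<and> e dvd b}" using e \<open>e > 0\<close> by simp
    qed auto
    have "gcd a b > 0" using pos by simp
    hence "(\<Sum>e | e dvd gcd a b. moebius_mu e) = (if gcd a b = 1 then 1 else 0)"
      by (rule sum_moebius_mu_divisors)
    hence "(if coprime a b then ?F (a, b) else 0) = of_int (\<Sum>e | e dvd gcd a b. moebius_mu e) * ?F (a, b)"
      by (simp add: coprime_iff_gcd_eq_1)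
    also have "\<dots> = (\<Sum>e\<in>{e \<in> {1..E}. e dvd a \<and> e dvd b}. of_int (moebius_mu e) * ?F (a, b))"
      unfolding sub by (simp add: sum_distrib_right)
    also have "\<dots> = (\<Sum>e\<in>{1..E}. if e dvd a \<and> e dvd b then of_int (moebius_mu e) * ?F (a, b) else 0)"
      by (rule sum.inter_filter) simp
    finally show "(case p of (a, b) \<Rightarrow> if coprime a b then ?F (a, b) else 0) =
       (\<Sum>e\<in>{1..E}. if e dvd fst p \<and> e dvd snd p then of_int (moebius_mu e) * ?F p else 0)"
      unfolding p by (simp only: prod.case fst_conv snd_conv)
  qed
  also have "\<dots> = (\<Sum>e\<in>{1..E}. \<Sum>p\<in>hpairs y. if e dvd fst p \<and> e dvd snd p then of_int (moebius_mu e) * ?F p else 0)"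
    by (rule sum.swap)
  also have "\<dots> = (\<Sum>e\<in>{1..E}. of_int (moebius_mu e) * hyperbola_sum f (y / (real e)\<^sup>2))"
  proof (rule sum.cong[OF refl])
    fix e assume "e \<in> {1..E}"
    hence e: "e \<ge> 1" by simp
    have "(\<Sum>p\<in>hpairs y. if e dvd fst p \<and> e dvd snd p then of_int (moebius_mu e) * ?F p else 0)
        = (\<Sum>p\<in>{p \<in> hpairs y. e dvd fst p \<and> e dvd snd p}. of_int (moebius_mu e) * ?F p)"
      by (rule sum.inter_filter[symmetric]) simp
    also have "\<dots> = of_int (moebius_mu e) * (\<Sum>p\<in>{p \<in> hpairs y. e dvd fst p \<and> e dvd snd p}. ?F p)"
      by (rule sum_distrib_left[symmetric])
    also have "{p \<in> hpairs y. e dvd fst p \<and> e dvd snd p} = {(a, b). (a, b) \<in> hpairs y \<and> e dvd a \<and> e dvd b}"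
      by auto
    also have "(\<Sum>p\<in>\<dots>. ?F p) = hyperbola_sum f (y / (real e)\<^sup>2)"
      unfolding scale_hpairs[OF e] hyperbola_sum_def
      by (subst sum.reindex[OF inj_on_scale[OF e]]) (simp only: comp_def case_prod_unfold fst_conv snd_conv scaled_floor)
    finally show "(\<Sum>p\<in>hpairs y. if e dvd fst p \<and> e dvd snd p then of_int (moebius_mu e) * ?F p else 0)
        = of_int (moebius_mu e) * hyperbola_sum f (y / (real e)\<^sup>2)" .
  qed
  finally show ?thesis by (simp only: E_def)
qed

text \<open>The exponent \<beta> is at least 4/7. As this exceeds 1/2, the errors summed over e
  still converge, and extending the main terms from e \<le> sqrt y to all e costs little more than
  y^(1/2). The maximum with 1 covers y < 1, where a power of y could fall below the main
  terms.\<close>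

lemma coprime_sum_asymptotics:
  fixes f :: "nat \<Rightarrow> complex"
  assumes \<alpha>: "0 \<le> \<alpha>" "\<alpha> < 1" and \<epsilon>: "0 < \<epsilon>" and B: "B \<ge> 0"
    and f: "\<And>k. k \<ge> 1 \<Longrightarrow> norm (f k) \<le> B * real k powr \<alpha>"
  shows "\<exists>C. \<forall>y>0. norm (coprime_sum f y - (C1 f / zeta 2 * of_real (y * ln y) + Cf f * of_real y))
     \<le> C * max 1 y powr ((4 + 3 * \<alpha>) / 7 + \<epsilon>)"
proof -
  define \<beta> where "\<beta> = (4 + 3 * \<alpha>) / 7 + \<epsilon>"
  have "4 / 7 \<le> (4 + 3 * \<alpha>) / 7" using \<alpha> by (intro divide_right_mono) auto
  hence "4 / 7 + 0 \<le> (4 + 3 * \<alpha>) / 7 + \<epsilon>" using \<epsilon> by (intro add_mono) auto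
  hence beta: "\<beta> \<ge> 4 / 7" by (simp only: \<beta>_def add_0_right)
  obtain C where C: "C > 0" "\<And>z. z \<ge> 1 \<Longrightarrow> norm (hyperbola_sum f z - (C1 f * of_real (z * ln z) + C2 f * of_real z)) \<le> C * z powr \<beta>"
    using hyperbola_sum_asymptotics[OF \<alpha> \<epsilon> B f] unfolding \<beta>_def by blast
  define c :: "nat \<Rightarrow> complex" where "c = (\<lambda>k. of_int (moebius_mu k) / of_nat (k ^ 2))"
  define g :: "nat \<Rightarrow> complex" where "g = (\<lambda>k. c k * (C2 f - 2 * C1 f * of_real (ln (real k))))"
  define D where "D = 2 powr (1 + 1 / 7) / (1 / 7 :: real)"
  \<comment> \<open>1/14 = 4/7 - 1/2 is the room left for a logarithm: truncating the series at sqrt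
    y saves y^(1/2) against y ln y.\<close>
  obtain Cl where Cl: "Cl > 0" "\<And>x::real. x \<ge> 1 \<Longrightarrow> (1 + ln x) ^ 1 \<le> Cl * x powr (1 / 14)"
    using log_power_le_powr[of "1 / 14" 1 1] by auto
  have cn: "norm (c k) \<le> 1 * real k powr (- 1 - 1)" if "k \<ge> 1" for k
    using norm_moebius_mu_term_le[OF that] by (simp add: c_def)
  define G where "G = (norm (C2 f) + 2 * norm (C1 f)) * Cl"
  have G: "G \<ge> 0" using Cl by (simp add: G_def)
  have gn: "norm (g k) \<le> G * real k powr (- 1 - 13 / 14)" if k: "k \<ge> 1" for k
  proof -
    have lk: "ln (real k) \<ge> 0" using k by simp
    have "norm (C2 f - 2 * C1 f * of_real (ln (real k))) \<le> norm (C2 f) + 2 * norm (C1 f) * ln (real k)"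
      using norm_triangle_ineq4[of "C2 f" "2 * C1 f * of_real (ln (real k))"] lk by (simp add: norm_mult)
    also have "\<dots> \<le> (norm (C2 f) + 2 * norm (C1 f)) * (1 + ln (real k))"
      using lk by (simp add: algebra_simps)
    also have "\<dots> \<le> (norm (C2 f) + 2 * norm (C1 f)) * (Cl * real k powr (1 / 14))"
      using Cl(2)[of "real k"] k by (intro mult_left_mono) auto
    finally have "norm (g k) \<le> (1 * real k powr (- 1 - 1)) * ((norm (C2 f) + 2 * norm (C1 f)) * (Cl * real k powr (1 / 14)))"
      unfolding g_def norm_mult[of "c k"] using cn[OF k] by (intro mult_mono) auto
    also have "\<dots> = G * (real k powr (- 1 - 1) * real k powr (1 / 14))" by (simp add: G_def)
    also have "real k powr (- 1 - 1) * real k powr (1 / 14) = real k powr (- 1 - 13 / 14)"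
      by (subst powr_add[symmetric]) simp
    finally show ?thesis .
  qed
  define D1 where "D1 = 1 * (2 powr (1 + 1) / 1 :: real)"
  define D2 where "D2 = G * (2 powr (1 + 13 / 14) / (13 / 14))"
  have tail1: "norm (1 / zeta 2 - (\<Sum>k\<in>{1..<N}. c k)) \<le> D1 * real N powr (- 1)" if "N \<ge> 1" for N
    unfolding sum_moebius_mu_over_squares[symmetric] c_def[symmetric] D1_def
    using that cn by (intro infsum_powr_tail(2)) auto
  have tail2: "norm (Cf f - (\<Sum>k\<in>{1..<N}. g k)) \<le> D2 * real N powr (- (13 / 14))" if "N \<ge> 1" for N
    unfolding Cf_def c_def[symmetric] D2_def
    using infsum_powr_tail(2)[of "13 / 14" G g N, OF _ G gn that] by (simp add: g_def c_def)
  have D12: "D1 \<ge> 0" "D2 \<ge> 0" using G by (simp_all add: D1_def D2_def)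
  have large: "norm (coprime_sum f y - (C1 f / zeta 2 * of_real (y * ln y) + Cf f * of_real y))
      \<le> (C * D + norm (C1 f) * D1 * Cl + D2) * y powr \<beta>" if y: "y \<ge> 1" for y
  proof -
    define E where "E = nat \<lfloor>sqrt y\<rfloor>"
    have E: "real E \<le> sqrt y" "sqrt y \<le> real (Suc E)" unfolding E_def using y by (simp, linarith)
    have ln_y: "ln y \<ge> 0" using y by simp
    let ?m = "\<lambda>z. C1 f * of_real (z * ln z) + C2 f * of_real z"
    have ye: "y / (real e)\<^sup>2 \<ge> 1" if "e \<in> {1..E}" for e
    proof -
      have "real e \<le> sqrt y" using that E(1) by auto
      hence "(real e)\<^sup>2 \<le> (sqrt y)\<^sup>2" by (intro power_mono) auto
      thus ?thesis using that y by (simp add: le_divide_eq)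
    qed
    have main: "(\<Sum>e\<in>{1..E}. of_int (moebius_mu e) * ?m (y / (real e)\<^sup>2))
        = C1 f * of_real (y * ln y) * (\<Sum>e\<in>{1..<Suc E}. c e) + of_real y * (\<Sum>e\<in>{1..<Suc E}. g e)"
    proof -
      have "(\<Sum>e\<in>{1..E}. of_int (moebius_mu e) * ?m (y / (real e)\<^sup>2))
          = (\<Sum>e\<in>{1..E}. C1 f * of_real (y * ln y) * c e + of_real y * g e)"
      proof (rule sum.cong[OF refl])
        fix e assume e: "e \<in> {1..E}"
        \<comment> \<open>The term - 2 ln e is where the summand - 2 \<open>C1 f\<close> ln k of
          \<open>Cf\<close> comes from.\<close>
        have ln: "ln (y / (real e)\<^sup>2) = ln y - 2 * ln (real e)" using e y by (simp add: ln_div ln_realpow)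
        show "of_int (moebius_mu e) * ?m (y / (real e)\<^sup>2) = C1 f * of_real (y * ln y) * c e + of_real y * g e"
          unfolding ln by (simp add: g_def c_def divide_inverse algebra_simps)
      qed
      also have "\<dots> = C1 f * of_real (y * ln y) * (\<Sum>e\<in>{1..E}. c e) + of_real y * (\<Sum>e\<in>{1..E}. g e)"
        by (simp only: sum.distrib sum_distrib_left)
      finally show ?thesis by (simp only: atLeastLessThanSuc_atLeastAtMost)
    qed
    have err: "norm (coprime_sum f y - (\<Sum>e\<in>{1..E}. of_int (moebius_mu e) * ?m (y / (real e)\<^sup>2))) \<le> C * D * y powr \<beta>"
    proof -
      have "coprime_sum f y - (\<Sum>e\<in>{1..E}. of_int (moebius_mu e) * ?m (y / (real e)\<^sup>2))
         = (\<Sum>e\<in>{1..E}. of_int (moebius_mu e) * (hyperbola_sum f (y / (real e)\<^sup>2) - ?m (y / (real e)\<^sup>2)))"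
      proof -
        have "y > 0" using y by simp
        thus ?thesis by (simp only: coprime_sum_eq_moebius E_def[symmetric] sum_subtractf right_diff_distrib)
      qed
      also have "norm \<dots> \<le> (\<Sum>e\<in>{1..E}. C * y powr \<beta> * real e powr (- 1 - 1 / 7))"
      proof (rule sum_norm_le)
        fix e assume e: "e \<in> {1..E}"
        have "norm (of_int (moebius_mu e) * (hyperbola_sum f (y / (real e)\<^sup>2) - ?m (y / (real e)\<^sup>2)))
           \<le> 1 * (C * (y / (real e)\<^sup>2) powr \<beta>)"
          unfolding norm_mult using abs_moebius_mu_le[of e] C(2)[OF ye[OF e]]
          by (intro mult_mono) (auto simp: norm_of_int simp flip: of_int_abs)
        also have "(y / (real e)\<^sup>2) powr \<beta> = y powr \<beta> * real e powr (- (2 * \<beta>))"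
        proof -
          have "(real e)\<^sup>2 = real e powr 2" using e by simp
          hence "(y / (real e)\<^sup>2) powr \<beta> = y powr \<beta> / (real e powr 2) powr \<beta>" by (simp only: powr_divide)
          also have "(real e powr 2) powr \<beta> = real e powr (2 * \<beta>)" by (rule powr_powr)
          finally show ?thesis by (simp only: powr_minus divide_inverse)
        qed
        \<comment> \<open>Here 2 \<beta> \<ge> 8/7, so the error terms are summable over e and no
          power of y is lost.\<close>
        also have "real e powr (- (2 * \<beta>)) \<le> real e powr (- 1 - 1 / 7)"
          using e beta by (intro powr_mono) auto
        finally show "norm (of_int (moebius_mu e) * (hyperbola_sum f (y / (real e)\<^sup>2) - ?m (y / (real e)\<^sup>2)))
            \<le> C * y powr \<beta> * real e powr (- 1 - 1 / 7)"
          using C(1) by (simp add: mult_left_mono)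
      qed
      also have "\<dots> = C * y powr \<beta> * (\<Sum>e\<in>{1..<Suc E}. real e powr (- 1 - 1 / 7))"
        by (simp add: sum_distrib_left atLeastLessThanSuc_atLeastAtMost)
      also have "\<dots> \<le> C * y powr \<beta> * (D * real 1 powr (- (1 / 7)))"
        unfolding D_def using C(1) by (intro mult_left_mono sum_powr_tail_le) auto
      finally show ?thesis by (simp add: mult_ac)
    qed
    have Ep: "real (Suc E) powr (- p) \<le> y powr (- p / 2)" if "p \<ge> 0" for p
    proof -
      have "real (Suc E) powr (- p) \<le> (sqrt y) powr (- p)" using E y that by (intro powr_mono2') auto
      also have "\<dots> = y powr (- p / 2)" using y by (simp add: powr_half_sqrt[symmetric] powr_powr)
      finally show ?thesis .
    qed
    have t1: "norm (C1 f * of_real (y * ln y) * (1 / zeta 2 - (\<Sum>e\<in>{1..<Suc E}. c e))) \<le> norm (C1 f) * D1 * Cl * y powr \<beta>"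
    proof -
      have "norm (C1 f * of_real (y * ln y) * (1 / zeta 2 - (\<Sum>e\<in>{1..<Suc E}. c e)))
         \<le> norm (C1 f) * (y * (Cl * y powr (1 / 14))) * (D1 * y powr (- 1 / 2))"
        unfolding norm_mult norm_of_real
      proof (intro mult_mono)
        show "norm (1 / zeta 2 - (\<Sum>e\<in>{1..<Suc E}. c e)) \<le> D1 * y powr (- 1 / 2)"
          using tail1[of "Suc E"] mult_left_mono[OF Ep[of 1] D12(1)] by simp
        have "\<bar>y * ln y\<bar> = y * ln y" using y ln_y by simp
        also have "\<dots> \<le> y * (Cl * y powr (1 / 14))" using y Cl(2)[OF y] by (intro mult_left_mono) auto
        finally show "\<bar>y * ln y\<bar> \<le> y * (Cl * y powr (1 / 14))" .
      qed (use y Cl in auto)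
      also have "\<dots> = norm (C1 f) * D1 * Cl * (y powr 1 * (y powr (1 / 14) * y powr (- 1 / 2)))"
        using y by simp
      also have "y powr 1 * (y powr (1 / 14) * y powr (- 1 / 2)) = y powr (1 + (1 / 14 + - 1 / 2))"
        by (simp only: powr_add)
      also have "norm (C1 f) * D1 * Cl * \<dots> \<le> norm (C1 f) * D1 * Cl * y powr \<beta>"
        using y beta D12 Cl by (intro mult_left_mono powr_mono) auto
      finally show ?thesis .
    qed
    have t2: "norm (of_real y * (Cf f - (\<Sum>e\<in>{1..<Suc E}. g e))) \<le> D2 * y powr \<beta>"
    proof -
      have "norm (of_real y * (Cf f - (\<Sum>e\<in>{1..<Suc E}. g e))) \<le> y * (D2 * y powr (- (13 / 14) / 2))"
        unfolding norm_mult norm_of_real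
      proof (intro mult_mono)
        show "norm (Cf f - (\<Sum>e\<in>{1..<Suc E}. g e)) \<le> D2 * y powr (- (13 / 14) / 2)"
          using tail2[of "Suc E"] mult_left_mono[OF Ep[of "13 / 14"] D12(2)] by simp
      qed (use y in auto)
      also have "\<dots> = D2 * (y powr 1 * y powr (- (13 / 14) / 2))" using y by simp
      also have "y powr 1 * y powr (- (13 / 14) / 2) = y powr (1 + (- (13 / 14) / 2))"
        by (simp only: powr_add)
      also have "D2 * \<dots> \<le> D2 * y powr \<beta>"
        using y beta D12 by (intro mult_left_mono powr_mono) auto
      finally show ?thesis .
    qed
    define M where "M = (\<Sum>e\<in>{1..E}. of_int (moebius_mu e) * ?m (y / (real e)\<^sup>2))"
    have "coprime_sum f y - (C1 f / zeta 2 * of_real (y * ln y) + Cf f * of_real y)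
       = (coprime_sum f y - M) - C1 f * of_real (y * ln y) * (1 / zeta 2 - (\<Sum>e\<in>{1..<Suc E}. c e))
         - of_real y * (Cf f - (\<Sum>e\<in>{1..<Suc E}. g e))"
      unfolding M_def main by (simp add: algebra_simps)
    also have "norm \<dots> \<le> norm (coprime_sum f y - M) + norm (C1 f * of_real (y * ln y) * (1 / zeta 2 - (\<Sum>e\<in>{1..<Suc E}. c e)))
         + norm (of_real y * (Cf f - (\<Sum>e\<in>{1..<Suc E}. g e)))"
      by (intro order.trans[OF norm_triangle_ineq4] add_mono order_refl)
    also have "\<dots> \<le> C * D * y powr \<beta> + norm (C1 f) * D1 * Cl * y powr \<beta> + D2 * y powr \<beta>"
      using err t1 t2 unfolding M_def by (intro add_mono)
    finally show ?thesis by (simp add: algebra_simps)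
  qed
  \<comment> \<open>No pair has product at most y, so the sum is empty and only the main terms must
    be bounded, using y |ln y| \<le> 1.\<close>
  have small: "norm (coprime_sum f y - (C1 f / zeta 2 * of_real (y * ln y) + Cf f * of_real y))
      \<le> norm (C1 f / zeta 2) + norm (Cf f)" if y: "0 < y" "y < 1" for y
  proof -
    have "nat \<lfloor>sqrt y\<rfloor> = 0" using y by (simp add: floor_eq_iff)
    hence 0: "coprime_sum f y = 0" using y by (simp add: coprime_sum_eq_moebius)
    have "\<bar>y * ln y\<bar> \<le> 1"
    proof -
      have "ln (1 / y) \<le> 1 / y - 1" using y by (intro ln_le_minus_one) auto
      hence "y * - ln y \<le> y * (1 / y - 1)" using y by (intro mult_left_mono) (auto simp: ln_div)
      also have "\<dots> = 1 - y" using y by (simp add: field_simps)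
      finally have "- (y * ln y) \<le> 1" using y by simp
      moreover have "y * ln y \<le> 0" using y by (simp add: mult_le_0_iff)
      ultimately show ?thesis by simp
    qed
    hence "norm (C1 f / zeta 2 * of_real (y * ln y) + Cf f * of_real y) \<le> norm (C1 f / zeta 2) * 1 + norm (Cf f) * 1"
      using y by (intro order.trans[OF norm_triangle_ineq] add_mono)
        (auto simp only: norm_mult norm_of_real norm_ge_zero intro!: mult_left_mono)
    thus ?thesis by (simp only: 0 diff_0 norm_minus_cancel mult_1_right)
  qed
  define K where "K = max (norm (C1 f / zeta 2) + norm (Cf f)) (C * D + norm (C1 f) * D1 * Cl + D2)"
  have "norm (coprime_sum f y - (C1 f / zeta 2 * of_real (y * ln y) + Cf f * of_real y)) \<le> K * max 1 y powr \<beta>"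
    if y: "y > 0" for y
  proof (cases "y < 1")
    case True
    thus ?thesis using small[OF y True] by (simp add: K_def)
  next
    case False
    hence F: "y \<ge> 1" by simp
    have "(C * D + norm (C1 f) * D1 * Cl + D2) * y powr \<beta> \<le> K * y powr \<beta>"
      unfolding K_def by (intro mult_right_mono) auto
    moreover have "max 1 y = y" using F by simp
    ultimately show ?thesis using order.trans[OF large[OF F]] by (simp only:)
  qed
  thus ?thesis unfolding \<beta>_def by blast
qed

theorem theorem1:
  fixes f :: "nat \<Rightarrow> complex" and \<alpha> \<epsilon> A :: real
  assumes "0 \<le> \<alpha>" and "\<alpha> < 1"
    and "(\<lambda>n. norm (f n)) \<in> O(\<lambda>n. real n powr \<alpha>)"
    and "\<epsilon> > 0"
  shows "\<exists>K::real. \<forall>\<^sub>F x in at_top. \<forall>d::nat.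
           d \<ge> 1 \<longrightarrow> real d \<le> A * x powr ((3 - 3 * \<alpha>) / 14 - \<epsilon>) \<longrightarrow>
           norm (S2 f d x
                 - (C1 f / zeta 2 * of_real (x / (real d)\<^sup>2 * ln (x / (real d)\<^sup>2))
                    + Cf f * of_real (x / (real d)\<^sup>2)))
             \<le> K * x powr ((4 + 3 * \<alpha>) / 7 + \<epsilon>)"
proof -
  obtain c where c: "c > 0" "eventually (\<lambda>n. norm (norm (f n)) \<le> c * norm (real n powr \<alpha>)) at_top"
    using landau_o.bigE[OF assms(3)] by blast
  then obtain N where N: "\<And>n. n \<ge> N \<Longrightarrow> norm (f n) \<le> c * real n powr \<alpha>"
    by (auto simp: eventually_at_top_linorder)
  \<comment> \<open>The finitely many k < N are absorbed into the constant, because k^\<alpha> \<ge>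
    1 for k \<ge> 1.\<close>
  define B where "B = c + (\<Sum>n<N. norm (f n))"
  have B: "B \<ge> 0" "B \<ge> c" using c by (auto simp: B_def sum_nonneg intro!: add_nonneg_nonneg)
  have f: "norm (f k) \<le> B * real k powr \<alpha>" if k: "k \<ge> 1" for k
  proof (cases "k < N")
    case True
    have "norm (f k) \<le> (\<Sum>n<N. norm (f n))" using True by (intro member_le_sum) auto
    also have "\<dots> \<le> B * 1" using c by (simp add: B_def)
    also have "\<dots> \<le> B * real k powr \<alpha>" using k assms B by (intro mult_left_mono ge_one_powr_ge_zero) auto
    finally show ?thesis .
  next
    case False
    hence "norm (f k) \<le> c * real k powr \<alpha>" by (intro N) auto
    also have "\<dots> \<le> B * real k powr \<alpha>" using B by (intro mult_right_mono) auto
    finally show ?thesis .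
  qed
  obtain C where C: "\<And>y. y > 0 \<Longrightarrow> norm (coprime_sum f y - (C1 f / zeta 2 * of_real (y * ln y) + Cf f * of_real y))
     \<le> C * max 1 y powr ((4 + 3 * \<alpha>) / 7 + \<epsilon>)"
    using coprime_sum_asymptotics[OF assms(1,2,4) B(1) f] by blast
  have "norm (S2 f d x - (C1 f / zeta 2 * of_real (x / (real d)\<^sup>2 * ln (x / (real d)\<^sup>2)) + Cf f * of_real (x / (real d)\<^sup>2)))
      \<le> \<bar>C\<bar> * x powr ((4 + 3 * \<alpha>) / 7 + \<epsilon>)" if "x \<ge> 1" "d \<ge> 1" for x d
  proof -
    define y where "y = x / (real d)\<^sup>2"
    have y: "y > 0" "y \<le> x"
    proof -
      show "y > 0" using that by (simp add: y_def)
      have "x / (real d)\<^sup>2 \<le> x / 1" using that by (intro divide_left_mono) auto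
      thus "y \<le> x" by (simp add: y_def)
    qed
    have "norm (coprime_sum f y - (C1 f / zeta 2 * of_real (y * ln y) + Cf f * of_real y))
       \<le> C * max 1 y powr ((4 + 3 * \<alpha>) / 7 + \<epsilon>)" by (rule C[OF y(1)])
    \<comment> \<open>Both 1 and y are at most x. The constant was fixed before d, which gives
      uniformity; its sign is unknown, hence the absolute value.\<close>
    also have "\<dots> \<le> \<bar>C\<bar> * x powr ((4 + 3 * \<alpha>) / 7 + \<epsilon>)"
      using that y assms by (intro mult_mono powr_mono2) auto
    finally show ?thesis unfolding y_def S2_eq_coprime_sum[OF that(2)] .
  qed
  thus ?thesis
    by (intro exI[of _ "\<bar>C\<bar>"] eventually_at_top_linorderI[of 1]) blast
qed

end
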